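(* Let $\tau\in\mathbb{H}$, $q=e^{2\pi i\tau}$, and let $\alpha$ be any complex number with $\alpha\neq 2n\tau+m$ for all $m,n\in\mathbb{Z}$. Put $w=e^{2\pi i\alpha}$. Then $$w\bigl(g_2(w;q)+g_2(-w;q)\bigr)=\frac{2\eta^4(2\tau)}{\eta^2(\tau)\,\vartheta(2\alpha;2\tau)},$$ a meromorphic Jacobi form. If $\alpha=r\tau+s$ with $r,s\in\mathbb{Q}$, then this function multiplied by $q^{-r^2}$ is a weakly holomorphic modular form of weight $1/2$ on a subgroup of $SL_2(\mathbb{Z})$ depending on $r$.
   Context: Notation: for $\lambda\in\mathbb{Q}$, $q^\lambda:=e^{2\pi i\lambda\tau}$. $(a;q)_0=1$, $(a;q)_n=\prod_{j=0}^{n-1}(1-aq^j)$. $g_2(w;q)=\sum_{n\ge0}\frac{(-q;q)_n\,q^{n(n+1)/2}}{(w;q)_{n+1}(q/w;q)_{n+1}}$. $\eta(\tau)=q^{1/24}\prod_{n\ge1}(1-q^n)$. $\vartheta(z;\tau)=\sum_{n\in\mathbb{Z}}(-1)^n e^{\pi i(2n+1)z}q^{n(n+1)/2+1/8}$.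
   Formalization: The right side carries −2 instead of 2 (printed sign fails as q→0); where 2α=2nτ+m both sides are shown to have poles instead of being equal; for α=rτ+s the case r∈ℤ, 2s∈ℤ, where the function is undefined, is excluded; the subgroup may depend on r and s. *)

theory Defs
  imports "HOL-Complex_Analysis.Complex_Analysis" "HOL-Algebra.Coset"
begin

subsection \<open>The \<open>q\<close>-series\<close>

definition e2pi :: "complex \<Rightarrow> complex" where
  "e2pi z = exp (2 * of_real pi * \<i> * z)"

text \<open>The nome is \<open>q = e2pi \<tau>\<close>, and \<open>q\<close> to a rational power \<open>\<lambda>\<close> always means \<open>e2pi (\<lambda> * \<tau>)\<close>.\<close>

definition qpoch :: "complex \<Rightarrow> complex \<Rightarrow> nat \<Rightarrow> complex" where
  "qpoch a q n = (\<Prod>j<n. 1 - a * q ^ j)"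

definition g2 :: "complex \<Rightarrow> complex \<Rightarrow> complex" where
  "g2 w q = (\<Sum>n. qpoch (- q) q n * q ^ (n * (n + 1) div 2)
                    / (qpoch w q (n + 1) * qpoch (q / w) q (n + 1)))"

definition eta :: "complex \<Rightarrow> complex" where
  "eta \<tau> = e2pi (\<tau> / 24) * (\<Prod>n. 1 - e2pi \<tau> ^ (n + 1))"

definition theta :: "complex \<Rightarrow> complex \<Rightarrow> complex" where
  "theta z \<tau> = (\<Sum>\<^sub>\<infinity>n\<in>(UNIV :: int set).
     (-1) powi n * exp (of_real pi * \<i> * of_int (2 * n + 1) * z)
       * e2pi ((of_int (n * (n + 1)) / 2 + 1 / 8) * \<tau>))"

definition g2_sum :: "complex \<Rightarrow> complex \<Rightarrow> complex" where
  "g2_sum \<alpha> \<tau> = e2pi \<alpha> * (g2 (e2pi \<alpha>) (e2pi \<tau>) + g2 (- e2pi \<alpha>) (e2pi \<tau>))"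


subsection \<open>The modular group\<close>

definition upper_half_plane :: "complex set" where
  "upper_half_plane = {\<tau>. Im \<tau> > 0}"

definition SL2Z :: "(int ^ 2 ^ 2) monoid" where
  "SL2Z = \<lparr>carrier = {A. det A = 1}, mult = (**), one = mat 1\<rparr>"

definition principal_congruence_subgroup :: "nat \<Rightarrow> (int ^ 2 ^ 2) set" where
  "principal_congruence_subgroup N =
     {A \<in> carrier SL2Z. \<forall>i j. int N dvd A $ i $ j - (mat 1 :: int ^ 2 ^ 2) $ i $ j}"

definition congruence_subgroup :: "(int ^ 2 ^ 2) set \<Rightarrow> bool" where
  "congruence_subgroup \<Gamma> \<longleftrightarrow>
     subgroup \<Gamma> SL2Z \<and> (\<exists>N>0. principal_congruence_subgroup N \<subseteq> \<Gamma>)"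

definition automorphy :: "int ^ 2 ^ 2 \<Rightarrow> complex \<Rightarrow> complex" where
  "automorphy A \<tau> = of_int (A $ 2 $ 1) * \<tau> + of_int (A $ 2 $ 2)"

definition moebius :: "int ^ 2 ^ 2 \<Rightarrow> complex \<Rightarrow> complex" where
  "moebius A \<tau> = (of_int (A $ 1 $ 1) * \<tau> + of_int (A $ 1 $ 2)) / automorphy A \<tau>"


subsection \<open>Weakly holomorphic modular forms\<close>

text \<open>
  The weight may be half-integral; \<open>powr\<close> is the principal branch, and the automorphy factor
  comes with a multiplier system \<open>v\<close> whose values are roots of unity of bounded order. The last
  condition is meromorphy at all cusps: for each \<open>A\<close> in the full modular group, \<open>f|A\<close> is a Laurent
  series in \<open>e2pi (\<tau> / N)\<close> with finitely many negative exponents.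
\<close>

definition weakly_holomorphic_modular_form ::
    "real \<Rightarrow> (int ^ 2 ^ 2) set \<Rightarrow> (complex \<Rightarrow> complex) \<Rightarrow> bool" where
  "weakly_holomorphic_modular_form k \<Gamma> f \<longleftrightarrow>
     f holomorphic_on upper_half_plane \<and>
     (\<exists>M>0. \<exists>v :: int ^ 2 ^ 2 \<Rightarrow> complex. \<forall>A\<in>\<Gamma>. v A ^ M = 1 \<and>
        (\<forall>\<tau>\<in>upper_half_plane.
           f (moebius A \<tau>) = v A * automorphy A \<tau> powr of_real k * f \<tau>)) \<and>
     (\<forall>A\<in>carrier SL2Z. \<exists>N::nat. N > 0 \<and> (\<exists>g. g meromorphic_on {0} \<and>
        (\<forall>\<tau>\<in>upper_half_plane.
           automorphy A \<tau> powr of_real (- k) * f (moebius A \<tau>) = g (e2pi (\<tau> / of_nat N)))))"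


subsection \<open>Meromorphic functions of two variables\<close>

definition holomorphic2_on :: "(complex \<times> complex \<Rightarrow> complex) \<Rightarrow> (complex \<times> complex) set \<Rightarrow> bool" where
  "holomorphic2_on f U \<longleftrightarrow>
     (\<forall>p\<in>U. \<exists>a b. (f has_derivative (\<lambda>(x, y). a * x + b * y)) (at p))"

text \<open>
  A meromorphic function is locally a quotient \<open>P / Q\<close> of holomorphic functions, where \<open>Q\<close> vanishes
  identically on no nonempty open set. The values of \<open>f\<close> at zeros of \<open>Q\<close> are irrelevant.
\<close>

definition meromorphic2_on :: "(complex \<times> complex \<Rightarrow> complex) \<Rightarrow> (complex \<times> complex) set \<Rightarrow> bool" where
  "meromorphic2_on f U \<longleftrightarrow>
     (\<forall>p\<in>U. \<exists>V P Q. open V \<and> p \<in> V \<and> holomorphic2_on P V \<and> holomorphic2_on Q V \<and>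
        (\<forall>W. open W \<and> W \<noteq> {} \<and> W \<subseteq> V \<longrightarrow> (\<exists>x\<in>W. Q x \<noteq> 0)) \<and>
        (\<forall>x\<in>V. Q x \<noteq> 0 \<longrightarrow> f x = P x / Q x))"

definition regular2_at :: "(complex \<times> complex \<Rightarrow> complex) \<Rightarrow> complex \<times> complex \<Rightarrow> bool" where
  "regular2_at f p \<longleftrightarrow> (\<exists>V. open V \<and> p \<in> V \<and> holomorphic2_on f V)"


subsection \<open>Meromorphic Jacobi forms\<close>

text \<open>
  Weight \<open>k\<close> and index \<open>m\<close>, with multipliers \<open>v\<close> on \<open>\<Gamma>\<close> and \<open>u\<close> on the lattice. The transformation
  laws are identities of meromorphic functions, so they are imposed where both sides are regular
  (HOL functions also have values at poles, and these carry no information). Meromorphy at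
  the cusps: for each \<open>A\<close> in the full modular group, \<open>\<phi>|A\<close> is a function of \<open>z\<close> and of
  \<open>t = e2pi (\<tau> / N)\<close> that extends meromorphically across \<open>t = 0\<close>.
\<close>

definition meromorphic_jacobi_form ::
    "real \<Rightarrow> real \<Rightarrow> (int ^ 2 ^ 2) set \<Rightarrow> (complex \<times> complex \<Rightarrow> complex) \<Rightarrow> bool" where
  "meromorphic_jacobi_form k m \<Gamma> \<phi> \<longleftrightarrow>
     meromorphic2_on \<phi> (UNIV \<times> upper_half_plane) \<and>
     (\<exists>M>0. \<exists>v :: int ^ 2 ^ 2 \<Rightarrow> complex. \<forall>A\<in>\<Gamma>. v A ^ M = 1 \<and>
        (\<forall>z. \<forall>\<tau>\<in>upper_half_plane.
           regular2_at \<phi> (z, \<tau>) \<and> regular2_at \<phi> (z / automorphy A \<tau>, moebius A \<tau>) \<longrightarrow>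
           \<phi> (z / automorphy A \<tau>, moebius A \<tau>) =
             v A * automorphy A \<tau> powr of_real k
               * e2pi (of_real m * of_int (A $ 2 $ 1) * z ^ 2 / automorphy A \<tau>) * \<phi> (z, \<tau>))) \<and>
     (\<exists>M>0. \<exists>u :: int \<Rightarrow> int \<Rightarrow> complex. \<forall>a b. u a b ^ M = 1 \<and>
        (\<forall>z. \<forall>\<tau>\<in>upper_half_plane.
           regular2_at \<phi> (z, \<tau>) \<and> regular2_at \<phi> (z + of_int a * \<tau> + of_int b, \<tau>) \<longrightarrow>
           \<phi> (z + of_int a * \<tau> + of_int b, \<tau>) =
             u a b * e2pi (- of_real m * (of_int a ^ 2 * \<tau> + 2 * of_int a * z)) * \<phi> (z, \<tau>))) \<and>
     (\<forall>A\<in>carrier SL2Z. \<exists>N::nat. N > 0 \<and> (\<exists>G. meromorphic2_on G (UNIV \<times> ball 0 1) \<and>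
        (\<forall>z. \<forall>\<tau>\<in>upper_half_plane.
           regular2_at \<phi> (z / automorphy A \<tau>, moebius A \<tau>) \<longrightarrow>
           automorphy A \<tau> powr of_real (- k)
             * e2pi (- of_real m * of_int (A $ 2 $ 1) * z ^ 2 / automorphy A \<tau>)
             * \<phi> (z / automorphy A \<tau>, moebius A \<tau>) = G (z, e2pi (\<tau> / of_nat N)))))"

end

theory Submission
  imports Defs
begin

text \<open>
  Each summand of \<open>g2 w q\<close> is expanded into partial fractions in \<open>w\<close>. The coefficients can be summed in
  closed form by telescoping, which gives
  \<open>g2 w q = (- q; q) / (q; q) * (\<Sum>k\<in>\<int>. (-1)^k q^(k (k + 1)) / (1 - w q^k))\<close> with infinite products \<open>( ; q)\<close>.
  Adding the value at \<open>- w\<close> leaves the same kind of sum in \<open>w\<^sup>2\<close> and \<open>q\<^sup>2\<close>, and this is the partial fraction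
  expansion of the reciprocal of a theta product. With the triple product, \<open>g2_sum\<close> becomes the quotient
  \<open>- 2 * phi\<close> of eta and theta functions.

  By Liouville's theorem \<open>theta (z / \<tau>) (- 1 / \<tau>)\<close> is \<open>C * e2pi (z\<^sup>2 / (2 * \<tau>)) * theta z \<tau>\<close>. The derivative
  at \<open>0\<close> and the product over the three half periods give two relations between \<open>C\<close> and \<open>eta (- 1 / \<tau>) / eta \<tau>\<close>;
  together they determine both up to roots of unity, which are constant because the half-plane is connected.
  The laws extend to the full modular group by Euclid's algorithm. At an arbitrary cusp, \<open>phi\<close> is again a
  quotient of eta and theta functions, now of arguments \<open>2 * \<tau>\<close>, \<open>\<tau> / 2\<close> or \<open>(\<tau> + 1) / 2\<close>.
\<close>


text \<open>The minus sign in \<open>- 2 * phi\<close> comes from the normalisation of theta: to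
  order q^0 the left side is 2 w / (1 - w^2), while \<open>theta (2 * \<alpha>) (2 * \<tau>)\<close>
  begins with q^(1/4) (w - 1 / w). Adding the value at - w closes up because the extra power of q in
  the sum for g2 turns q^(k (k + 1) / 2) into (q^2)^(k (k + 1) / 2), just the exponent that base q^2
  requires. All series identities rest on one family of finite coefficients, essentially Gaussian
  binomials of 2 n + 1 over n - k. They expand the reciprocal of a finite theta product and also the
  product itself, so every infinite identity is a rational one followed by a dominated limit, and no
  residue calculus enters. Multipliers are never computed: only a power in which the root of unity
  disappears is proved, and this also absorbs the branches of the square roots. The poles form the
  set 2 \<alpha> in 2 Z \<tau> + Z, larger than the excluded set \<alpha> in 2 Z \<tau> + Z; for
  instance \<alpha> = 1/2 is a pole. Values of HOL functions at poles have to be kept out of every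
  law.\<close>

no_notation fps_nth (infixl "$" 75)

subsection \<open>Infinite \<open>q\<close>-products\<close>

definition qinf :: "complex \<Rightarrow> complex \<Rightarrow> complex" where
  "qinf a q = (\<Prod>n. 1 - a * q ^ n)"

lemma convergent_prod_qinf:
  fixes a q :: complex
  assumes "norm q < 1"
  shows "convergent_prod (\<lambda>n. 1 - a * q ^ n)"
proof -
  have "summable (\<lambda>n. norm a * norm q ^ n)"
    using assms by (intro summable_mult summable_geometric) auto
  moreover have "norm (1 - a * q ^ n - 1) = norm a * norm q ^ n" for n
    by (simp add: norm_mult norm_power)
  ultimately have "summable (\<lambda>n. norm (1 - a * q ^ n - 1))"
    by simp
  thus ?thesis
    by (intro abs_convergent_prod_imp_convergent_prod summable_imp_abs_convergent_prod)
qed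

lemma qpoch_0 [simp]: "qpoch a q 0 = 1"
  by (simp add: qpoch_def)

lemma qpoch_Suc: "qpoch a q (Suc n) = qpoch a q n * (1 - a * q ^ n)"
  by (simp add: qpoch_def)

lemma qpoch_tendsto:
  assumes "norm q < 1"
  shows "(\<lambda>n. qpoch a q n) \<longlonglongrightarrow> qinf a q"
  using convergent_prod_LIMSEQ[OF convergent_prod_qinf[OF assms, of a]]
  unfolding qpoch_def qinf_def by (simp add: LIMSEQ_lessThan_iff_atMost)

text \<open>A convergent infinite product tends to zero only through a vanishing factor. All later
  statements about zeros of theta and eta reduce to this.\<close>

lemma qinf_eq_0_iff:
  assumes "norm q < 1"
  shows "qinf a q = 0 \<longleftrightarrow> (\<exists>n. a * q ^ n = 1)"
proof -
  have "(\<lambda>n. \<Prod>i\<le>n. 1 - a * q ^ i) \<longlonglongrightarrow> qinf a q"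
    unfolding qinf_def by (rule convergent_prod_LIMSEQ[OF convergent_prod_qinf[OF assms]])
  hence "qinf a q = 0 \<longleftrightarrow> (\<lambda>n. \<Prod>i\<le>n. 1 - a * q ^ i) \<longlonglongrightarrow> 0"
    using LIMSEQ_unique by metis
  also have "\<dots> \<longleftrightarrow> (\<exists>n. 1 - a * q ^ n = 0)"
    by (rule convergent_prod_to_zero_iff[OF convergent_prod_qinf[OF assms]])
  finally show ?thesis by (metis eq_iff_diff_eq_0)
qed

lemma qinf_split:
  assumes "norm q < 1"
  shows "qinf a q = qpoch a q m * qinf (a * q ^ m) q"
proof -
  have "(\<lambda>n. qpoch a q m * qpoch (a * q ^ m) q n) \<longlonglongrightarrow> qpoch a q m * qinf (a * q ^ m) q"
    by (intro tendsto_intros qpoch_tendsto assms)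
  moreover have "qpoch a q m * qpoch (a * q ^ m) q n = qpoch a q (n + m)" for n
    by (induction n) (auto simp: qpoch_Suc power_add mult_ac)
  ultimately show ?thesis
    using LIMSEQ_ignore_initial_segment[OF qpoch_tendsto[OF assms, of a], of m] LIMSEQ_unique
    by auto
qed

lemma qinf_shift:
  assumes "norm q < 1"
  shows "qinf a q = (1 - a) * qinf (a * q) q"
  using qinf_split[OF assms, of a 1] by (simp add: qpoch_Suc)

text \<open>Factor by factor, (1 - a q^j) (1 + a q^j) = 1 - a^2 q^(2 j).\<close>

lemma qinf_mult_neg:
  assumes "norm q < 1"
  shows "qinf a q * qinf (- a) q = qinf (a ^ 2) (q ^ 2)"
proof -
  have "norm (q ^ 2) < 1"
    using assms by (simp add: norm_power power_less_one_iff)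
  moreover have "qpoch a q n * qpoch (- a) q n = qpoch (a ^ 2) (q ^ 2) n" for n
    unfolding qpoch_def prod.distrib[symmetric]
    by (intro prod.cong) (auto simp: algebra_simps power2_eq_square power_mult_distrib)
  ultimately show ?thesis
    using LIMSEQ_unique tendsto_mult[OF qpoch_tendsto[OF assms, of a] qpoch_tendsto[OF assms, of "-a"]]
      qpoch_tendsto[of "q ^ 2" "a ^ 2"] by simp
qed

lemma qpoch_bounded:
  assumes "norm q < 1"
  obtains K where "K > 0" "\<And>n. norm (qpoch a q n) \<le> K"
  using convergent_imp_Bseq[OF convergentI[OF qpoch_tendsto[OF assms, of a]]]
  unfolding Bseq_def by blast

lemma power_neq_1:
  fixes q :: complex
  assumes "norm q < 1"
  shows "q ^ Suc n \<noteq> 1"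
proof
  assume "q ^ Suc n = 1"
  hence "norm q ^ Suc n = 1" by (metis norm_one norm_power)
  thus False using assms by (metis norm_ge_zero power_less_one_iff less_irrefl zero_less_Suc power_Suc_less_one)
qed

lemma qpoch_self_nonzero:
  assumes "norm q < 1"
  shows "qpoch q q n \<noteq> 0"
  unfolding qpoch_def using power_neq_1[OF assms] by (auto simp: eq_commute[of 1])

lemma qinf_self_nonzero:
  assumes "norm q < 1"
  shows "qinf q q \<noteq> 0"
  using qinf_eq_0_iff[OF assms] power_neq_1[OF assms] by auto

lemma qpoch_self_inverse_bounded:
  assumes "norm q < 1"
  obtains K where "K > 0" "\<And>n. norm (inverse (qpoch q q n)) \<le> K"
  using convergent_imp_Bseq[OF convergentI[OF tendsto_inverse[OF qpoch_tendsto[OF assms, of q]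
        qinf_self_nonzero[OF assms]]]]
  unfolding Bseq_def by blast

section \<open>Triangular exponents\<close>

abbreviation (input) tri :: "nat \<Rightarrow> nat" where
  "tri n \<equiv> n * (n + 1) div 2"

lemma tri_Suc: "tri (Suc n) = tri n + Suc n"
  by (induction n) auto

lemma tri_add: "tri (k + m) = tri k + tri m + k * m"
proof (induction m)
  case (Suc m)
  have "tri (k + Suc m) = tri (k + m) + Suc (k + m)"
    using tri_Suc[of "k + m"] by simp
  thus ?case using Suc tri_Suc[of m] by simp
qed auto

lemma tri_ge: "n \<le> tri n"
proof (induction n)
  case (Suc n)
  show ?case by (subst tri_Suc) auto
qed auto

lemma summable_power_tri:
  fixes q :: complex
  assumes "norm q < 1"
  shows "summable (\<lambda>n. norm q ^ tri n)" "norm q ^ tri n \<le> norm q ^ n"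
proof -
  show *: "norm q ^ tri n \<le> norm q ^ n" for n
    using assms by (intro power_decreasing tri_ge) auto
  show "summable (\<lambda>n. norm q ^ tri n)"
    by (rule summable_comparison_test[OF _ summable_geometric[of "norm q"]])
       (use * assms in auto)
qed

subsection \<open>Partial fractions\<close>

text \<open>The terms with index \<open>k\<close> and \<open>- 1 - k\<close> of \<open>\<Sum>k\<in>\<int>. (-1)^k q^(k (k + 1) / 2) / (1 - w q^k)\<close>, without the common factor \<open>(-1)^k q^(k (k + 1) / 2)\<close>.\<close>

definition lterm :: "complex \<Rightarrow> complex \<Rightarrow> nat \<Rightarrow> complex" where
  "lterm w q k = 1 / (1 - w * q ^ k) + (q ^ (k + 1) / w) / (1 - q ^ (k + 1) / w)"

text \<open>The Gaussian binomial coefficient of 2 n + 1 over n - k, divided by (q; q)_(2 n + 1).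
  The value 0 for k > n lets sums over k be lengthened freely.\<close>

definition pcoeff :: "complex \<Rightarrow> nat \<Rightarrow> nat \<Rightarrow> complex" where
  "pcoeff q n k = (if k \<le> n then 1 / (qpoch q q (n - k) * qpoch q q (n + k + 1)) else 0)"

text \<open>Stated without division so that k = Suc n is included: there the factor 1 - q^0 and the
  right side are both zero.\<close>

lemma pcoeff_Suc:
  assumes "norm q < 1" "k \<le> Suc n"
  shows "pcoeff q (Suc n) k * ((1 - q ^ (Suc n - k)) * (1 - q ^ (n + k + 2))) = pcoeff q n k"
proof (cases "k \<le> n")
  case True
  have "Suc n - k = Suc (n - k)" using True by simp
  hence 1: "qpoch q q (Suc n - k) = qpoch q q (n - k) * (1 - q ^ (Suc n - k))"
    by (simp add: qpoch_Suc)
  have 2: "qpoch q q (Suc n + k + 1) = qpoch q q (n + k + 1) * (1 - q ^ (n + k + 2))"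
    by (simp add: qpoch_Suc)
  have "1 - q ^ (Suc n - k) \<noteq> 0" "1 - q ^ (n + k + 2) \<noteq> 0"
    using power_neq_1[OF assms(1), of "n - k"] power_neq_1[OF assms(1), of "n + k + 1"] True
    by (auto simp: Suc_diff_le)
  moreover have "1 / (a * x * (b * y)) * (x * y) = 1 / (a * b)" if "x \<noteq> 0" "y \<noteq> 0" for a b x y :: complex
    using that by simp
  ultimately show ?thesis unfolding pcoeff_def 1 2 using True by simp
next
  case False
  thus ?thesis using assms(2) by (simp add: pcoeff_def)
qed

text \<open>These are the coefficients of the w-free remainders that \<open>lterm_mult\<close>
  leaves in the induction step of \<open>partial_fractions\<close>; the step works because they
  cancel in total.\<close>

lemma telescope_pcoeff:
  fixes q :: complex
  assumes "norm q < 1" "q \<noteq> 0" "n \<ge> 1"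
  shows "(\<Sum>k\<le>n. (-1) ^ k * q ^ tri k * pcoeff q n k * (1 / q ^ k - q ^ (k + 1))) = 0"
proof -
  \<comment> \<open>The antidifference of the summand, from the ansatz with a factor \<open>A + B * q ^ k\<close>.\<close>
  define g where "g = (\<lambda>k. (-1) ^ k * q ^ tri k / q ^ k * (1 - q ^ k) / (1 - q ^ n) /
     (qpoch q q (n - k) * qpoch q q (n + k)))"
  obtain m where m: "n = Suc m" using assms(3) by (cases n) auto
  have qn: "1 - q ^ n \<noteq> 0" using power_neq_1[OF assms(1), of m] m by auto
  note nz = qpoch_self_nonzero[OF assms(1)]
  have tri': "q ^ tri (Suc k) = q ^ tri k * q ^ Suc k" for k
    by (subst tri_Suc) (simp only: power_add)
  have *: "(\<Sum>k<K. (-1) ^ k * q ^ tri k * pcoeff q n k * (1 / q ^ k - q ^ (k + 1))) = - g K"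
    if "K \<le> n" for K
    using that
  proof (induction K)
    case 0
    show ?case by (simp add: g_def)
  next
    case (Suc K)
    define X Y a b where "X = q ^ K" and "Y = q ^ (n - K)" and
      "a = qpoch q q (n - Suc K)" and "b = qpoch q q (n + K)"
    have nK: "n - K = Suc (n - Suc K)" using Suc.prems by simp
    have a: "qpoch q q (n - K) = a * (1 - Y)"
      unfolding a_def Y_def by (subst nK, subst qpoch_Suc) (use Suc.prems in \<open>simp add: nK[symmetric] power_Suc[symmetric] del: power_Suc\<close>)
    have b: "qpoch q q (n + K + 1) = b * (1 - X * X * Y * q)"
      unfolding b_def X_def Y_def using Suc.prems
      by (simp add: qpoch_Suc power_Suc[symmetric] power_add[symmetric] mult_ac del: power_Suc)
    have XY: "q ^ n = X * Y" unfolding X_def Y_def using Suc.prems by (simp flip: power_add)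
    have ab: "a \<noteq> 0" "b \<noteq> 0" "1 - Y \<noteq> 0" "1 - X * X * Y * q \<noteq> 0"  "X \<noteq> 0"
      using nz[of "n - K"] nz[of "n + K + 1"] assms(2) unfolding a b X_def by auto
    have pc: "pcoeff q n K = 1 / (a * (1 - Y) * (b * (1 - X * X * Y * q)))"
      using Suc.prems unfolding pcoeff_def a b by simp
    have gK: "g K = (-1) ^ K * q ^ tri K / X * (1 - X) / (1 - X * Y) / (a * (1 - Y) * b)"
      unfolding g_def a XY X_def b_def by simp
    have gS: "g (Suc K) = - ((-1) ^ K * q ^ tri K * (1 - X * q) / (1 - X * Y) / (a * (b * (1 - X * X * Y * q))))"
      unfolding g_def tri' using b assms(2) by (simp add: XY a_def X_def mult_ac)
    have XYn: "1 - X * Y \<noteq> 0" using qn XY by simp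
    show ?case
    proof -
      have "- g K + (-1) ^ K * q ^ tri K * pcoeff q n K * (1 / q ^ K - q ^ (K + 1)) =
        (-1) ^ K * q ^ tri K / (X * a * b * (1 - X * Y) * (1 - Y) * (1 - X * X * Y * q)) *
         (- ((1 - X) * (1 - X * X * Y * q)) + (1 - X * Y) * (1 - X * X * q))"
        unfolding pc gK X_def[symmetric] using ab XYn
        by (simp add: divide_simps X_def[symmetric]) (simp add: algebra_simps)
      also have "- ((1 - X) * (1 - X * X * Y * q)) + (1 - X * Y) * (1 - X * X * q) = X * (1 - X * q) * (1 - Y)"
        by (simp add: algebra_simps)
      also have "(-1) ^ K * q ^ tri K / (X * a * b * (1 - X * Y) * (1 - Y) * (1 - X * X * Y * q)) *
         (X * (1 - X * q) * (1 - Y)) = - g (Suc K)"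
        unfolding gS using ab XYn by (simp add: divide_simps)
      finally show ?thesis using Suc by simp
    qed
  qed
  \<comment> \<open>\<open>g (Suc n)\<close> would contain the truncated difference n - Suc n, so
    the telescoping stops at n. The last summand is treated separately and equals
    \<open>g n\<close>.\<close>
  have "{..n} = insert n {..<n}" by auto
  hence 0: "(\<Sum>k\<le>n. (-1) ^ k * q ^ tri k * pcoeff q n k * (1 / q ^ k - q ^ (k + 1))) =
    - g n + (-1) ^ n * q ^ tri n * pcoeff q n n * (1 / q ^ n - q ^ (n + 1))"
    using *[of n] by simp
  have "(1 - q ^ (2 * n + 1)) * qpoch q q (2 * n) = qpoch q q (n + n + 1)"
    by (simp add: qpoch_Suc mult_2)
  hence 1: "pcoeff q n n * (1 - q ^ (2 * n + 1)) = 1 / qpoch q q (2 * n)"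
    using nz[of "n + n + 1"] unfolding pcoeff_def by (auto simp: divide_simps)
  have 2: "1 / q ^ n - q ^ (n + 1) = (1 - q ^ (2 * n + 1)) / q ^ n"
    using assms(2) by (simp add: field_simps mult_2_right power_add)
  have "(-1) ^ n * q ^ tri n * pcoeff q n n * (1 / q ^ n - q ^ (n + 1)) =
      (-1) ^ n * q ^ tri n / q ^ n * (pcoeff q n n * (1 - q ^ (2 * n + 1)))"
    unfolding 2 by simp
  also have "\<dots> = g n"
    unfolding 1 using qn unfolding g_def by (simp add: mult_2)
  finally show ?thesis using 0 by simp
qed

text \<open>Put M = (1 - w q^N) (1 - q^(N + 1) / w). At both poles of \<open>lterm w q k\<close>,
  namely w = q^(- k) and w = q^(k + 1), M takes the value (1 - q^(N - k)) (1 - q^(N + k + 1)). The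
  difference of M and this value cancels the denominator of \<open>lterm w q k\<close> = (1 - q^(2 k
  + 1)) / ((1 - w q^k) (1 - q^(k + 1) / w)), so the remainder is free of w.\<close>

lemma lterm_mult:
  assumes "k \<le> N" "q \<noteq> 0" "w \<noteq> 0" "w * q ^ k \<noteq> 1" "q ^ (k + 1) \<noteq> w"
  shows "(1 - w * q ^ N) * (1 - q ^ (N + 1) / w) * lterm w q k =
         (1 - q ^ (N - k)) * (1 - q ^ (N + k + 1)) * lterm w q k + q ^ N * (1 / q ^ k - q ^ (k + 1))"
proof -
  define X Y where "X = q ^ k" and "Y = q ^ (N - k)"
  have XY: "q ^ N = X * Y" unfolding X_def Y_def using assms(1) by (simp flip: power_add)
  have nz: "1 - w * X \<noteq> 0" "w - q * X \<noteq> 0" "X \<noteq> 0" using assms unfolding X_def by auto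
  have e: "(X * q / w) / (1 - X * q / w) = q * X / (w - q * X)" using assms(3) nz(2) by (simp add: field_simps)
  have "(1 - w * (X * Y)) * (1 - q * (X * Y) / w) * (1 / (1 - w * X) + q * X / (w - q * X)) =
        (1 - Y) * (1 - q * X * X * Y) * (1 / (1 - w * X) + q * X / (w - q * X)) + Y * (1 - q * X * X)"
    using nz assms(3) by (simp add: divide_simps) (simp add: algebra_simps)
  moreover have "X * Y * (1 / X - q * X) = Y * (1 - q * X * X)" using nz by (simp add: field_simps)
  ultimately show ?thesis
    unfolding lterm_def power_add power_one_right XY X_def[symmetric] Y_def[symmetric] e
    by (simp only: mult_ac)
qed

text \<open>No factor of (w; q) (q / w; q) vanishes; for q \<noteq> 0 this says that w is nonzero
  and not an integral power of q.\<close>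

definition theta_generic :: "complex \<Rightarrow> complex \<Rightarrow> bool" where
  "theta_generic w q \<longleftrightarrow> w \<noteq> 0 \<and> (\<forall>k. w * q ^ k \<noteq> 1) \<and> (\<forall>k. q ^ (k + 1) \<noteq> w)"

lemma qpoch_generic_nonzero:
  assumes "theta_generic w q"
  shows "qpoch w q n \<noteq> 0" "qpoch (q / w) q n \<noteq> 0"
  using assms unfolding qpoch_def theta_generic_def by (auto simp: field_simps)

text \<open>Induction on n: multiplying the claimed sum by the two new linear factors gives back the
  previous sum, since \<open>pcoeff_Suc\<close> matches the coefficients and
  \<open>telescope_pcoeff\<close> removes the remainders.\<close>

lemma partial_fractions:
  assumes "norm q < 1" "q \<noteq> 0" "theta_generic w q"
  shows "1 / (qpoch w q (n + 1) * qpoch (q / w) q (n + 1)) =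
         (\<Sum>k\<le>n. (-1) ^ k * q ^ tri k * pcoeff q n k * lterm w q k)"
proof (induction n)
  case 0
  have g: "w \<noteq> 0" "1 - w \<noteq> 0" "w \<noteq> q"
    using assms(3) unfolding theta_generic_def
    by (auto dest: spec[of _ 0])
  moreover have "1 - q \<noteq> 0" using assms(1) by auto
  ultimately show ?case
    by (simp add: pcoeff_def lterm_def qpoch_Suc divide_simps) (simp add: algebra_simps)
next
  case (Suc n)
  define N where "N = Suc n"
  define M where "M = (1 - w * q ^ N) * (1 - q ^ (N + 1) / w)"
  define S where "S = (\<Sum>k\<le>N. (-1) ^ k * q ^ tri k * pcoeff q N k * lterm w q k)"
  have "S * M = (\<Sum>k\<le>N. (-1) ^ k * q ^ tri k * pcoeff q N k * (M * lterm w q k))"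
    unfolding S_def sum_distrib_right by (simp add: mult_ac)
  also have "\<dots> = (\<Sum>k\<le>N. (-1) ^ k * q ^ tri k * pcoeff q n k * lterm w q k
      + q ^ N * ((-1) ^ k * q ^ tri k * pcoeff q N k * (1 / q ^ k - q ^ (k + 1))))"
  proof (intro sum.cong refl)
    fix k assume k: "k \<in> {..N}"
    have 1: "M * lterm w q k = (1 - q ^ (N - k)) * (1 - q ^ (N + k + 1)) * lterm w q k + q ^ N * (1 / q ^ k - q ^ (k + 1))"
      unfolding M_def by (rule lterm_mult) (use k assms in \<open>auto simp: theta_generic_def simp del: power_Suc\<close>)
    have 2: "pcoeff q n k = pcoeff q N k * ((1 - q ^ (N - k)) * (1 - q ^ (N + k + 1)))"
      using pcoeff_Suc[OF assms(1), of k n] k unfolding N_def by (simp del: power_Suc)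
    show "(-1) ^ k * q ^ tri k * pcoeff q N k * (M * lterm w q k) =
       (-1) ^ k * q ^ tri k * pcoeff q n k * lterm w q k
      + q ^ N * ((-1) ^ k * q ^ tri k * pcoeff q N k * (1 / q ^ k - q ^ (k + 1)))"
      unfolding 1 2 by (simp add: algebra_simps)
  qed
  also have "\<dots> = (\<Sum>k\<le>N. (-1) ^ k * q ^ tri k * pcoeff q n k * lterm w q k)"
    unfolding sum.distrib sum_distrib_left[symmetric]
    using telescope_pcoeff[OF assms(1,2), of N] unfolding N_def by simp
  also have "\<dots> = (\<Sum>k\<le>n. (-1) ^ k * q ^ tri k * pcoeff q n k * lterm w q k)"
    unfolding N_def by (simp add: pcoeff_def)
  also have "\<dots> = 1 / (qpoch w q N * qpoch (q / w) q N)"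
    using Suc unfolding N_def by simp
  finally have SM: "S * M = 1 / (qpoch w q N * qpoch (q / w) q N)" .
  have e: "qpoch w q (N + 1) * qpoch (q / w) q (N + 1) = (qpoch w q N * qpoch (q / w) q N) * M"
    unfolding M_def by (simp add: qpoch_Suc mult_ac)
  have "M \<noteq> 0" using qpoch_generic_nonzero[OF assms(3), of "N + 1"] e by auto
  hence "1 / (qpoch w q (N + 1) * qpoch (q / w) q (N + 1)) = S"
    unfolding e using SM qpoch_generic_nonzero[OF assms(3), of "N"] by (simp add: field_simps)
  thus ?case unfolding S_def N_def .
qed

text \<open>The bound is uniform in both n and k, which makes it the majorant for the limits under
  the summation sign.\<close>

lemma pcoeff_bounded:
  assumes "norm q < 1"
  obtains K where "K > 0" "\<And>n k. norm (pcoeff q n k) \<le> K"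
proof -
  obtain K where K: "K > 0" "\<And>n. norm (inverse (qpoch q q n)) \<le> K"
    using qpoch_self_inverse_bounded[OF assms] by blast
  have "norm (pcoeff q n k) \<le> K * K" for n k
  proof (cases "k \<le> n")
    case True
    have "norm (pcoeff q n k) = norm (inverse (qpoch q q (n - k))) * norm (inverse (qpoch q q (n + k + 1)))"
      using True by (simp add: pcoeff_def norm_mult norm_divide norm_inverse field_simps)
    also have "\<dots> \<le> K * K" using K by (intro mult_mono) auto
    finally show ?thesis .
  qed (use K in \<open>simp add: pcoeff_def\<close>)
  thus thesis using that[of "K * K"] K by auto
qed

lemma pcoeff_tendsto:
  assumes "norm q < 1"
  shows "(\<lambda>n. pcoeff q n k) \<longlonglongrightarrow> 1 / qinf q q ^ 2"
proof -
  have nz: "qinf q q \<noteq> 0" by (rule qinf_self_nonzero[OF assms])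
  have "(\<lambda>n. 1 / (qpoch q q n * qpoch q q (n + (2 * k + 1)))) \<longlonglongrightarrow> 1 / (qinf q q * qinf q q)"
    using nz by (intro tendsto_intros LIMSEQ_ignore_initial_segment qpoch_tendsto assms) auto
  moreover have "1 / (qpoch q q n * qpoch q q (n + (2 * k + 1))) = pcoeff q (n + k) k" for n
    by (simp add: pcoeff_def mult_2 add_ac)
  ultimately have "(\<lambda>n. pcoeff q (n + k) k) \<longlonglongrightarrow> 1 / (qinf q q * qinf q q)" by simp
  from LIMSEQ_offset[OF this] show ?thesis by (simp add: power2_eq_square)
qed

subsection \<open>The series \<open>g2\<close> as a partial fraction expansion\<close>

text \<open>The coefficient of (-1)^k q^(tri k) \<open>lterm w q k\<close> in the n-th summand of
  \<open>g2 w q\<close>; it does not depend on w.\<close>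

definition tterm :: "complex \<Rightarrow> nat \<Rightarrow> nat \<Rightarrow> complex" where
  "tterm q n k = qpoch (- q) q n * q ^ tri n * pcoeff q n k"

lemma tri_power_Suc: "(q :: complex) ^ tri (Suc k) = q ^ tri k * q ^ Suc k"
  by (subst tri_Suc) (simp only: power_add)

text \<open>Creative telescoping: a first-order recurrence in k holds up to a difference in n. For n
  > k the certificate is \<open>G n\<close> = - (1 - q^(k + 1)) (1 - q^(n - k))
  \<open>tterm q n k\<close>, and its natural value at n = k is 0, so the cut-off in
  \<open>G\<close> fits the boundary.\<close>

lemma tterm_telescope:
  fixes k :: nat
  assumes "norm q < 1"
  defines "G \<equiv> \<lambda>n. if Suc k \<le> n then
      - ((1 - q ^ Suc k) * qpoch (- q) q n * q ^ tri n / (qpoch q q (n - Suc k) * qpoch q q (n + Suc k))) else 0"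
  shows "tterm q n (Suc k) - q ^ Suc k * tterm q n k = G (Suc n) - G n"
proof -
  note nz = qpoch_self_nonzero[OF assms(1)]
  define X A T where "X = q ^ Suc k" and "A = qpoch (- q) q n" and "T = q ^ tri n"
  consider "n < k" | "n = k" | d where "n = Suc k + d"
    by (metis add_Suc_right add_Suc less_iff_Suc_add linorder_neqE_nat)
  thus ?thesis
  proof cases
    case 1
    thus ?thesis by (simp add: G_def tterm_def pcoeff_def)
  next
    case 2
    define b where "b = qpoch q q (2 * k + 1)"
    have X2: "q ^ Suc (2 * k + 1) = X * X" unfolding X_def power_add[symmetric] by (rule arg_cong[where f = "power q"]) simp
    have b: "qpoch q q (Suc (2 * k + 1)) = b * (1 - X * X)"
      unfolding b_def by (subst qpoch_Suc) (simp only: power_Suc[symmetric] X2)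
    have Ab: "b \<noteq> 0" "1 - X * X \<noteq> 0" using nz[of "Suc (2 * k + 1)"] unfolding b by auto
    have t: "tterm q n k = A * T / b"
      unfolding tterm_def A_def T_def pcoeff_def b_def using 2 by (simp add: mult_2)
    have "qpoch (- q) q (Suc n) = A * (1 + X)" unfolding A_def X_def qpoch_Suc 2 by simp
    moreover have "q ^ tri (Suc n) = T * X" unfolding tri_power_Suc T_def X_def 2 ..
    moreover have "qpoch q q (Suc n + Suc k) = b * (1 - X * X)"
      unfolding b[symmetric] 2 by (simp add: mult_2)
    ultimately have G: "G (Suc n) = - ((1 - X) * (A * (1 + X)) * (T * X) / (b * (1 - X * X)))"
      unfolding G_def using 2 by (simp add: X_def)
    have "tterm q n (Suc k) = 0" "G n = 0" using 2 by (auto simp: tterm_def pcoeff_def G_def)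
    moreover have "- (X * (A * T / b)) = - ((1 - X) * (A * (1 + X)) * (T * X) / (b * (1 - X * X)))"
      using Ab by (simp add: divide_simps) (simp add: algebra_simps)
    ultimately show ?thesis unfolding t G X_def[symmetric] by simp
  next
    case 3
    define Y a b where "Y = q ^ Suc d" and "a = qpoch q q d" and "b = qpoch q q (n + k + 1)"
    have XY: "q ^ Suc n = X * Y" unfolding X_def Y_def power_add[symmetric] 3 by (rule arg_cong[where f = "power q"]) simp
    have Z: "q ^ Suc (n + k + 1) = X * X * Y"
      unfolding X_def Y_def power_add[symmetric] 3 by (rule arg_cong[where f = "power q"]) simp
    have a: "qpoch q q (Suc d) = a * (1 - Y)" unfolding a_def Y_def by (simp add: qpoch_Suc)
    have b: "qpoch q q (Suc (n + k + 1)) = b * (1 - X * X * Y)"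
      unfolding b_def by (subst qpoch_Suc) (simp only: power_Suc[symmetric] Z)
    have ab: "a \<noteq> 0" "b \<noteq> 0" "1 - Y \<noteq> 0" "1 - X * X * Y \<noteq> 0"
      using nz[of "Suc d"] nz[of "Suc (n + k + 1)"] unfolding a b by auto
    have "n - k = Suc d" "Suc n - Suc k = Suc d" "n - Suc k = d" using 3 by auto
    note e = this
    have t1: "tterm q n (Suc k) = A * T / (a * (b * (1 - X * X * Y)))"
      unfolding tterm_def A_def T_def pcoeff_def e a_def b[symmetric] using 3 by simp
    have t2: "tterm q n k = A * T / (a * (1 - Y) * b)"
      unfolding tterm_def A_def T_def pcoeff_def e a[symmetric] b_def using 3 by simp
    have "qpoch (- q) q (Suc n) = A * (1 + X * Y)" unfolding A_def XY[symmetric] qpoch_Suc by simp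
    moreover have "q ^ tri (Suc n) = T * (X * Y)" unfolding tri_power_Suc T_def XY ..
    moreover have "qpoch q q (Suc n + Suc k) = b * (1 - X * X * Y)"
      unfolding b[symmetric] by simp
    ultimately have G1: "G (Suc n) = - ((1 - X) * (A * (1 + X * Y)) * (T * (X * Y)) / (a * (1 - Y) * (b * (1 - X * X * Y))))"
      unfolding G_def e a using 3 by (simp add: X_def)
    have G2: "G n = - ((1 - X) * A * T / (a * b))"
      unfolding G_def e using 3 by (simp add: X_def A_def T_def a_def b_def)
    have frac: "A * T / (a * (b * R)) - X * (A * T / (a * P * b)) =
        - (C * (A * D) * (T * E) / (a * P * (b * R))) + C * A * T / (a * b)"
      if "P \<noteq> 0" "R \<noteq> 0" "P - X * R = - (C * D * E) + C * P * R" for P R C D E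
    proof -
      have "A * T / (a * (b * R)) - X * (A * T / (a * P * b)) = A * T / (a * b * P * R) * (P - X * R)"
        using ab that(1,2) by (simp add: field_simps)
      also have "\<dots> = - (C * (A * D) * (T * E) / (a * P * (b * R))) + C * A * T / (a * b)"
        unfolding that(3) using ab that(1,2) by (simp add: field_simps)
      finally show ?thesis .
    qed
    show ?thesis unfolding t1 t2 G1 G2 X_def[symmetric] diff_minus_eq_add
      by (rule frac) (use ab in \<open>simp_all add: algebra_simps\<close>)
  qed
qed

lemma tterm_bounded:
  assumes "norm q < 1"
  obtains K where "K > 0" "\<And>n k. norm (tterm q n k) \<le> K * norm q ^ n"
proof -
  obtain K1 where K1: "K1 > 0" "\<And>n k. norm (pcoeff q n k) \<le> K1"
    using pcoeff_bounded[OF assms] by blast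
  obtain K2 where K2: "K2 > 0" "\<And>n. norm (qpoch (- q) q n) \<le> K2"
    using qpoch_bounded[OF assms] by blast
  have "norm (tterm q n k) \<le> K2 * norm q ^ n * K1" for n k
    unfolding tterm_def norm_mult norm_power
    using K1 K2 summable_power_tri(2)[OF assms, of n] by (intro mult_mono) (auto intro: less_imp_le)
  thus thesis using that[of "K2 * K1"] K1 K2 by (simp add: mult_ac)
qed

lemma tterm_summable:
  assumes "norm q < 1"
  shows "summable (\<lambda>n. norm (tterm q n k))"
proof -
  obtain K where "K > 0" "\<And>n k. norm (tterm q n k) \<le> K * norm q ^ n"
    using tterm_bounded[OF assms] by blast
  thus ?thesis using assms
    by (intro summable_comparison_test[OF _ summable_mult[OF summable_geometric[of "norm q"], of K]]) auto
qed

text \<open>Sum the recurrence over all n. \<open>G\<close> starts at 0 and, because of the factor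
  q^(tri n), also tends to 0, so nothing remains of the telescoping part.\<close>

lemma tterm_suminf_Suc:
  assumes "norm q < 1"
  shows "(\<Sum>n. tterm q n (Suc k)) = q ^ Suc k * (\<Sum>n. tterm q n k)"
proof -
  define G where "G = (\<lambda>n. if Suc k \<le> n then
      - ((1 - q ^ Suc k) * qpoch (- q) q n * q ^ tri n / (qpoch q q (n - Suc k) * qpoch q q (n + Suc k))) else 0)"
  obtain K1 where K1: "K1 > 0" "\<And>n. norm (inverse (qpoch q q n)) \<le> K1"
    using qpoch_self_inverse_bounded[OF assms] by blast
  obtain K2 where K2: "K2 > 0" "\<And>n. norm (qpoch (- q) q n) \<le> K2"
    using qpoch_bounded[OF assms] by blast
  define D where "D = norm (1 - q ^ Suc k)"
  have "norm (G n) \<le> norm q ^ n * (D * K2 * (K1 * K1))" for n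
  proof (cases "Suc k \<le> n")
    case True
    have "G n = - (q ^ tri n * ((1 - q ^ Suc k) * qpoch (- q) q n * 
       (inverse (qpoch q q (n - Suc k)) * inverse (qpoch q q (n + Suc k)))))"
      using True by (simp add: G_def field_simps)
    hence "norm (G n) = norm q ^ tri n * (D * norm (qpoch (- q) q n) * 
       (norm (inverse (qpoch q q (n - Suc k))) * norm (inverse (qpoch q q (n + Suc k)))))"
      by (simp only: norm_minus_cancel norm_mult norm_power D_def)
    also have "\<dots> \<le> norm q ^ n * (D * K2 * (K1 * K1))"
      using K1 K2 summable_power_tri(2)[OF assms, of n]
      by (intro mult_mono) (auto intro: less_imp_le simp: D_def)
    finally show ?thesis .
  qed (use K1 K2 in \<open>auto simp: G_def D_def\<close>)
  moreover have "(\<lambda>n. norm q ^ n * (D * K2 * (K1 * K1))) \<longlonglongrightarrow> 0"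
    using assms by (intro tendsto_mult_left_zero LIMSEQ_power_zero) auto
  ultimately have G0: "G \<longlonglongrightarrow> 0"
    by (intro Lim_null_comparison[of G]) auto
  have sm: "summable (\<lambda>n. tterm q n k)" for k
    using tterm_summable[OF assms] by (rule summable_norm_cancel)
  have "tterm q n (Suc k) - q ^ Suc k * tterm q n k = G (Suc n) - G n" for n
    using tterm_telescope[OF assms, of n k] unfolding G_def .
  moreover have "G 0 = 0" by (simp add: G_def)
  ultimately have 1: "(\<lambda>n. tterm q n (Suc k) - q ^ Suc k * tterm q n k) sums 0"
    using telescope_sums[OF G0] by simp
  have 2: "(\<lambda>n. tterm q n (Suc k) - q ^ Suc k * tterm q n k) sums
      ((\<Sum>n. tterm q n (Suc k)) - q ^ Suc k * (\<Sum>n. tterm q n k))"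
    by (intro sums_diff sums_mult summable_sums sm)
  show ?thesis using sums_unique2[OF 1 2] by simp
qed

lemma tterm_suminf_aux:
  assumes "norm q < 1"
  shows "(\<Sum>n. tterm q n k) = q ^ tri k * (\<Sum>n. tterm q n 0)"
proof (induction k)
  case 0
  show ?case by simp
next
  case (Suc k)
  have "(\<Sum>n. tterm q n (Suc k)) = q ^ Suc k * (q ^ tri k * (\<Sum>n. tterm q n 0))"
    unfolding tterm_suminf_Suc[OF assms] Suc ..
  thus ?case unfolding tri_power_Suc[of q k] by (simp only: mult_ac)
qed

text \<open>The sum over n for index k, divided by q^(tri k), does not depend on k, so it can be
  evaluated by letting k tend to infinity. In that limit only the first nonzero term n = k survives,
  and it tends to (- q; q) / (q; q).\<close>

lemma tterm_suminf_0:
  assumes "norm q < 1" "q \<noteq> 0"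
  shows "(\<Sum>n. tterm q n 0) = qinf (- q) q / qinf q q"
proof -
  define s where "s = (\<lambda>k. \<Sum>n. tterm q n k)"
  have s: "s k = q ^ tri k * s 0" for k
    unfolding s_def by (rule tterm_suminf_aux[OF assms(1)])
  \<comment> \<open>The term n = k + m divided by q^(tri k), using tri (k + m) = tri k + tri m + k
    m. The factor (q^m)^k kills it in the limit unless m = 0.\<close>
  define a where "a = (\<lambda>m k. q ^ tri m * (q ^ m) ^ k * qpoch (- q) q (k + m) * pcoeff q (k + m) k)"
  obtain K1 where K1: "K1 > 0" "\<And>n k. norm (pcoeff q n k) \<le> K1"
    using pcoeff_bounded[OF assms(1)] by blast
  obtain K2 where K2: "K2 > 0" "\<And>n. norm (qpoch (- q) q n) \<le> K2"
    using qpoch_bounded[OF assms(1)] by blast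
  have "(\<Sum>m. a m k) = s 0" for k
  proof -
    have "(\<lambda>n. tterm q n k) sums s k"
      unfolding s_def by (rule summable_sums[OF summable_norm_cancel[OF tterm_summable[OF assms(1)]]])
    moreover have "tterm q i k = 0" if "i < k" for i
      using that by (simp add: tterm_def pcoeff_def)
    ultimately have "(\<lambda>n. tterm q (n + k) k) sums s k"
      using sums_zero_iff_shift[of k "\<lambda>n. tterm q n k" "s k"] by simp
    moreover have "tterm q (n + k) k = q ^ tri k * a n k" for n
      unfolding tterm_def a_def add.commute[of n k] tri_add[of k n]
      by (simp add: power_add power_mult[symmetric] mult_ac)
    ultimately have "(\<lambda>n. q ^ tri k * a n k) sums (q ^ tri k * s 0)"
      using s[of k] by simp
    hence "(\<lambda>n. a n k) sums s 0"
      using assms(2) by (subst (asm) sums_mult_iff) auto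
    thus ?thesis by (rule sums_unique[symmetric])
  qed
  moreover have "(\<lambda>k. \<Sum>m. a m k) \<longlonglongrightarrow> (\<Sum>m. if m = 0 then qinf (- q) q / qinf q q else 0)"
  proof (intro conjunct2[OF conjunct2[OF tannerys_theorem]])
    fix m :: nat
    show "a m \<longlonglongrightarrow> (if m = 0 then qinf (- q) q / qinf q q else 0)"
    proof (cases "m = 0")
      case True
      have "(\<lambda>k. qpoch (- q) q k / qpoch q q (2 * k + 1)) \<longlonglongrightarrow> qinf (- q) q / qinf q q"
      proof (intro tendsto_divide qpoch_tendsto assms qinf_self_nonzero)
        have "strict_mono (\<lambda>k::nat. 2 * k + 1)" by (auto simp: strict_mono_def)
        from LIMSEQ_subseq_LIMSEQ[OF qpoch_tendsto[OF assms(1), of q] this]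
        show "(\<lambda>k. qpoch q q (2 * k + 1)) \<longlonglongrightarrow> qinf q q" by (simp add: o_def)
      qed
      thus ?thesis unfolding a_def using True by (simp add: pcoeff_def mult_2)
    next
      case False
      have "norm (a m k) \<le> (norm q ^ m) ^ k * (1 * K2 * K1)" for k
      proof -
        have "norm (a m k) = (norm q ^ m) ^ k * (norm q ^ tri m * norm (qpoch (- q) q (k + m)) * norm (pcoeff q (k + m) k))"
          by (simp add: a_def norm_mult norm_power)
        also have "\<dots> \<le> (norm q ^ m) ^ k * (1 * K2 * K1)"
          using K1 K2 assms(1) by (intro mult_mono power_le_one) (auto intro: less_imp_le)
        finally show ?thesis .
      qed
      moreover have "(\<lambda>k. (norm q ^ m) ^ k * (1 * K2 * K1)) \<longlonglongrightarrow> 0"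
        using assms False by (intro tendsto_mult_left_zero LIMSEQ_power_zero) (auto simp: power_less_one_iff)
      ultimately have "a m \<longlonglongrightarrow> 0"
        by (intro Lim_null_comparison[of "a m"]) auto
      thus ?thesis using False by simp
    qed
  next
    have "norm (a m k) \<le> norm q ^ m * 1 * K2 * K1" for k m
      unfolding a_def norm_mult norm_power using K1 K2 assms(1) summable_power_tri(2)[OF assms(1), of m]
      by (intro mult_mono power_le_one) (auto intro: less_imp_le power_le_one)
    thus "\<forall>\<^sub>F (m, k) in sequentially \<times>\<^sub>F sequentially. norm (a m k) \<le> norm q ^ m * 1 * K2 * K1"
      by (intro always_eventually) auto
    show "summable (\<lambda>m. norm q ^ m * 1 * K2 * K1)"
      using assms(1) by (intro summable_mult2 summable_geometric) auto
  qed auto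
  moreover have "(\<Sum>m::nat. if m = 0 then qinf (- q) q / qinf q q else 0) = qinf (- q) q / qinf q q"
    by (subst suminf_finite[of "{0}"]) auto
  ultimately have "(\<lambda>k::nat. s 0) \<longlonglongrightarrow> qinf (- q) q / qinf q q"
    by simp
  thus ?thesis unfolding s_def by (simp add: LIMSEQ_const_iff)
qed

lemma tterm_suminf:
  assumes "norm q < 1" "q \<noteq> 0"
  shows "(\<lambda>n. tterm q n k) sums (q ^ tri k * (qinf (- q) q / qinf q q))"
  using tterm_suminf_aux[OF assms(1), of k] tterm_suminf_0[OF assms]
    summable_sums[OF summable_norm_cancel[OF tterm_summable[OF assms(1), of k]]] by simp

section \<open>Passage from the finite expansions to the infinite series\<close>

lemma lterm_tendsto:
  assumes "norm q < 1"
  shows "lterm w q \<longlonglongrightarrow> 1"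
proof -
  have q0: "(\<lambda>k. q ^ k) \<longlonglongrightarrow> 0" using assms by (rule LIMSEQ_power_zero)
  have "(\<lambda>k. 1 / (1 - w * q ^ k) + (q ^ Suc k / w) / (1 - q ^ Suc k / w)) \<longlonglongrightarrow>
    1 / (1 - w * 0) + (0 / w) / (1 - 0 / w)"
    unfolding divide_inverse[of _ w]
    by (intro tendsto_intros q0 LIMSEQ_Suc[OF q0]) auto
  thus ?thesis unfolding lterm_def by simp
qed

lemma lterm_bounded:
  assumes "norm q < 1"
  obtains K where "K > 0" "\<And>k. norm (lterm w q k) \<le> K"
  using convergent_imp_Bseq[OF convergentI[OF lterm_tendsto[OF assms, of w]]]
  unfolding Bseq_def by blast

lemma summable_lterm:
  assumes "norm q < 1"
  shows "summable (\<lambda>k. norm ((-1) ^ k * q ^ tri k * lterm w q k))"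
    "summable (\<lambda>k. norm ((-1) ^ k * q ^ tri k * q ^ tri k * lterm w q k))"
proof -
  obtain K where K: "K > 0" "\<And>k. norm (lterm w q k) \<le> K"
    using lterm_bounded[OF assms, of w] by blast
  have 1: "summable (\<lambda>k. norm q ^ tri k * K)"
    by (intro summable_mult2 summable_power_tri assms)
  show "summable (\<lambda>k. norm ((-1) ^ k * q ^ tri k * lterm w q k))"
    by (rule summable_comparison_test[OF _ 1])
       (use K in \<open>auto simp: norm_mult norm_power intro!: exI[of _ 0] mult_left_mono\<close>)
  have "norm ((-1) ^ k * q ^ tri k * q ^ tri k * lterm w q k) \<le> norm q ^ tri k * 1 * K" for k
  proof -
    have "norm ((-1) ^ k * q ^ tri k * q ^ tri k * lterm w q k) = norm q ^ tri k * norm q ^ tri k * norm (lterm w q k)"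
      by (simp add: norm_mult norm_power)
    also have "\<dots> \<le> norm q ^ tri k * 1 * K"
      using K assms by (intro mult_mono power_le_one) auto
    finally show ?thesis .
  qed
  thus "summable (\<lambda>k. norm ((-1) ^ k * q ^ tri k * q ^ tri k * lterm w q k))"
    by (intro summable_comparison_test[OF _ 1]) auto
qed

text \<open>Tannery's theorem applied to \<open>partial_fractions\<close> as n tends to infinity;
  the limit 1 / (q; q)^2 of the coefficients accounts for the numerator on the left.\<close>

lemma inverse_product_expansion:
  assumes "norm q < 1" "q \<noteq> 0" "theta_generic w q"
  shows "qinf q q ^ 2 / (qinf w q * qinf (q / w) q) = (\<Sum>k. (-1) ^ k * q ^ tri k * lterm w q k)"
proof -
  define c where "c = (\<lambda>k. (-1) ^ k * q ^ tri k * lterm w q k)"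
  define R where "R = (\<lambda>n. 1 / (qpoch w q (n + 1) * qpoch (q / w) q (n + 1)))"
  have nz: "qinf w q \<noteq> 0" "qinf (q / w) q \<noteq> 0"
    using assms(3) unfolding qinf_eq_0_iff[OF assms(1)] theta_generic_def by (auto simp: field_simps)
  have E: "qinf q q \<noteq> 0" by (rule qinf_self_nonzero[OF assms(1)])
  obtain K1 where K1: "K1 > 0" "\<And>n k. norm (pcoeff q n k) \<le> K1"
    using pcoeff_bounded[OF assms(1)] by blast
  have "R \<longlonglongrightarrow> 1 / (qinf w q * qinf (q / w) q)"
    unfolding R_def using nz
    by (intro tendsto_intros LIMSEQ_ignore_initial_segment qpoch_tendsto assms) auto
  moreover have "(\<lambda>n. \<Sum>k. pcoeff q n k * c k) \<longlonglongrightarrow> (\<Sum>k. 1 / qinf q q ^ 2 * c k)"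
  proof (intro conjunct2[OF conjunct2[OF tannerys_theorem]])
    show "(\<lambda>n. pcoeff q n k * c k) \<longlonglongrightarrow> 1 / qinf q q ^ 2 * c k" for k
      by (intro tendsto_intros pcoeff_tendsto assms)
    show "\<forall>\<^sub>F (k, n) in sequentially \<times>\<^sub>F sequentially. norm (pcoeff q n k * c k) \<le> K1 * norm (c k)"
      using K1 by (intro always_eventually) (auto simp: norm_mult mult_right_mono)
    show "summable (\<lambda>k. K1 * norm (c k))"
      unfolding c_def by (intro summable_mult summable_lterm assms)
  qed auto
  moreover have "(\<Sum>k. pcoeff q n k * c k) = R n" for n
  proof -
    have "(\<Sum>k. pcoeff q n k * c k) = (\<Sum>k\<le>n. pcoeff q n k * c k)"
      by (rule suminf_finite) (auto simp: pcoeff_def)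
    also have "\<dots> = R n"
      unfolding R_def partial_fractions[OF assms] c_def by (simp add: mult_ac)
    finally show ?thesis .
  qed
  ultimately have "(\<Sum>k. 1 / qinf q q ^ 2 * c k) = 1 / (qinf w q * qinf (q / w) q)"
    using LIMSEQ_unique by auto
  moreover have "(\<Sum>k. 1 / qinf q q ^ 2 * c k) = 1 / qinf q q ^ 2 * (\<Sum>k. c k)"
    unfolding c_def by (intro suminf_mult summable_norm_cancel[OF summable_lterm(1)] assms)
  ultimately show ?thesis using E unfolding c_def by (simp add: field_simps)
qed

text \<open>The order of summation is changed through partial sums in n. Each of them is a finite
  combination of the \<open>lterm w q k\<close> with coefficients \<open>A N k\<close>, which are
  bounded independently of N and k and converge by \<open>tterm_suminf\<close>; the factor q^(tri k)
  kept with \<open>lterm\<close> provides the summable majorant.\<close>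

lemma g2_expansion:
  assumes "norm q < 1" "q \<noteq> 0" "theta_generic w q"
  shows "g2 w q = qinf (- q) q / qinf q q * (\<Sum>k. (-1) ^ k * q ^ tri k * q ^ tri k * lterm w q k)"
proof -
  define l where "l = (\<lambda>k. (-1) ^ k * q ^ tri k * lterm w q k)"
  define f where "f = (\<lambda>n. qpoch (- q) q n * q ^ tri n / (qpoch w q (n + 1) * qpoch (q / w) q (n + 1)))"
  define A where "A = (\<lambda>N k. \<Sum>n<N. tterm q n k)"
  define s where "s = qinf (- q) q / qinf q q"
  have f: "f n = (\<Sum>k<N. tterm q n k * l k)" if "n < N" for n N
  proof -
    have "f n = qpoch (- q) q n * q ^ tri n * (1 / (qpoch w q (n + 1) * qpoch (q / w) q (n + 1)))"
      by (simp add: f_def)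
    also have "\<dots> = (\<Sum>k\<le>n. tterm q n k * l k)"
      unfolding partial_fractions[OF assms] sum_distrib_left tterm_def l_def by (simp add: mult_ac)
    also have "\<dots> = (\<Sum>k<N. tterm q n k * l k)"
      by (rule sum.mono_neutral_left) (use that in \<open>auto simp: tterm_def pcoeff_def\<close>)
    finally show ?thesis .
  qed
  obtain K where K: "K > 0" "\<And>n k. norm (tterm q n k) \<le> K * norm q ^ n"
    using tterm_bounded[OF assms(1)] by blast
  have sg: "summable (\<lambda>n. K * norm q ^ n)"
    using assms(1) by (intro summable_mult summable_geometric) auto
  define B where "B = (\<Sum>n. K * norm q ^ n)"
  have A_bound: "norm (A N k) \<le> B" for N k
  proof -
    have "norm (A N k) \<le> (\<Sum>n<N. K * norm q ^ n)"
      unfolding A_def using K(2) by (intro sum_norm_le) auto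
    also have "\<dots> \<le> B"
      unfolding B_def using K(1) by (intro sum_le_suminf sg) auto
    finally show ?thesis .
  qed
  have "(\<lambda>N. \<Sum>k. A N k * l k) \<longlonglongrightarrow> (\<Sum>k. q ^ tri k * s * l k)"
  proof (intro conjunct2[OF conjunct2[OF tannerys_theorem]])
    show "(\<lambda>N. A N k * l k) \<longlonglongrightarrow> q ^ tri k * s * l k" for k
      using tterm_suminf[OF assms(1,2), of k] unfolding sums_def A_def s_def
      by (intro tendsto_intros)
    show "\<forall>\<^sub>F (k, N) in sequentially \<times>\<^sub>F sequentially. norm (A N k * l k) \<le> B * norm (l k)"
      using A_bound by (intro always_eventually) (auto simp: norm_mult mult_right_mono)
    show "summable (\<lambda>k. B * norm (l k))"
      unfolding l_def by (intro summable_mult summable_lterm assms)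
  qed auto
  moreover have "(\<Sum>k. A N k * l k) = (\<Sum>n<N. f n)" for N
  proof -
    have "(\<Sum>k. A N k * l k) = (\<Sum>k<N. A N k * l k)"
    proof (rule suminf_finite)
      show "A N k * l k = 0" if "k \<notin> {..<N}" for k
        using that unfolding A_def by (auto simp: tterm_def pcoeff_def intro!: sum.neutral)
    qed auto
    also have "\<dots> = (\<Sum>n<N. \<Sum>k<N. tterm q n k * l k)"
      unfolding A_def sum_distrib_right by (rule sum.swap)
    also have "\<dots> = (\<Sum>n<N. f n)" using f by simp
    finally show ?thesis .
  qed
  ultimately have "f sums (\<Sum>k. q ^ tri k * s * l k)" unfolding sums_def by simp
  hence "g2 w q = (\<Sum>k. q ^ tri k * s * l k)"
    unfolding g2_def f_def by (simp add: sums_iff)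
  also have "\<dots> = (\<Sum>k. s * ((-1) ^ k * q ^ tri k * q ^ tri k * lterm w q k))"
    unfolding l_def by (simp only: mult_ac)
  also have "\<dots> = s * (\<Sum>k. (-1) ^ k * q ^ tri k * q ^ tri k * lterm w q k)"
    by (intro suminf_mult summable_norm_cancel[OF summable_lterm(2)] assms)
  finally show ?thesis unfolding s_def .
qed

lemma theta_generic_squareD:
  assumes "theta_generic (w ^ 2) (q ^ 2)" "v ^ 2 = w ^ 2"
  shows "theta_generic v q"
  unfolding theta_generic_def
proof (intro conjI allI notI)
  assume "v = 0"
  thus False using assms by (simp add: theta_generic_def)
next
  fix k assume "v * q ^ k = 1"
  hence "(v * q ^ k) ^ 2 = 1" by simp
  hence "w ^ 2 * (q ^ 2) ^ k = 1"
    by (simp add: power_mult_distrib power_mult[symmetric] assms(2) mult_ac)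
  thus False using assms(1) by (simp add: theta_generic_def)
next
  fix k assume "q ^ (k + 1) = v"
  hence "(q ^ (k + 1)) ^ 2 = w ^ 2" using assms(2) by simp
  hence "(q ^ 2) ^ (k + 1) = w ^ 2" by (simp only: power_mult[symmetric] mult.commute)
  thus False using assms(1) by (auto simp: theta_generic_def simp del: power_Suc)
qed

text \<open>From 1 / (1 - a) + 1 / (1 + a) = 2 / (1 - a^2) and its analogue for b / (1 - b), the two
  values of \<open>lterm\<close> add up to twice \<open>lterm\<close> at w^2 and q^2. The weight
  q^(tri k) q^(tri k) is (q^2)^(tri k), so \<open>inverse_product_expansion\<close> applies with
  base q^2.\<close>

lemma g2_sum_product:
  assumes "norm q < 1" "q \<noteq> 0" "theta_generic (w ^ 2) (q ^ 2)"
  shows "g2 w q + g2 (- w) q =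
    2 * (qinf (- q) q / qinf q q) * qinf (q ^ 2) (q ^ 2) ^ 2 /
      (qinf (w ^ 2) (q ^ 2) * qinf (q ^ 2 / w ^ 2) (q ^ 2))"
proof -
  define s where "s = qinf (- q) q / qinf q q"
  have q2: "norm (q ^ 2) < 1" "q ^ 2 \<noteq> 0"
    using assms(1,2) by (auto simp: norm_power power_less_one_iff)
  have gen: "theta_generic w q" "theta_generic (- w) q"
    by (auto intro: theta_generic_squareD[OF assms(3)])
  have l: "lterm w q k + lterm (- w) q k = 2 * lterm (w ^ 2) (q ^ 2) k" for k
  proof -
    have *: "1 / (1 - a) + 1 / (1 + a) = 2 / (1 - a ^ 2)" "b / (1 - b) + (- b) / (1 + b) = 2 * (b ^ 2 / (1 - b ^ 2))"
      if "a ^ 2 \<noteq> 1" "b ^ 2 \<noteq> 1" for a b :: complex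
    proof -
      have "1 - a \<noteq> 0" "1 + a \<noteq> 0" "1 - b \<noteq> 0" "1 + b \<noteq> 0" "1 - a ^ 2 = (1 - a) * (1 + a)"
        "1 - b ^ 2 = (1 - b) * (1 + b)"
        using that by (auto simp: algebra_simps power2_eq_square add_eq_0_iff)
      thus "1 / (1 - a) + 1 / (1 + a) = 2 / (1 - a ^ 2)" 
           "b / (1 - b) + (- b) / (1 + b) = 2 * (b ^ 2 / (1 - b ^ 2))"
        by (simp_all add: divide_simps power2_eq_square) (simp_all add: algebra_simps)
    qed
    have "(w * q ^ k) ^ 2 = w ^ 2 * (q ^ 2) ^ k" "(q ^ (k + 1) / w) ^ 2 = (q ^ 2) ^ (k + 1) / w ^ 2"
      by (simp_all add: power_mult_distrib power_divide power_mult[symmetric] mult_ac)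
    moreover have "w ^ 2 * (q ^ 2) ^ k \<noteq> 1" "(q ^ 2) ^ (k + 1) / w ^ 2 \<noteq> 1"
      using assms(3) unfolding theta_generic_def by (auto simp: field_simps)
    moreover define a b where "a = w * q ^ k" and "b = q ^ (k + 1) / w"
    ultimately have ab: "a ^ 2 \<noteq> 1" "b ^ 2 \<noteq> 1"
      and l2: "lterm (w ^ 2) (q ^ 2) k = 1 / (1 - a ^ 2) + b ^ 2 / (1 - b ^ 2)"
      by (simp_all add: lterm_def)
    have "lterm w q k = 1 / (1 - a) + b / (1 - b)" "lterm (- w) q k = 1 / (1 + a) + (- b) / (1 + b)"
      by (simp_all add: lterm_def a_def b_def)
    hence "lterm w q k + lterm (- w) q k = (1 / (1 - a) + 1 / (1 + a)) + (b / (1 - b) + (- b) / (1 + b))"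
      by (simp only: add_ac)
    also have "\<dots> = 2 * lterm (w ^ 2) (q ^ 2) k"
      unfolding *[OF ab] l2 by simp
    finally show ?thesis .
  qed
  have "g2 w q + g2 (- w) q = s * ((\<Sum>k. (-1) ^ k * q ^ tri k * q ^ tri k * lterm w q k)
       + (\<Sum>k. (-1) ^ k * q ^ tri k * q ^ tri k * lterm (- w) q k))"
    unfolding g2_expansion[OF assms(1,2) gen(1)] g2_expansion[OF assms(1,2) gen(2)] s_def
    by (simp only: distrib_left)
  also have "(\<Sum>k. (-1) ^ k * q ^ tri k * q ^ tri k * lterm w q k)
       + (\<Sum>k. (-1) ^ k * q ^ tri k * q ^ tri k * lterm (- w) q k) =
     (\<Sum>k. (-1) ^ k * q ^ tri k * q ^ tri k * lterm w q k + (-1) ^ k * q ^ tri k * q ^ tri k * lterm (- w) q k)"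
    by (intro suminf_add summable_norm_cancel[OF summable_lterm(2)] assms)
  also have "\<dots> = (\<Sum>k. 2 * ((-1) ^ k * (q ^ 2) ^ tri k * lterm (w ^ 2) (q ^ 2) k))"
  proof (rule suminf_cong)
    fix k
    have "(q ^ 2) ^ tri k = q ^ tri k * q ^ tri k"
      by (simp only: power2_eq_square power_mult_distrib)
    thus "(-1) ^ k * q ^ tri k * q ^ tri k * lterm w q k + (-1) ^ k * q ^ tri k * q ^ tri k * lterm (- w) q k =
      2 * ((-1) ^ k * (q ^ 2) ^ tri k * lterm (w ^ 2) (q ^ 2) k)"
      unfolding distrib_left[symmetric] l by (simp only: mult_ac)
  qed
  also have "\<dots> = 2 * (qinf (q ^ 2) (q ^ 2) ^ 2 / (qinf (w ^ 2) (q ^ 2) * qinf (q ^ 2 / w ^ 2) (q ^ 2)))"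
    unfolding inverse_product_expansion[OF q2 assms(3)]
    by (intro suminf_mult summable_norm_cancel[OF summable_lterm(1)] q2)
  finally show ?thesis unfolding s_def by simp
qed

subsection \<open>The triple product\<close>

lemma pcoeff_Suc_Suc:
  assumes "norm q < 1" "k \<le> Suc n"
  shows "pcoeff q (Suc n) k * ((1 - q ^ (Suc n - k)) * (1 - q ^ (n - k))) = pcoeff q n (Suc k)"
proof (cases "Suc k \<le> n")
  case True
  then obtain d where d: "n = Suc k + d" using le_Suc_ex by blast
  have e: "Suc n - k = Suc (Suc d)" "n - k = Suc d" "n - Suc k = d" "Suc n + k + 1 = n + Suc k + 1"
    using d by auto
  have 1: "qpoch q q (Suc (Suc d)) = qpoch q q d * ((1 - q ^ Suc (Suc d)) * (1 - q ^ Suc d))"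
    by (simp add: qpoch_Suc mult_ac)
  have "(1 - q ^ Suc (Suc d)) * (1 - q ^ Suc d) \<noteq> 0"
    using power_neq_1[OF assms(1), of d] power_neq_1[OF assms(1), of "Suc d"]
    by (auto simp del: power_Suc)
  moreover have "1 / (a * x * b) * x = 1 / (a * b)" if "x \<noteq> 0" for a b x :: complex
    using that by simp
  ultimately show ?thesis unfolding pcoeff_def e 1 using d by (simp del: power_Suc)
next
  case False
  hence "k = n \<or> k = Suc n" using assms(2) by auto
  thus ?thesis by (auto simp: pcoeff_def)
qed

lemma pcoeff_Suc_pred:
  assumes "norm q < 1" "Suc k \<le> Suc n"
  shows "pcoeff q (Suc n) (Suc k) * ((1 - q ^ (n + k + 2)) * (1 - q ^ (n + k + 3))) = pcoeff q n k"
proof -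
  have e: "Suc n - Suc k = n - k" "Suc n + Suc k + 1 = Suc (Suc (n + k + 1))"
    using assms by auto
  have 1: "qpoch q q (Suc (Suc (n + k + 1))) = qpoch q q (n + k + 1) * ((1 - q ^ (n + k + 2)) * (1 - q ^ (n + k + 3)))"
    by (simp add: qpoch_Suc mult_ac numeral_3_eq_3)
  have "(1 - q ^ (n + k + 2)) * (1 - q ^ (n + k + 3)) \<noteq> 0"
    using power_neq_1[OF assms(1), of "n + k + 1"] power_neq_1[OF assms(1), of "n + k + 2"]
    by (auto simp: numeral_3_eq_3)
  moreover have "1 / (a * (b * x)) * x = 1 / (a * b)" if "x \<noteq> 0" for a b x :: complex
    using that by simp
  ultimately show ?thesis unfolding pcoeff_def e 1 using assms(2) by (simp del: power_Suc)
qed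

text \<open>This is the comparison of coefficients when the finite triple product is multiplied by 1
  + Q^2 - Q (x + 1 / x). The entry - e n 0 for k = 0 is the coefficient with index -1, since the
  bilateral coefficients are odd under k \<mapsto> -1 - k.\<close>

lemma pcoeff_recurrence:
  assumes "norm q < 1" "q \<noteq> 0" "k \<le> Suc n"
  defines "e \<equiv> \<lambda>n k. (-1) ^ k * q ^ tri k * pcoeff q n k"
  defines "Q \<equiv> q ^ Suc n"
  shows "(1 - Q ^ 2) * (1 - q * Q ^ 2) * e (Suc n) k =
    (1 + Q ^ 2) * e n k - Q * ((if k = 0 then - e n 0 else e n (k - 1)) + e n (Suc k))"
proof -
  define X A P c where "X = q ^ k" and "A = q ^ (Suc n - k)" and "P = pcoeff q (Suc n) k"
    and "c = (-1) ^ k * q ^ tri k"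
  have X: "X \<noteq> 0" using assms(2) by (simp add: X_def)
  have QAX: "Q = A * X" unfolding Q_def A_def X_def using assms(3) by (simp flip: power_add)
  have p1: "q ^ (n + k + 2) = q * A * X * X"
  proof -
    have "n + k + 2 = Suc (Suc n - k + k + k)" using assms(3) by simp
    thus ?thesis unfolding A_def X_def by (simp only: power_Suc power_add mult_ac)
  qed
  have p2: "q ^ (n + k + 1) = A * X * X"
    using p1 assms(2) by simp
  have e1: "e (Suc n) k = c * P" by (simp add: e_def c_def P_def)
  have "P * ((1 - A) * (1 - q * A * X * X)) = pcoeff q n k"
    using pcoeff_Suc[OF assms(1,3)] unfolding p1 A_def[symmetric] P_def[symmetric] .
  hence e2: "e n k = c * P * ((1 - A) * (1 - q * A * X * X))"
    unfolding e_def c_def mult.assoc by simp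
  have e3: "q * e n (Suc k) = - (c * P * (q * X * ((1 - A) * (q - A))))"
  proof -
    \<comment> \<open>For k = Suc n the exponent n - k is truncated; this is harmless because then A
      = 1 and both sides vanish.\<close>
    have "q * ((1 - A) * (1 - q ^ (n - k))) = (1 - A) * (q - A)"
    proof (cases "k = Suc n")
      case True
      thus ?thesis by (simp add: A_def)
    next
      case False
      hence "Suc n - k = Suc (n - k)" using assms(3) by simp
      hence "A = q * q ^ (n - k)" by (simp add: A_def)
      thus ?thesis by (simp add: algebra_simps)
    qed
    hence "P * (q * ((1 - A) * (1 - q ^ (n - k)))) = P * ((1 - A) * (q - A))"
      by (simp only:)
    hence "q * pcoeff q n (Suc k) = P * ((1 - A) * (q - A))"
      unfolding pcoeff_Suc_Suc[OF assms(1,3), symmetric] P_def A_def by (simp only: mult.left_commute)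
    moreover have "e n (Suc k) = - (c * (q * X) * pcoeff q n (Suc k))"
      unfolding e_def tri_power_Suc c_def X_def by simp
    ultimately show ?thesis by (simp add: mult_ac)
  qed
  have e4: "X * (if k = 0 then - e n 0 else e n (k - 1)) = - (c * P * ((1 - A * X * X) * (1 - q * A * X * X)))"
  proof (cases k)
    case 0
    have "e n 0 = c * P * ((1 - A) * (1 - q * A * X * X))" using e2 0 by simp
    thus ?thesis using 0 by (simp add: X_def)
  next
    case (Suc m)
    have "pcoeff q n m = P * ((1 - A * X * X) * (1 - q * A * X * X))"
      using pcoeff_Suc_pred[OF assms(1), of m n] assms(3) p1 p2 unfolding P_def Suc
      by (simp add: numeral_3_eq_3 mult.assoc)
    moreover have "c = - ((-1) ^ m * (q ^ tri m * X))" unfolding c_def Suc tri_power_Suc X_def by simp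
    hence "X * ((-1) ^ m * q ^ tri m) = - c" by simp
    moreover have "X * (if k = 0 then - e n 0 else e n (k - 1)) = X * ((-1) ^ m * q ^ tri m) * pcoeff q n m"
      using Suc unfolding e_def by (simp add: mult_ac)
    ultimately show ?thesis by simp
  qed
  \<comment> \<open>Multiplication by X q clears the negative powers of q in the two neighbouring
    coefficients and leaves a polynomial identity.\<close>
  have "(X * q) * ((1 - Q ^ 2) * (1 - q * Q ^ 2) * e (Suc n) k) =
    (X * q) * ((1 + Q ^ 2) * e n k - Q * ((if k = 0 then - e n 0 else e n (k - 1)) + e n (Suc k)))"
  proof -
    have "(X * q) * ((1 + Q ^ 2) * e n k - Q * ((if k = 0 then - e n 0 else e n (k - 1)) + e n (Suc k))) =
      (X * q) * (1 + Q ^ 2) * e n k - q * Q * (X * (if k = 0 then - e n 0 else e n (k - 1))) - X * Q * (q * e n (Suc k))"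
      by (simp only: algebra_simps)
    also have "\<dots> = (X * q) * ((1 - Q ^ 2) * (1 - q * Q ^ 2) * e (Suc n) k)"
      unfolding e1 e2 e3 e4 QAX by (simp add: algebra_simps power2_eq_square)
    finally show ?thesis ..
  qed
  thus ?thesis using X assms(2) by simp
qed

text \<open>A form of the q-binomial theorem, with the terms k and -1 - k of the bilateral sum
  paired. The new factors in the induction are (1 - x Q) (1 - Q / x) = 1 + Q^2 - Q (x + 1 / x), and
  they act on the coefficients through \<open>pcoeff_recurrence\<close>.\<close>

lemma finite_triple_product:
  assumes "norm q < 1" "q \<noteq> 0" "x \<noteq> 0"
  shows "(1 - 1 / x) * (qpoch (x * q) q n * qpoch (q / x) q n) =
    qpoch q q (2 * n + 1) * (\<Sum>k\<le>n. (-1) ^ k * q ^ tri k * pcoeff q n k * (x ^ k - (1 / x) ^ (k + 1)))"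
proof (induction n)
  case 0
  have "1 - q \<noteq> 0" using assms(1) by auto
  thus ?case by (simp add: pcoeff_def qpoch_Suc)
next
  case (Suc n)
  define e where "e = (\<lambda>n k. (-1) ^ k * q ^ tri k * pcoeff q n k)"
  define y where "y = 1 / x"
  have xy: "x * y = 1" using assms(3) by (simp add: y_def)
  define X where "X = (\<lambda>k. x ^ k - y ^ (k + 1))"
  define Q where "Q = q ^ Suc n"
  have X0: "(x + y) * X 0 = X 1 - X 0"
    unfolding X_def using xy by (simp add: algebra_simps power2_eq_square)
  have XS: "(x + y) * X (Suc k) = X (Suc (Suc k)) + X k" for k
  proof -
    have "(x + y) * X (Suc k) = X (Suc (Suc k)) + (x * y) * X k"
      unfolding X_def by (simp add: algebra_simps)
    thus ?thesis using xy by simp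
  qed
  have e0: "e n k = 0" if "k > n" for k using that by (simp add: e_def pcoeff_def)
  \<comment> \<open>Summation by parts moves multiplication by x + 1 / x from the functions
    \<open>X\<close> to the coefficients. The function with index -1 is - \<open>X 0\<close>, which
    explains the case k = 0; for m = Suc n both boundary terms vanish.\<close>
  have shift: "(\<Sum>k\<le>m. e n k * ((x + y) * X k)) =
     (\<Sum>k\<le>m. ((if k = 0 then - e n 0 else e n (k - 1)) + e n (Suc k)) * X k) + e n m * X (Suc m) - e n (Suc m) * X m" for m
  proof (induction m)
    case 0
    show ?case by (simp add: X0) (simp add: algebra_simps)
  next
    case (Suc m)
    show ?case unfolding sum.atMost_Suc Suc XS by (simp add: algebra_simps)
  qed
  define S where "S = (\<Sum>k\<le>Suc n. e n k * X k)"
  have M: "(1 - x * Q) * (1 - Q * y) = (1 + Q ^ 2) - Q * (x + y)"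
    using xy by (simp add: algebra_simps power2_eq_square)
  have "(x + y) * S = (\<Sum>k\<le>Suc n. e n k * ((x + y) * X k))"
    unfolding S_def sum_distrib_left by (simp only: mult.left_commute)
  also have "\<dots> = (\<Sum>k\<le>Suc n. ((if k = 0 then - e n 0 else e n (k - 1)) + e n (Suc k)) * X k)"
    unfolding shift using e0 by simp
  finally have xyS: "(x + y) * S = \<dots>" .
  have "(1 - x * Q) * (1 - Q * y) * (\<Sum>k\<le>n. e n k * X k) = (1 - x * Q) * (1 - Q * y) * S"
    unfolding S_def using e0 by simp
  also have "\<dots> = (1 + Q ^ 2) * S - Q * ((x + y) * S)"
    unfolding M by (simp only: left_diff_distrib mult.assoc)
  also have "\<dots> = (\<Sum>k\<le>Suc n. ((1 + Q ^ 2) * e n k - Q * ((if k = 0 then - e n 0 else e n (k - 1)) + e n (Suc k))) * X k)"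
    unfolding xyS unfolding S_def sum_distrib_left sum_subtractf[symmetric]
    by (intro sum.cong refl) (simp only: left_diff_distrib mult.assoc)
  also have "\<dots> = (\<Sum>k\<le>Suc n. (1 - Q ^ 2) * (1 - q * Q ^ 2) * (e (Suc n) k * X k))"
  proof (intro sum.cong refl)
    fix k assume "k \<in> {..Suc n}"
    hence k: "k \<le> Suc n" by simp
    show "((1 + Q ^ 2) * e n k - Q * ((if k = 0 then - e n 0 else e n (k - 1)) + e n (Suc k))) * X k =
      (1 - Q ^ 2) * (1 - q * Q ^ 2) * (e (Suc n) k * X k)"
      unfolding e_def Q_def pcoeff_recurrence[OF assms(1,2) k, symmetric] by (simp only: mult_ac)
  qed
  also have "\<dots> = (1 - Q ^ 2) * (1 - q * Q ^ 2) * (\<Sum>k\<le>Suc n. e (Suc n) k * X k)"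
    by (simp only: sum_distrib_left)
  finally have main: "(1 - x * Q) * (1 - Q * y) * (\<Sum>k\<le>n. e n k * X k) =
     (1 - Q ^ 2) * (1 - q * Q ^ 2) * (\<Sum>k\<le>Suc n. e (Suc n) k * X k)" .
  have q1: "qpoch q q (2 * Suc n + 1) = qpoch q q (2 * n + 1) * ((1 - Q ^ 2) * (1 - q * Q ^ 2))"
  proof -
    have "2 * Suc n + 1 = Suc (Suc (2 * n + 1))" by simp
    moreover have "q * q ^ (2 * n + 1) = Q ^ 2" "q * q ^ Suc (2 * n + 1) = q * Q ^ 2"
      unfolding Q_def by (simp_all add: power2_eq_square power_add[symmetric] mult_2 flip: power_Suc)
    ultimately show ?thesis by (simp only: qpoch_Suc mult_ac)
  qed
  have q2: "qpoch (x * q) q (Suc n) * qpoch (q / x) q (Suc n) =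
      (qpoch (x * q) q n * qpoch (q / x) q n) * ((1 - x * Q) * (1 - Q * y))"
    unfolding qpoch_Suc Q_def y_def by (simp add: mult_ac)
  have IH: "(1 - y) * (qpoch (x * q) q n * qpoch (q / x) q n) = qpoch q q (2 * n + 1) * (\<Sum>k\<le>n. e n k * X k)"
    using Suc unfolding e_def y_def X_def .
  have "(1 - y) * (qpoch (x * q) q (Suc n) * qpoch (q / x) q (Suc n)) =
      qpoch q q (2 * n + 1) * ((1 - x * Q) * (1 - Q * y) * (\<Sum>k\<le>n. e n k * X k))"
    unfolding q2 using arg_cong[OF IH, of "\<lambda>c. c * ((1 - x * Q) * (1 - Q * y))"] by (simp only: mult_ac)
  also have "\<dots> = qpoch q q (2 * Suc n + 1) * (\<Sum>k\<le>Suc n. e (Suc n) k * X k)"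
    unfolding main q1 by (simp only: mult_ac)
  finally show ?case unfolding e_def y_def X_def .
qed

text \<open>The quadratic exponent outweighs geometric growth of any rate: the ratio of consecutive
  terms tends to 0.\<close>

lemma summable_tri_power:
  fixes q :: complex
  assumes "norm q < 1"
  shows "summable (\<lambda>k. norm q ^ tri k * R ^ k)"
proof (cases "R = 0 \<or> q = 0")
  case True
  have "norm q ^ tri k * R ^ k = 0" if "k \<noteq> 0" for k
  proof -
    have "(0::real) ^ tri k = 0"
      by (rule zero_power) (use tri_ge[of k] that in linarith)
    thus ?thesis using True that by auto
  qed
  thus ?thesis by (intro summable_finite[of "{0}"]) auto
next
  case False
  have "(\<lambda>k. norm q ^ Suc k * \<bar>R\<bar>) \<longlonglongrightarrow> 0"
    using assms by (intro tendsto_mult_left_zero LIMSEQ_Suc LIMSEQ_power_zero) auto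
  hence "eventually (\<lambda>k. norm q ^ Suc k * \<bar>R\<bar> < 1 / 2) sequentially"
    by (rule order_tendstoD) auto
  then obtain N where N: "\<And>k. k \<ge> N \<Longrightarrow> norm q ^ Suc k * \<bar>R\<bar> < 1 / 2"
    by (auto simp: eventually_sequentially)
  show ?thesis
  proof (rule summable_ratio_test[of "1/2" N])
    fix k assume "k \<ge> N"
    have "norm (norm q ^ tri (Suc k) * R ^ Suc k) = (norm q ^ Suc k * \<bar>R\<bar>) * norm (norm q ^ tri k * R ^ k)"
      unfolding tri_Suc power_add by (simp add: abs_mult power_abs mult_ac)
    also have "\<dots> \<le> 1 / 2 * norm (norm q ^ tri k * R ^ k)"
      using N[OF \<open>k \<ge> N\<close>] by (intro mult_right_mono) auto
    finally show "norm (norm q ^ tri (Suc k) * R ^ Suc k) \<le> 1 / 2 * norm (norm q ^ tri k * R ^ k)" .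
  qed auto
qed

text \<open>Limit of the finite form, again by Tannery's theorem. Of (q; q)_(2 n + 1) and 1 / (q;
  q)^2 one power of (q; q) remains, and 1 - 1 / x completes (q / x; q) to (1 / x; q).\<close>

theorem triple_product:
  assumes "norm q < 1" "q \<noteq> 0" "x \<noteq> 0"
  shows "(\<lambda>k. (-1) ^ k * q ^ tri k * x ^ k - (-1) ^ k * q ^ tri k * (1 / x) ^ (k + 1)) sums
    (qinf q q * qinf (x * q) q * qinf (1 / x) q)"
    "summable (\<lambda>k. norm ((-1) ^ k * q ^ tri k * x ^ k))"
    "summable (\<lambda>k. norm ((-1) ^ k * q ^ tri k * (1 / x) ^ (k + 1)))"
proof -
  define c where "c = (\<lambda>k. (-1) ^ k * q ^ tri k * x ^ k - (-1) ^ k * q ^ tri k * (1 / x) ^ (k + 1))"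
  have s: "summable (\<lambda>k. norm ((-1) ^ k * q ^ tri k * y ^ k))" for y
    using summable_tri_power[OF assms(1), of "norm y"] by (simp add: norm_mult norm_power)
  show s1: "summable (\<lambda>k. norm ((-1) ^ k * q ^ tri k * x ^ k))" by (rule s)
  show s2: "summable (\<lambda>k. norm ((-1) ^ k * q ^ tri k * (1 / x) ^ (k + 1)))"
    using summable_mult2[OF s[of "1 / x"], of "norm (1 / x)"] by (simp add: norm_mult norm_power norm_divide mult_ac)
  have c: "summable (\<lambda>k. norm (c k))"
    unfolding c_def by (rule summable_comparison_test[OF _ summable_add[OF s1 s2]]) (auto intro!: norm_triangle_ineq4)
  obtain K1 where K1: "K1 > 0" "\<And>n k. norm (pcoeff q n k) \<le> K1"
    using pcoeff_bounded[OF assms(1)] by blast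
  have E: "qinf q q \<noteq> 0" by (rule qinf_self_nonzero[OF assms(1)])
  have t: "(\<lambda>n. \<Sum>k. pcoeff q n k * c k) \<longlonglongrightarrow> (\<Sum>k. 1 / qinf q q ^ 2 * c k)"
  proof (intro conjunct2[OF conjunct2[OF tannerys_theorem]])
    show "(\<lambda>n. pcoeff q n k * c k) \<longlonglongrightarrow> 1 / qinf q q ^ 2 * c k" for k
      by (intro tendsto_intros pcoeff_tendsto assms)
    show "\<forall>\<^sub>F (k, n) in sequentially \<times>\<^sub>F sequentially. norm (pcoeff q n k * c k) \<le> K1 * norm (c k)"
      using K1 by (intro always_eventually) (auto simp: norm_mult mult_right_mono)
    show "summable (\<lambda>k. K1 * norm (c k))"
      by (intro summable_mult c)
  qed auto
  have l: "(\<lambda>n. qpoch q q (2 * n + 1)) \<longlonglongrightarrow> qinf q q"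
  proof -
    have "strict_mono (\<lambda>k::nat. 2 * k + 1)" by (auto simp: strict_mono_def)
    from LIMSEQ_subseq_LIMSEQ[OF qpoch_tendsto[OF assms(1), of q] this]
    show ?thesis by (simp add: o_def)
  qed
  have e: "qpoch q q (2 * n + 1) * (\<Sum>k. pcoeff q n k * c k) =
    (1 - 1 / x) * (qpoch (x * q) q n * qpoch (q / x) q n)" for n
  proof -
    have "(\<Sum>k. pcoeff q n k * c k) = (\<Sum>k\<le>n. pcoeff q n k * c k)"
      by (rule suminf_finite) (auto simp: pcoeff_def)
    also have "\<dots> = (\<Sum>k\<le>n. (-1) ^ k * q ^ tri k * pcoeff q n k * (x ^ k - (1 / x) ^ (k + 1)))"
      unfolding c_def by (simp only: algebra_simps)
    finally show ?thesis unfolding finite_triple_product[OF assms] by simp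
  qed
  have "(\<lambda>n. qpoch q q (2 * n + 1) * (\<Sum>k. pcoeff q n k * c k)) \<longlonglongrightarrow>
     qinf q q * (\<Sum>k. 1 / qinf q q ^ 2 * c k)"
    by (intro tendsto_intros l t)
  moreover have "(\<lambda>n. (1 - 1 / x) * (qpoch (x * q) q n * qpoch (q / x) q n)) \<longlonglongrightarrow>
    (1 - 1 / x) * (qinf (x * q) q * qinf (q / x) q)"
    by (intro tendsto_intros qpoch_tendsto assms)
  ultimately have "(1 - 1 / x) * (qinf (x * q) q * qinf (q / x) q) = qinf q q * (\<Sum>k. 1 / qinf q q ^ 2 * c k)"
    unfolding e using LIMSEQ_unique by blast
  also have "(\<Sum>k. 1 / qinf q q ^ 2 * c k) = 1 / qinf q q ^ 2 * (\<Sum>k. c k)"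
    by (intro suminf_mult summable_norm_cancel[OF c])
  finally have "(\<Sum>k. c k) = qinf q q * ((1 - 1 / x) * (qinf (x * q) q * qinf (q / x) q))"
    using E by (simp add: field_simps power2_eq_square)
  also have "\<dots> = qinf q q * qinf (x * q) q * qinf (1 / x) q"
    unfolding qinf_shift[OF assms(1), of "1 / x"] by simp
  finally show "c sums \<dots>"
    using summable_sums[OF summable_norm_cancel[OF c]] by simp
qed

subsection \<open>Eta and theta as products\<close>

lemma e2pi_add: "e2pi (a + b) = e2pi a * e2pi b"
  by (simp add: e2pi_def ring_distribs exp_add)

lemma e2pi_0 [simp]: "e2pi 0 = 1"
  by (simp add: e2pi_def)

lemma e2pi_nonzero [simp]: "e2pi z \<noteq> 0"
  by (simp add: e2pi_def)

lemma e2pi_minus: "e2pi (- a) = 1 / e2pi a"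
  by (simp add: e2pi_def exp_minus field_simps)

lemma e2pi_diff: "e2pi (a - b) = e2pi a / e2pi b"
  using e2pi_add[of a "- b"] by (simp add: e2pi_minus)

lemma e2pi_power: "e2pi z ^ n = e2pi (of_nat n * z)"
  by (simp add: e2pi_def exp_of_nat_mult[symmetric] mult_ac)

lemma e2pi_of_int [simp]: "e2pi (of_int n) = 1"
  using exp_integer_2pi[of "of_int n"] by (simp add: e2pi_def mult_ac)

lemma norm_e2pi: "norm (e2pi z) = exp (- 2 * pi * Im z)"
  by (simp add: e2pi_def)

lemma norm_e2pi_less_1:
  assumes "Im \<tau> > 0"
  shows "norm (e2pi \<tau>) < 1"
  using assms by (simp add: norm_e2pi)

lemma e2pi_eq_1_iff: "e2pi z = 1 \<longleftrightarrow> (\<exists>n::int. z = of_int n)"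
proof
  assume "e2pi z = 1"
  then obtain n :: int where n: "Re (2 * of_real pi * \<i> * z) = 0" "Im (2 * of_real pi * \<i> * z) = of_int (2 * n) * pi"
    unfolding e2pi_def exp_eq_1 by blast
  have "Im z = 0" "Re z = of_int n" using n by auto
  hence "z = of_int n" by (auto simp: complex_eq_iff)
  thus "\<exists>n::int. z = of_int n" ..
qed auto

lemma exp_pi_eq_e2pi: "exp (of_real pi * \<i> * z) = e2pi (z / 2)"
  by (simp add: e2pi_def mult.assoc)

lemma eta_product: "eta \<tau> = e2pi (\<tau> / 24) * qinf (e2pi \<tau>) (e2pi \<tau>)"
  by (simp add: eta_def qinf_def)

lemma eta_nonzero:
  assumes "Im \<tau> > 0"
  shows "eta \<tau> \<noteq> 0"
  using qinf_self_nonzero[OF norm_e2pi_less_1[OF assms]] by (simp add: eta_product)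

lemma eta_add_int: "eta (\<tau> + of_int b) = e2pi (of_int b / 24) * eta \<tau>"
  by (simp add: eta_product add_divide_distrib e2pi_add)

lemma minus_one_powi: "(-1 :: complex) powi n = (if even n then 1 else -1)"
  by (auto simp: power_int_def minus_one_power_iff even_nat_iff)

text \<open>The index shift n \<mapsto> n + a completes the square in the exponent. The translation
  by b contributes e2pi ((2 n + 1) b / 2), which is (-1)^b because 2 n + 1 is odd.\<close>

lemma theta_add_lattice:
  "theta (z + of_int a * \<tau> + of_int b) \<tau> =
    (-1) powi (a + b) * e2pi (- (of_int a ^ 2 * \<tau> / 2) - of_int a * z) * theta z \<tau>"
proof -
  define f where "f = (\<lambda>z n. (-1) powi n * exp (of_real pi * \<i> * of_int (2 * n + 1) * z)
       * e2pi ((of_int (n * (n + 1)) / 2 + 1 / 8) * \<tau>))"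
  have th: "theta z \<tau> = (\<Sum>\<^sub>\<infinity>n. f z n)" for z
    by (simp only: theta_def f_def)
  define c where "c = (-1) powi (a + b) * e2pi (- (of_int a ^ 2 * \<tau> / 2) - of_int a * z)"
  have "f (z + of_int a * \<tau> + of_int b) n = c * f z (n + a)" for n
  proof -
    have 1: "((-1) :: complex) powi (a + b) * (-1) powi (n + a) = (-1) powi n * (-1) powi b"
      by (auto simp: power_int_add minus_one_powi)
    have 2: "e2pi (of_int ((2 * n + 1) * b) / 2) = (-1) powi b"
    proof (cases "even b")
      case True
      then obtain c where c: "b = 2 * c" by auto
      have "of_int ((2 * n + 1) * b) / 2 = (of_int ((2 * n + 1) * c) :: complex)" by (simp add: c)
      thus ?thesis using True by (simp del: of_int_mult of_int_add add: minus_one_powi)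
    next
      case False
      then obtain c where c: "b = 2 * c + 1" by (elim oddE)
      have "of_int ((2 * n + 1) * b) / 2 = (of_int (2 * n * c + n + c) :: complex) + 1 / 2"
        by (simp add: c algebra_simps add_divide_distrib)
      hence "e2pi (of_int ((2 * n + 1) * b) / 2) = e2pi (1 / 2)"
        by (simp only: e2pi_add e2pi_of_int mult_1_left)
      moreover have "e2pi (1 / 2) = -1" by (simp add: e2pi_def)
      ultimately show ?thesis using False by (simp add: minus_one_powi)
    qed
    have 3: "exp (of_real pi * \<i> * of_int (2 * n + 1) * (z + of_int a * \<tau> + of_int b)) *
        e2pi ((of_int (n * (n + 1)) / 2 + 1 / 8) * \<tau>) =
       e2pi (of_int ((2 * n + 1) * b) / 2) * e2pi (- (of_int a ^ 2 * \<tau> / 2) - of_int a * z) *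
       (exp (of_real pi * \<i> * of_int (2 * (n + a) + 1) * z) *
        e2pi ((of_int ((n + a) * (n + a + 1)) / 2 + 1 / 8) * \<tau>))"
      unfolding mult.assoc[of "of_real pi * \<i>"] exp_pi_eq_e2pi e2pi_add[symmetric]
      by (rule arg_cong[where f = e2pi]) (simp add: field_simps power2_eq_square)
    have "f (z + of_int a * \<tau> + of_int b) n =
       ((-1) powi n * (-1) powi b) * e2pi (- (of_int a ^ 2 * \<tau> / 2) - of_int a * z) *
       (exp (of_real pi * \<i> * of_int (2 * (n + a) + 1) * z) *
        e2pi ((of_int ((n + a) * (n + a + 1)) / 2 + 1 / 8) * \<tau>))"
      unfolding f_def mult.assoc[of "(-1) powi n"] 3 2 by (simp only: mult_ac)
    thus ?thesis unfolding 1[symmetric] c_def f_def by (simp only: mult_ac)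
  qed
  hence "theta (z + of_int a * \<tau> + of_int b) \<tau> = (\<Sum>\<^sub>\<infinity>n. c * f z (n + a))"
    unfolding th by presburger
  also have "\<dots> = (\<Sum>\<^sub>\<infinity>n. c * f z n)"
    by (rule infsum_reindex_bij_betw) (rule bij_betwI[of _ _ _ "\<lambda>n. n - a"], auto)
  also have "\<dots> = c * theta z \<tau>"
    unfolding th by (rule infsum_cmult_right')
  finally show ?thesis unfolding c_def .
qed

text \<open>The substitution n \<mapsto> -1 - n fixes n (n + 1) and reverses the signs of 2 n + 1
  and (-1)^n.\<close>

lemma theta_minus: "theta (- z) \<tau> = - theta z \<tau>"
proof -
  define f where "f = (\<lambda>z n. (-1) powi n * exp (of_real pi * \<i> * of_int (2 * n + 1) * z)
       * e2pi ((of_int (n * (n + 1)) / 2 + 1 / 8) * \<tau>))"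
  have th: "theta z \<tau> = (\<Sum>\<^sub>\<infinity>n. f z n)" for z
    by (simp only: theta_def f_def)
  have "f (- z) n = - f z (- 1 - n)" for n
  proof -
    have "(-1) powi (- 1 - n) = - ((-1) powi n :: complex)"
      by (auto simp: minus_one_powi)
    moreover have "(- 1 - n) * (- 1 - n + 1) = n * (n + 1)" by (simp add: algebra_simps)
    moreover have "of_int (2 * (- 1 - n) + 1) * z = of_int (2 * n + 1) * (- z)"
      by (simp add: algebra_simps)
    ultimately show ?thesis unfolding f_def mult.assoc[of "of_real pi * \<i>"] by simp
  qed
  hence "theta (- z) \<tau> = (\<Sum>\<^sub>\<infinity>n. - f z (- 1 - n))"
    unfolding th by presburger
  also have "\<dots> = (\<Sum>\<^sub>\<infinity>n. - f z n)"
    by (rule infsum_reindex_bij_betw) (rule bij_betwI[of _ _ _ "\<lambda>n. - 1 - n"], auto)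
  also have "\<dots> = - theta z \<tau>"
    unfolding th by (rule infsum_uminus)
  finally show ?thesis .
qed

text \<open>n (n + 1) / 2 is an integer, so only the factor q^(1/8) feels the translation.\<close>

lemma theta_add_int_tau: "theta z (\<tau> + of_int b) = e2pi (of_int b / 8) * theta z \<tau>"
proof -
  have "e2pi ((of_int (n * (n + 1)) / 2 + 1 / 8) * (\<tau> + of_int b)) =
    e2pi (of_int b / 8) * e2pi ((of_int (n * (n + 1)) / 2 + 1 / 8) * \<tau>)" for n :: int
  proof -
    have "even (n * (n + 1))" by simp
    then obtain m where m: "n * (n + 1) = 2 * m" by blast
    have "(of_int (n * (n + 1)) / 2 + 1 / 8) * (\<tau> + of_int b) =
      of_int (m * b) + (of_int b / 8 + (of_int (n * (n + 1)) / 2 + 1 / 8) * \<tau>)"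
      unfolding m by (simp add: algebra_simps)
    thus ?thesis by (simp only: e2pi_add e2pi_of_int mult_1_left)
  qed
  thus ?thesis unfolding theta_def
    by (simp add: infsum_cmult_right'[symmetric] mult_ac)
qed

text \<open>The integers split into n = k and n = -1 - k with k natural, and the two halves are the
  two series of \<open>triple_product\<close>.\<close>

theorem theta_product:
  fixes z \<tau> :: complex
  assumes "Im \<tau> > 0"
  defines "q \<equiv> e2pi \<tau>" and "x \<equiv> e2pi z"
  shows "theta z \<tau> = e2pi (\<tau> / 8) * e2pi (z / 2) * (qinf q q * qinf (x * q) q * qinf (1 / x) q)"
proof -
  have q: "norm q < 1" "q \<noteq> 0" "x \<noteq> 0" unfolding q_def x_def using norm_e2pi_less_1[OF assms(1)] by auto
  define f where "f = (\<lambda>n::int. (-1) powi n * exp (of_real pi * \<i> * of_int (2 * n + 1) * z)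
       * e2pi ((of_int (n * (n + 1)) / 2 + 1 / 8) * \<tau>))"
  define A where "A = e2pi (\<tau> / 8) * e2pi (z / 2)"
  have qtri: "q ^ tri k = e2pi (of_int (int k * (int k + 1)) / 2 * \<tau>)" for k
  proof -
    have "of_nat (tri k) = (of_nat (k * (k + 1)) / 2 :: complex)"
      by (simp add: field_char_0_class.of_nat_div)
    thus ?thesis unfolding q_def e2pi_power by (simp only: of_nat_mult of_nat_add of_nat_1 of_int_mult of_int_add of_int_of_nat_eq of_int_1)
  qed
  have f1: "f (int k) = A * ((-1) ^ k * q ^ tri k * x ^ k)" for k
    unfolding f_def A_def qtri x_def e2pi_power mult.assoc[of "of_real pi * \<i>"] exp_pi_eq_e2pi
    by (simp add: e2pi_add[symmetric] mult_ac) (simp add: algebra_simps add_divide_distrib flip: e2pi_add)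
  have f2: "f (- 1 - int k) = A * (- ((-1) ^ k * q ^ tri k * (1 / x) ^ (k + 1)))" for k
  proof -
    have 1: "(-1) powi (- 1 - int k) = - ((-1) ^ k :: complex)"
      by (auto simp: minus_one_powi minus_one_power_iff)
    have 2: "(1 / x) ^ (k + 1) = e2pi (- of_nat (k + 1) * z)"
      unfolding x_def e2pi_minus[symmetric] e2pi_power by (simp only: mult_minus_right mult_minus_left)
    have 3: "(- 1 - int k) * (- 1 - int k + 1) = int k * (int k + 1)" by (simp add: algebra_simps)
    have 4: "e2pi ((of_int (2 * (- 1 - int k) + 1) * z) / 2) * e2pi ((of_int (int k * (int k + 1)) / 2 + 1 / 8) * \<tau>)
       = A * (e2pi (of_int (int k * (int k + 1)) / 2 * \<tau>) * e2pi (- of_nat (k + 1) * z))"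
      unfolding A_def e2pi_add[symmetric] by (rule arg_cong[where f = e2pi]) (simp add: field_simps)
    show ?thesis
      unfolding f_def 1 2 3 qtri mult.assoc[of "of_real pi * \<i>"] exp_pi_eq_e2pi
      using 4 by (simp add: mult_ac)
  qed
  note tp = triple_product[OF q]
  have "((\<lambda>k. A * ((-1) ^ k * q ^ tri k * x ^ k)) has_sum (A * (\<Sum>k. (-1) ^ k * q ^ tri k * x ^ k))) UNIV"
    by (intro has_sum_cmult_right norm_summable_imp_has_sum tp(2) summable_sums summable_norm_cancel[OF tp(2)])
  hence s1: "(f has_sum (A * (\<Sum>k. (-1) ^ k * q ^ tri k * x ^ k))) (range int)"
    by (subst has_sum_reindex) (auto simp: f1 o_def)
  have "((\<lambda>k. A * (- ((-1) ^ k * q ^ tri k * (1 / x) ^ (k + 1)))) has_sum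
      (A * (- (\<Sum>k. (-1) ^ k * q ^ tri k * (1 / x) ^ (k + 1))))) UNIV"
    by (intro has_sum_cmult_right has_sum_uminusI norm_summable_imp_has_sum tp(3) summable_sums summable_norm_cancel[OF tp(3)])
  hence s2: "(f has_sum (A * (- (\<Sum>k. (-1) ^ k * q ^ tri k * (1 / x) ^ (k + 1))))) (range (\<lambda>k. - 1 - int k))"
    by (subst has_sum_reindex) (auto simp: f2 o_def inj_on_def)
  have "(UNIV :: int set) = range int \<union> range (\<lambda>k. - 1 - int k)"
  proof -
    have "n \<in> range int \<union> range (\<lambda>k. - 1 - int k)" for n
    proof (cases "n \<ge> 0")
      case True
      hence "n = int (nat n)" by simp
      thus ?thesis by blast
    next
      case False
      hence "n = - 1 - int (nat (- 1 - n))" by simp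
      thus ?thesis by blast
    qed
    thus ?thesis by blast
  qed
  moreover have "range int \<inter> range (\<lambda>k. - 1 - int k) = {}" by auto
  ultimately have "(f has_sum (A * (\<Sum>k. (-1) ^ k * q ^ tri k * x ^ k) +
      A * (- (\<Sum>k. (-1) ^ k * q ^ tri k * (1 / x) ^ (k + 1))))) UNIV"
    using has_sum_Un_disjoint[OF s1 s2] by simp
  hence "theta z \<tau> = A * ((\<Sum>k. (-1) ^ k * q ^ tri k * x ^ k) - (\<Sum>k. (-1) ^ k * q ^ tri k * (1 / x) ^ (k + 1)))"
    unfolding theta_def f_def by (simp add: infsumI algebra_simps)
  also have "(\<Sum>k. (-1) ^ k * q ^ tri k * x ^ k) - (\<Sum>k. (-1) ^ k * q ^ tri k * (1 / x) ^ (k + 1)) =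
    qinf q q * qinf (x * q) q * qinf (1 / x) q"
    using sums_diff[OF summable_sums[OF summable_norm_cancel[OF tp(2)]] summable_sums[OF summable_norm_cancel[OF tp(3)]]]
      tp(1) sums_unique2 by blast
  finally show ?thesis unfolding A_def .
qed

lemma theta_eq_0_iff:
  assumes "Im \<tau> > 0"
  shows "theta z \<tau> = 0 \<longleftrightarrow> (\<exists>m n :: int. z = of_int n * \<tau> + of_int m)"
proof -
  have q: "norm (e2pi \<tau>) < 1" by (rule norm_e2pi_less_1[OF assms])
  have 1: "e2pi z * e2pi \<tau> * e2pi \<tau> ^ k = e2pi (z + of_int (int k + 1) * \<tau>)" for k
    by (simp add: e2pi_power e2pi_add[symmetric] algebra_simps)
  have 2: "1 / e2pi z * e2pi \<tau> ^ k = e2pi (of_int (int k) * \<tau> - z)" for k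
    by (simp add: e2pi_power e2pi_diff)
  have "theta z \<tau> = 0 \<longleftrightarrow> (\<exists>k. e2pi (z + of_int (int k + 1) * \<tau>) = 1) \<or> (\<exists>k. e2pi (of_int (int k) * \<tau> - z) = 1)"
    unfolding theta_product[OF assms] mult_eq_0_iff qinf_eq_0_iff[OF q] 1 2
    using qinf_self_nonzero[OF q] q qinf_eq_0_iff[OF q] by auto
  also have "\<dots> \<longleftrightarrow> (\<exists>m n :: int. z = of_int n * \<tau> + of_int m)"
  proof
    assume "(\<exists>k. e2pi (z + of_int (int k + 1) * \<tau>) = 1) \<or> (\<exists>k. e2pi (of_int (int k) * \<tau> - z) = 1)"
    then consider k m where "z + of_int (int k + 1) * \<tau> = of_int m" | k m where "of_int (int k) * \<tau> - z = of_int m"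
      unfolding e2pi_eq_1_iff by blast
    thus "\<exists>m n :: int. z = of_int n * \<tau> + of_int m"
    proof cases
      case 1
      hence "z = of_int (- (int k + 1)) * \<tau> + of_int m" by (simp add: algebra_simps)
      thus ?thesis by blast
    next
      case 2
      hence "z = of_int (int k) * \<tau> + of_int (- m)" by (simp add: algebra_simps)
      thus ?thesis by blast
    qed
  next
    assume "\<exists>m n :: int. z = of_int n * \<tau> + of_int m"
    then obtain m n :: int where z: "z = of_int n * \<tau> + of_int m" by blast
    show "(\<exists>k. e2pi (z + of_int (int k + 1) * \<tau>) = 1) \<or> (\<exists>k. e2pi (of_int (int k) * \<tau> - z) = 1)"
    proof (cases "n \<ge> 0")
      case True
      hence "of_int (int (nat n)) * \<tau> - z = of_int (- m)" by (simp add: z)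
      thus ?thesis unfolding e2pi_eq_1_iff by blast
    next
      case False
      hence "int (nat (- n - 1)) + 1 = - n" by simp
      hence "z + of_int (int (nat (- n - 1)) + 1) * \<tau> = of_int m" by (simp only: z) simp
      thus ?thesis unfolding e2pi_eq_1_iff by blast
    qed
  qed
  finally show ?thesis .
qed

text \<open>Where theta vanishes, division by zero gives \<open>phi\<close> the value 0. Its
  transformation laws therefore hold at every z, whereas for \<open>g2_sum\<close> they can be
  asserted only away from the poles.\<close>

definition phi :: "complex \<Rightarrow> complex \<Rightarrow> complex" where
  "phi z \<tau> = eta (2 * \<tau>) ^ 4 / (eta \<tau> ^ 2 * theta (2 * z) (2 * \<tau>))"

theorem g2_sum_eq_phi:
  assumes "Im \<tau> > 0" "theta (2 * \<alpha>) (2 * \<tau>) \<noteq> 0"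
  shows "g2_sum \<alpha> \<tau> = - 2 * phi \<alpha> \<tau>"
proof -
  define q w where "q = e2pi \<tau>" and "w = e2pi \<alpha>"
  have q: "norm q < 1" "q \<noteq> 0" "w \<noteq> 0" unfolding q_def w_def using norm_e2pi_less_1[OF assms(1)] by auto
  have q2: "norm (q ^ 2) < 1" using q by (auto simp: norm_power power_less_one_iff)
  have qq: "e2pi (2 * \<tau>) = q ^ 2" "e2pi (2 * \<alpha>) = w ^ 2" by (simp_all add: q_def w_def e2pi_power)
  have Im2: "Im (2 * \<tau>) > 0" using assms by simp
  define E where "E = qinf (q ^ 2) (q ^ 2)"
  define V where "V = qinf (w ^ 2 * q ^ 2) (q ^ 2)"
  define U where "U = qinf (q ^ 2 / w ^ 2) (q ^ 2)"
  have sh1: "qinf (w ^ 2) (q ^ 2) = (1 - w ^ 2) * V" unfolding V_def by (rule qinf_shift[OF q2])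
  have sh2: "qinf (1 / w ^ 2) (q ^ 2) = (1 - 1 / w ^ 2) * U"
    unfolding U_def using qinf_shift[OF q2, of "1 / w ^ 2"] by simp
  have th: "theta (2 * \<alpha>) (2 * \<tau>) = e2pi (\<tau> / 4) * w * (E * V * ((1 - 1 / w ^ 2) * U))"
    unfolding theta_product[OF Im2] qq E_def V_def sh2[symmetric] by (simp add: w_def)
  have nz: "V \<noteq> 0" "U \<noteq> 0" "1 - 1 / w ^ 2 \<noteq> 0" "E \<noteq> 0" using assms(2) unfolding th by auto
  have w2: "1 - w ^ 2 \<noteq> 0" using nz(3) q(3) by (auto simp: field_simps)
  have gen: "theta_generic (w ^ 2) (q ^ 2)"
  proof -
    have "qinf (w ^ 2) (q ^ 2) \<noteq> 0" "qinf (q ^ 2 / w ^ 2) (q ^ 2) \<noteq> 0"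
      using nz w2 unfolding sh1 by (auto simp: U_def)
    thus ?thesis unfolding qinf_eq_0_iff[OF q2] theta_generic_def using q(3) by (auto simp: field_simps)
  qed
  have E1: "qinf q q \<noteq> 0" by (rule qinf_self_nonzero[OF q(1)])
  have neg: "qinf (- q) q = E / qinf q q"
    using qinf_mult_neg[OF q(1), of q] E1 unfolding E_def by (simp add: field_simps)
  have lhs: "g2_sum \<alpha> \<tau> = w * (2 * (E / qinf q q ^ 2) * E ^ 2 / ((1 - w ^ 2) * V * U))"
    unfolding g2_sum_def w_def[symmetric] q_def[symmetric] g2_sum_product[OF q(1,2) gen] neg sh1
      E_def[symmetric] U_def[symmetric] by (simp add: power2_eq_square)
  have e4: "eta (2 * \<tau>) ^ 4 = e2pi (\<tau> / 3) * E ^ 4"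
    unfolding eta_product qq E_def power_mult_distrib e2pi_power by simp
  have e2: "eta \<tau> ^ 2 = e2pi (\<tau> / 12) * qinf q q ^ 2"
    unfolding eta_product q_def power_mult_distrib e2pi_power by simp
  \<comment> \<open>The fractional powers of q cancel: eta^4 contributes 4 * 2 / 24 = 1/3, eta^2
    contributes 2/24 = 1/12 and theta contributes 2/8 = 1/4.\<close>
  have e: "e2pi (\<tau> / 3) = e2pi (\<tau> / 12) * e2pi (\<tau> / 4)"
    unfolding e2pi_add[symmetric] by simp
  \<comment> \<open>Theta contains (1 / w^2; q^2), the partial fraction sum contains (w^2; q^2).
    Exchanging their first factors produces the minus sign.\<close>
  have w3: "w * (1 - 1 / w ^ 2) = - (1 - w ^ 2) / w" using q(3) by (simp add: field_simps power2_eq_square)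
  have "- 2 * phi \<alpha> \<tau> = - 2 * (e2pi (\<tau> / 12) * e2pi (\<tau> / 4) * E ^ 4) /
     (e2pi (\<tau> / 12) * qinf q q ^ 2 * (e2pi (\<tau> / 4) * (w * (1 - 1 / w ^ 2)) * (E * V * U)))"
    unfolding phi_def e4 e2 e th by (simp add: mult_ac)
  also have "\<dots> = - 2 * (E ^ 4) / (qinf q q ^ 2 * ((- (1 - w ^ 2) / w) * (E * V * U)))"
    unfolding w3 by (simp add: mult_ac)
  also have "\<dots> = w * (2 * (E / qinf q q ^ 2) * E ^ 2 / ((1 - w ^ 2) * V * U))"
    using nz w2 q(3) E1 by (simp add: divide_simps) (simp add: eval_nat_numeral algebra_simps)
  finally show ?thesis using lhs by simp
qed

subsection \<open>Holomorphy in two variables\<close>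

text \<open>The pointwise form of \<open>holomorphic2_on\<close>, for which product, chain and
  composition rules can be stated at a single point.\<close>

definition hd2 :: "(complex \<times> complex \<Rightarrow> complex) \<Rightarrow> complex \<times> complex \<Rightarrow> bool" where
  "hd2 f p \<longleftrightarrow> (\<exists>a b. (f has_derivative (\<lambda>(x, y). a * x + b * y)) (at p))"

lemma holomorphic2_on_iff: "holomorphic2_on f U \<longleftrightarrow> (\<forall>p\<in>U. hd2 f p)"
  by (simp add: holomorphic2_on_def hd2_def)

lemma hd2_I:
  assumes "(f has_derivative D) (at p)" "\<And>x y. D (x, y) = a * x + b * y"
  shows "hd2 f p"
proof -
  have "D = (\<lambda>(x, y). a * x + b * y)" using assms(2) by auto
  thus ?thesis using assms(1) unfolding hd2_def by blast
qed

lemma hd2_const: "hd2 (\<lambda>_. c) p"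
  by (rule hd2_I[where a = 0 and b = 0]) (auto intro!: derivative_eq_intros)

lemma hd2_fst: "hd2 fst p"
  by (rule hd2_I[where a = 1 and b = 0]) (auto intro!: derivative_eq_intros)

lemma hd2_snd: "hd2 snd p"
  by (rule hd2_I[where a = 0 and b = 1]) (auto intro!: derivative_eq_intros)

lemma hd2_mult:
  assumes "hd2 f p" "hd2 g p"
  shows "hd2 (\<lambda>x. f x * g x) p"
proof -
  obtain a b c d where f: "(f has_derivative (\<lambda>(x, y). a * x + b * y)) (at p)"
    and g: "(g has_derivative (\<lambda>(x, y). c * x + d * y)) (at p)"
    using assms unfolding hd2_def by blast
  show ?thesis
    by (rule hd2_I[OF has_derivative_mult[OF f g], where a = "f p * c + a * g p" and b = "f p * d + b * g p"])
       (simp add: algebra_simps)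
qed

lemma hd2_add:
  assumes "hd2 f p" "hd2 g p"
  shows "hd2 (\<lambda>x. f x + g x) p"
proof -
  obtain a b c d where f: "(f has_derivative (\<lambda>(x, y). a * x + b * y)) (at p)"
    and g: "(g has_derivative (\<lambda>(x, y). c * x + d * y)) (at p)"
    using assms unfolding hd2_def by blast
  show ?thesis
    by (rule hd2_I[OF has_derivative_add[OF f g], where a = "a + c" and b = "b + d"])
       (simp add: algebra_simps)
qed

lemma hd2_power:
  assumes "hd2 f p"
  shows "hd2 (\<lambda>x. f x ^ n) p"
  by (induction n) (auto intro: hd2_const hd2_mult assms)

lemma hd2_comp1:
  assumes "h field_differentiable (at (f p))" "hd2 f p"
  shows "hd2 (\<lambda>x. h (f x)) p"
proof -
  obtain a b where f: "(f has_derivative (\<lambda>(x, y). a * x + b * y)) (at p)"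
    using assms unfolding hd2_def by blast
  obtain d where h: "(h has_derivative (*) d) (at (f p))"
    using assms unfolding field_differentiable_def has_field_derivative_def by blast
  have "((h \<circ> f) has_derivative ((*) d \<circ> (\<lambda>(x, y). a * x + b * y))) (at p)"
    by (rule diff_chain_at[OF f h])
  from hd2_I[OF this, where a = "d * a" and b = "d * b"] show ?thesis
    by (simp add: algebra_simps o_def)
qed

lemma hd2_comp2:
  assumes "hd2 F (f p, g p)" "hd2 f p" "hd2 g p"
  shows "hd2 (\<lambda>x. F (f x, g x)) p"
proof -
  obtain a b c d s t where f: "(f has_derivative (\<lambda>(x, y). a * x + b * y)) (at p)"
    and g: "(g has_derivative (\<lambda>(x, y). c * x + d * y)) (at p)"
    and F: "(F has_derivative (\<lambda>(x, y). s * x + t * y)) (at (f p, g p))"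
    using assms unfolding hd2_def by blast
  have "((F \<circ> (\<lambda>x. (f x, g x))) has_derivative
     ((\<lambda>(x, y). s * x + t * y) \<circ> (\<lambda>h. ((\<lambda>(x, y). a * x + b * y) h, (\<lambda>(x, y). c * x + d * y) h)))) (at p)"
    by (rule diff_chain_at[OF has_derivative_Pair[OF f g]]) (use F in simp)
  from hd2_I[OF this, where a = "s * a + t * c" and b = "s * b + t * d"] show ?thesis
    by (simp add: algebra_simps o_def)
qed

lemma hd2_comp_curve:
  assumes "hd2 F (f z, g z)" "f field_differentiable at z" "g field_differentiable at z"
  shows "(\<lambda>z. F (f z, g z)) field_differentiable at z"
proof -
  obtain c d s t where f: "(f has_derivative (*) c) (at z)"
    and g: "(g has_derivative (*) d) (at z)"
    and F: "(F has_derivative (\<lambda>(x, y). s * x + t * y)) (at (f z, g z))"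
    using assms unfolding hd2_def field_differentiable_def has_field_derivative_def by blast
  have "((F \<circ> (\<lambda>x. (f x, g x))) has_derivative
     ((\<lambda>(x, y). s * x + t * y) \<circ> (\<lambda>h. (c * h, d * h)))) (at z)"
    by (rule diff_chain_at[OF has_derivative_Pair[OF f g]]) (use F in simp)
  moreover have "((\<lambda>(x, y). s * x + t * y) \<circ> (\<lambda>h. (c * h, d * h))) = (*) (s * c + t * d)"
    by (auto simp: fun_eq_iff algebra_simps)
  ultimately show ?thesis
    unfolding field_differentiable_def has_field_derivative_def by (auto simp: o_def)
qed

lemma hd2_transform:
  assumes "hd2 f p" "open U" "p \<in> U" "\<And>x. x \<in> U \<Longrightarrow> f x = g x"
  shows "hd2 g p"
  using assms has_derivative_transform_within_open unfolding hd2_def by blast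

text \<open>Osgood's lemma: Cauchy's formula in the second variable makes that partial derivative continuous.\<close>

lemma osgood:
  fixes f :: "complex \<times> complex \<Rightarrow> complex"
  assumes "open U" "continuous_on U f"
    "\<And>x y. (x, y) \<in> U \<Longrightarrow> (\<lambda>x. f (x, y)) field_differentiable at x"
    "\<And>x y. (x, y) \<in> U \<Longrightarrow> (\<lambda>y. f (x, y)) field_differentiable at y"
  shows "holomorphic2_on f U"
  unfolding holomorphic2_on_iff
proof
  fix p assume "p \<in> U"
  obtain x0 y0 where p: "p = (x0, y0)" by (cases p)
  obtain A B where AB': "open A" "open B" "p \<in> A \<times> B" "A \<times> B \<subseteq> U"
    by (rule open_prod_elim[OF assms(1) \<open>p \<in> U\<close>])
  hence AB: "open A" "open B" "x0 \<in> A" "y0 \<in> B" "A \<times> B \<subseteq> U" unfolding p by auto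
  obtain r where r: "r > 0" "cball y0 r \<subseteq> B" using AB open_contains_cball by blast
  define Y where "Y = ball y0 r"
  define g where "g = circlepath y0 r"
  have gB: "g t \<in> cball y0 r" "g t \<notin> Y" if "t \<in> {0..1}" for t
    using that r unfolding g_def Y_def circlepath by (auto simp: dist_norm norm_mult)
  \<comment> \<open>Cauchy's integral for the derivative in y over a fixed circle, written out as an
    integral over [0, 1] so that continuity in the parameters x and y is available.\<close>
  define d where "d = (\<lambda>x y. 1 / (2 * of_real pi * \<i>) * integral (cbox 0 1) (\<lambda>t. f (x, g t) / (g t - y) ^ 2 *
       (2 * of_real pi * \<i> * of_real r * exp (2 * of_real pi * \<i> * of_real t))))"
  have cont: "continuous_on (A \<times> Y) (\<lambda>p. d (fst p) (snd p))"
  proof -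
    have gc: "continuous_on {0..1} g" unfolding g_def circlepath by (intro continuous_intros)
    have f1: "continuous_on ((A \<times> Y) \<times> cbox 0 1) (\<lambda>z. f (fst (fst z), g (snd z)))"
    proof (rule continuous_on_compose2[OF assms(2)])
      show "continuous_on ((A \<times> Y) \<times> cbox (0::real) 1) (\<lambda>z. (fst (fst z), g (snd z)))"
        by (intro continuous_intros continuous_on_compose2[OF gc]) auto
      show "(\<lambda>z. (fst (fst z), g (snd z))) ` ((A \<times> Y) \<times> cbox (0::real) 1) \<subseteq> U"
        using AB(5) gB r(2) by fastforce
    qed
    have f2: "continuous_on ((A \<times> Y) \<times> cbox 0 1) (\<lambda>z. g (snd z))"
      by (rule continuous_on_compose2[OF gc]) (auto intro: continuous_intros)
    have "continuous_on ((A \<times> Y) \<times> cbox 0 1) (\<lambda>z. f (fst (fst z), g (snd z)) / (g (snd z) - snd (fst z)) ^ 2 *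
       (2 * of_real pi * \<i> * of_real r * exp (2 * of_real pi * \<i> * of_real (snd z))))"
      by (intro continuous_intros f1 f2) (use gB(2) in auto)
    hence "continuous_on (A \<times> Y) (\<lambda>p. integral (cbox 0 1) (\<lambda>t. f (fst p, g t) / (g t - snd p) ^ 2 *
       (2 * of_real pi * \<i> * of_real r * exp (2 * of_real pi * \<i> * of_real t))))"
      by (intro integral_continuous_on_param) (simp add: case_prod_beta)
    thus ?thesis unfolding d_def by (intro continuous_intros) auto
  qed
  have der: "((\<lambda>y. f (x, y)) has_field_derivative d x y) (at y)" if "x \<in> A" "y \<in> Y" for x y
  proof -
    have fd: "(\<lambda>y. f (x, y)) field_differentiable at u" if "u \<in> cball y0 r" for u
      using assms(4) AB(5) r(2) that \<open>x \<in> A\<close> by blast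
    have h: "(\<lambda>y. f (x, y)) holomorphic_on ball y0 r"
      using fd by (intro holomorphic_onI) (auto intro: field_differentiable_at_within)
    have c: "continuous_on (cball y0 r) (\<lambda>y. f (x, y))"
      using fd by (intro continuous_at_imp_continuous_on) (auto intro: field_differentiable_imp_continuous_at)
    have "((\<lambda>y. f (x, y)) has_field_derivative (1 / (2 * of_real pi * \<i>) *
       contour_integral (circlepath y0 r) (\<lambda>u. f (x, u) / (u - y) ^ 2))) (at y)"
      by (rule Cauchy_derivative_integral_circlepath(2)[OF c h]) (use that in \<open>simp add: Y_def\<close>)
    moreover have "contour_integral (circlepath y0 r) (\<lambda>u. f (x, u) / (u - y) ^ 2) =
      integral (cbox 0 1) (\<lambda>t. f (x, g t) / (g t - y) ^ 2 *
       (2 * of_real pi * \<i> * of_real r * exp (2 * of_real pi * \<i> * of_real t)))"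
      unfolding contour_integral_integral g_def cbox_interval
      by (intro integral_cong) (simp add: vector_derivative_circlepath)
    ultimately show ?thesis unfolding d_def by simp
  qed
  obtain c where c: "((\<lambda>x. f (x, y0)) has_field_derivative c) (at x0)"
    using assms(3) \<open>p \<in> U\<close> p unfolding field_differentiable_def by blast
  have yY: "y0 \<in> Y" using r by (simp add: Y_def)
  \<comment> \<open>A derivative in the first variable at the point itself and a jointly continuous
    partial derivative in the second together give total differentiability.\<close>
  have "((\<lambda>(x, y). f (x, y)) has_derivative (\<lambda>(tx, ty). c * tx + blinfun_apply (blinfun_mult_right (d x0 y0)) ty))
     (at (x0, y0) within A \<times> Y)"
  proof (rule has_derivative_partialsI)
    show "((\<lambda>x. f (x, y0)) has_derivative (*) c) (at x0 within A)"
      using c unfolding has_field_derivative_def by (rule has_derivative_at_withinI)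
    show "((\<lambda>y. f (x, y)) has_derivative blinfun_apply (blinfun_mult_right (d x y))) (at y within Y)"
      if "x \<in> A" "y \<in> Y" for x y
      using der[OF that] unfolding has_field_derivative_def
      by (simp add: has_derivative_at_withinI)
    have "continuous_on (A \<times> Y) (\<lambda>p. blinfun_mult_right (d (fst p) (snd p)))"
      by (intro bounded_linear.continuous_on[OF bounded_linear_blinfun_mult_right] cont)
    thus "continuous (at (x0, y0) within A \<times> Y) (\<lambda>(x, y). blinfun_mult_right (d x y))"
      unfolding continuous_on_eq_continuous_within case_prod_unfold
      by (rule bspec) (use AB(3) yY in auto)
    show "y0 \<in> Y" "convex Y" using yY by (auto simp: Y_def)
  qed
  hence "(f has_derivative (\<lambda>(tx, ty). c * tx + d x0 y0 * ty)) (at (x0, y0) within A \<times> Y)"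
    by simp
  moreover have "open (A \<times> Y)" using AB by (auto simp: Y_def open_Times)
  ultimately have "(f has_derivative (\<lambda>(tx, ty). c * tx + d x0 y0 * ty)) (at (x0, y0))"
    using at_within_open[of "(x0, y0)" "A \<times> Y"] AB(3) yY by auto
  thus "hd2 f p" unfolding hd2_def p by blast
qed

text \<open>Weierstrass majorant R \<rho>^n on a closed polydisc.\<close>

lemma qinf_uniform_limit:
  assumes "0 \<le> \<rho>" "\<rho> < 1"
  shows "uniform_limit (cball 0 R \<times> cball 0 \<rho>) (\<lambda>n p. qpoch (fst p) (snd p) n) (\<lambda>p. qinf (fst p) (snd p)) sequentially"
proof -
  let ?K = "cball (0::complex) R \<times> cball (0::complex) \<rho>"
  have "uniformly_convergent_on ?K (\<lambda>N x. \<Prod>n<N. 1 - fst x * snd x ^ n)"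
  proof (rule uniformly_convergent_on_prod')
    show "uniformly_convergent_on ?K (\<lambda>N x. \<Sum>n<N. norm (1 - fst x * snd x ^ n - 1))"
    proof (rule Weierstrass_m_test')
      fix n and x :: "complex \<times> complex" assume x: "x \<in> ?K"
      have "norm (fst x) * norm (snd x) ^ n \<le> R * \<rho> ^ n"
        using x by (intro mult_mono power_mono) (auto simp: mem_Times_iff intro: order_trans[OF norm_ge_zero])
      thus "norm (norm (1 - fst x * snd x ^ n - 1)) \<le> R * \<rho> ^ n"
        by (simp add: norm_mult norm_power)
    next
      show "summable (\<lambda>n. R * \<rho> ^ n)"
        using assms by (intro summable_mult summable_geometric) auto
    qed
  qed (auto intro!: continuous_intros compact_Times)
  hence ul: "uniform_limit ?K (\<lambda>n p. qpoch (fst p) (snd p) n) (\<lambda>p. lim (\<lambda>n. qpoch (fst p) (snd p) n)) sequentially"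
    unfolding uniformly_convergent_uniform_limit_iff qpoch_def .
  show ?thesis
  proof (rule uniform_limit_cong'[THEN iffD1, OF _ _ ul])
    fix p assume "p \<in> ?K"
    hence "norm (snd p) < 1" using assms by (auto simp: mem_Times_iff)
    thus "lim (\<lambda>n. qpoch (fst p) (snd p) n) = qinf (fst p) (snd p)"
      by (intro limI qpoch_tendsto)
  qed auto
qed

text \<open>Locally uniform convergence of the finite products yields joint continuity as well as
  holomorphy in each variable separately; \<open>osgood\<close> combines the two.\<close>

lemma qinf_hd2:
  assumes "norm (snd p) < 1"
  shows "hd2 (\<lambda>p. qinf (fst p) (snd p)) p"
proof -
  let ?U = "UNIV \<times> ball (0::complex) 1 :: (complex \<times> complex) set"
  have nbhd: "\<exists>R \<rho>. \<rho> < 1 \<and> norm a < R \<and> norm q < \<rho>" if "norm q < 1" for a q :: complex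
    using dense[OF that] less_add_one[of "norm a"] by blast
  have "holomorphic2_on (\<lambda>p. qinf (fst p) (snd p)) ?U"
  proof (rule osgood)
    show "open ?U" by (intro open_Times) auto
    show "continuous_on ?U (\<lambda>p. qinf (fst p) (snd p))"
    proof (rule continuous_at_imp_continuous_on, rule ballI)
      fix p :: "complex \<times> complex" assume "p \<in> ?U"
      then obtain R \<rho> where R: "\<rho> < 1" "norm (fst p) < R" "norm (snd p) < \<rho>"
        using nbhd[of "snd p" "fst p"] by (auto simp: mem_Times_iff)
      have R0: "0 \<le> \<rho>" using R(3) norm_ge_zero[of "snd p"] by linarith
      have "continuous_on (cball 0 R \<times> cball 0 \<rho>) (\<lambda>p. qinf (fst p) (snd p))"
        by (rule uniform_limit_theorem[OF _ qinf_uniform_limit[OF R0 R(1)]])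
           (auto simp: qpoch_def intro!: continuous_intros always_eventually)
      hence "continuous_on (ball 0 R \<times> ball 0 \<rho>) (\<lambda>p. qinf (fst p) (snd p))"
        by (rule continuous_on_subset) auto
      moreover have "open (ball (0::complex) R \<times> ball (0::complex) \<rho>)" by (intro open_Times) auto
      moreover have "p \<in> ball 0 R \<times> ball 0 \<rho>" using R by (auto simp: mem_Times_iff)
      ultimately show "isCont (\<lambda>p. qinf (fst p) (snd p)) p"
        using continuous_on_eq_continuous_at by blast
    qed
  next
    fix a q :: complex assume "(a, q) \<in> ?U"
    hence q: "norm q < 1" by simp
    have "(\<lambda>a. qinf a q) holomorphic_on UNIV"
    proof (rule holomorphic_uniform_sequence)
      show "(\<lambda>a. qpoch a q n) holomorphic_on UNIV" for n
        unfolding qpoch_def by (intro holomorphic_intros)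
      fix a :: complex
      obtain R \<rho> where R: "\<rho> < 1" "norm a + 1 < R" "norm q < \<rho>"
        using dense[OF q] by (metis less_add_one)
      have R0: "0 \<le> \<rho>" using R(3) norm_ge_zero[of q] by linarith
      have "uniform_limit (cball a 1) (\<lambda>n a. qpoch a q n) (\<lambda>a. qinf a q) sequentially"
      proof -
        have "norm b \<le> R" if "dist a b \<le> 1" for b
          using norm_triangle_sub[of b a] that R(2) by (simp add: dist_norm norm_minus_commute)
        hence sub: "(\<lambda>b. (b, q)) ` cball a 1 \<subseteq> cball 0 R \<times> cball 0 \<rho>" using R(3) by auto
        show ?thesis
          using uniform_limit_compose'[OF qinf_uniform_limit[OF R0 R(1), of R], of "\<lambda>b. (b, q)" "cball a 1"] sub
          by (auto simp: image_subset_iff_funcset)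
      qed
      thus "\<exists>d>0. cball a d \<subseteq> UNIV \<and> uniform_limit (cball a d) (\<lambda>n a. qpoch a q n) (\<lambda>a. qinf a q) sequentially"
        by (intro exI[of _ 1]) auto
    qed auto
    thus "(\<lambda>x. qinf (fst (x, q)) (snd (x, q))) field_differentiable at a"
      by (simp add: holomorphic_on_open field_differentiable_def)
    have "(\<lambda>q. qinf a q) holomorphic_on ball 0 1"
    proof (rule holomorphic_uniform_sequence)
      show "(\<lambda>q. qpoch a q n) holomorphic_on ball 0 1" for n
        unfolding qpoch_def by (intro holomorphic_intros)
      fix q :: complex assume q: "q \<in> ball 0 1"
      then obtain \<rho> where R: "norm q < \<rho>" "\<rho> < 1"
        using dense[of "norm q" 1] by auto
      have R0: "0 \<le> \<rho>" using R(1) norm_ge_zero[of q] by linarith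
      define d where "d = \<rho> - norm q"
      have sub: "cball q d \<subseteq> cball 0 \<rho>"
      proof
        fix b assume "b \<in> cball q d"
        hence "norm (b - q) \<le> d" by (simp add: dist_norm norm_minus_commute)
        thus "b \<in> cball 0 \<rho>" using norm_triangle_sub[of b q] by (simp add: d_def)
      qed
      hence sub': "(\<lambda>b. (a, b)) ` cball q d \<subseteq> cball 0 (norm a) \<times> cball 0 \<rho>" by auto
      have "uniform_limit (cball q d) (\<lambda>n q. qpoch a q n) (\<lambda>q. qinf a q) sequentially"
        using uniform_limit_compose'[OF qinf_uniform_limit[OF R0 R(2), of "norm a"], of "\<lambda>b. (a, b)" "cball q d"] sub'
        by (auto simp: image_subset_iff_funcset)
      moreover have "cball q d \<subseteq> ball 0 1" using sub R by force
      ultimately show "\<exists>d>0. cball q d \<subseteq> ball 0 1 \<and> uniform_limit (cball q d) (\<lambda>n q. qpoch a q n) (\<lambda>q. qinf a q) sequentially"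
        using R by (intro exI[of _ d]) (auto simp: d_def)
    qed auto
    thus "(\<lambda>y. qinf (fst (a, y)) (snd (a, y))) field_differentiable at q"
      using q by (simp add: holomorphic_on_open field_differentiable_def)
  qed
  moreover have "p \<in> ?U" using assms by (auto simp: mem_Times_iff)
  ultimately show ?thesis unfolding holomorphic2_on_iff by blast
qed

lemma qinf_comp_hd2:
  assumes "hd2 f p" "hd2 g p" "norm (g p) < 1"
  shows "hd2 (\<lambda>x. qinf (f x) (g x)) p"
  using hd2_comp2[of "\<lambda>p. qinf (fst p) (snd p)", OF qinf_hd2 assms(1,2)] assms(3) by simp

section \<open>Holomorphy of eta and theta\<close>

lemma e2pi_field_differentiable: "e2pi field_differentiable at z"
  unfolding e2pi_def[abs_def] by (intro holomorphic_on_imp_differentiable_at[of _ UNIV] holomorphic_intros) auto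

lemma hd2_e2pi: "hd2 f p \<Longrightarrow> hd2 (\<lambda>x. e2pi (f x)) p"
  by (rule hd2_comp1[OF e2pi_field_differentiable])

lemma open_upper: "open {p :: complex \<times> complex. Im (snd p) > 0}"
  by (intro open_Collect_less continuous_intros)

lemma eta_hd2:
  assumes "hd2 f p" "Im (f p) > 0"
  shows "hd2 (\<lambda>x. eta (f x)) p"
proof -
  have "hd2 (\<lambda>x. e2pi (f x * (1 / 24)) * qinf (e2pi (f x)) (e2pi (f x))) p"
    by (intro hd2_mult hd2_e2pi hd2_const qinf_comp_hd2 assms norm_e2pi_less_1)
  thus ?thesis by (simp add: eta_product)
qed

text \<open>Holomorphy is read off the product, so the bilateral series never has to be
  differentiated.\<close>

lemma theta_hd2_0:
  assumes "Im (snd p) > 0"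
  shows "hd2 (\<lambda>p. theta (fst p) (snd p)) p"
proof (rule hd2_transform[OF _ open_upper])
  show "hd2 (\<lambda>p. e2pi (snd p * (1 / 8)) * e2pi (fst p * (1 / 2)) * (qinf (e2pi (snd p)) (e2pi (snd p)) *
     qinf (e2pi (fst p) * e2pi (snd p)) (e2pi (snd p)) * qinf (e2pi (-1 * fst p)) (e2pi (snd p)))) p"
    by (intro hd2_mult hd2_e2pi hd2_const hd2_fst hd2_snd qinf_comp_hd2 norm_e2pi_less_1 assms)
qed (use assms in \<open>auto simp: theta_product e2pi_minus\<close>)

lemma theta_hd2:
  assumes "hd2 f p" "hd2 g p" "Im (g p) > 0"
  shows "hd2 (\<lambda>x. theta (f x) (g x)) p"
  using hd2_comp2[of "\<lambda>p. theta (fst p) (snd p)", OF theta_hd2_0 assms(1,2)] assms(3) by simp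

lemma hd2_imp_field_differentiable:
  assumes "hd2 F (x, y)"
  shows "(\<lambda>x. F (x, y)) field_differentiable at x" "(\<lambda>y. F (x, y)) field_differentiable at y"
  using hd2_comp_curve[of F "\<lambda>x. x" x "\<lambda>_. y"] hd2_comp_curve[of F "\<lambda>_. x" y "\<lambda>y. y"] assms
  by auto

lemma theta_holomorphic:
  assumes "Im \<tau> > 0"
  shows "(\<lambda>z. theta z \<tau>) holomorphic_on S"
proof (rule holomorphic_onI)
  fix z
  have "(\<lambda>z. theta (fst (z, \<tau>)) (snd (z, \<tau>))) field_differentiable at z"
    by (rule hd2_imp_field_differentiable(1)[OF theta_hd2_0]) (use assms in simp)
  thus "(\<lambda>z. theta z \<tau>) field_differentiable at z within S"
    by (simp add: field_differentiable_at_within)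
qed

lemma eta_holomorphic: "eta holomorphic_on {\<tau>. Im \<tau> > 0}"
proof (rule holomorphic_onI)
  fix \<tau> :: complex assume \<tau>: "\<tau> \<in> {\<tau>. Im \<tau> > 0}"
  have "(\<lambda>\<tau>. eta (snd (0, \<tau>))) field_differentiable at \<tau>"
    using hd2_imp_field_differentiable(2)[of "\<lambda>p. eta (snd p)" 0 \<tau>] eta_hd2[OF hd2_snd, of "(0, \<tau>)"] \<tau>
    by simp
  thus "eta field_differentiable at \<tau> within {\<tau>. Im \<tau> > 0}"
    by (simp add: field_differentiable_at_within)
qed

subsection \<open>Inversion of theta and eta\<close>

lemma eventually_nonzero_deriv:
  fixes g :: "complex \<Rightarrow> complex"
  assumes "(g has_field_derivative d) (at z)" "g z = 0" "d \<noteq> 0"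
  shows "eventually (\<lambda>w. g w \<noteq> 0) (at z)"
proof -
  have "((\<lambda>w. (g w - g z) / (w - z)) \<longlongrightarrow> d) (at z)"
    using assms(1) by (rule has_field_derivativeD)
  hence "eventually (\<lambda>w. (g w - g z) / (w - z) \<noteq> 0) (at z)"
    using assms(3) by (rule tendsto_imp_eventually_ne)
  thus ?thesis by eventually_elim (use assms(2) in auto)
qed

text \<open>The zeros of g are simple, so l'Hopital's rule makes f / g continuous there with value
  f' / g'. Continuity at an isolated point and holomorphy around it give holomorphy.\<close>

lemma entire_quotient:
  fixes f g :: "complex \<Rightarrow> complex"
  assumes "f holomorphic_on UNIV" "g holomorphic_on UNIV"
    "\<And>z. g z = 0 \<Longrightarrow> f z = 0" "\<And>z. g z = 0 \<Longrightarrow> deriv g z \<noteq> 0"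
  obtains h where "h holomorphic_on UNIV" "\<And>z. f z = h z * g z"
proof
  define h where "h = (\<lambda>z. if g z = 0 then deriv f z / deriv g z else f z / g z)"
  show "f z = h z * g z" for z using assms(3)[of z] by (simp add: h_def)
  have df: "(f has_field_derivative deriv f z) (at z)" "(g has_field_derivative deriv g z) (at z)" for z
    using assms(1,2) by (auto intro!: holomorphic_derivI[of _ UNIV])
  have *: "h field_differentiable at z" if "g z \<noteq> 0" for z
  proof -
    have "open {z. g z \<noteq> 0}"
      using assms(2) by (intro open_Collect_neq continuous_intros holomorphic_on_imp_continuous_on)
    moreover have "h holomorphic_on {z. g z \<noteq> 0}"
      by (rule holomorphic_transform[of "\<lambda>z. f z / g z"])
         (auto simp: h_def intro!: holomorphic_intros holomorphic_on_subset[OF assms(1)] holomorphic_on_subset[OF assms(2)])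
    ultimately show ?thesis using that by (auto intro: holomorphic_on_imp_differentiable_at)
  qed
  have "h field_differentiable at z" if "g z = 0" for z
  proof -
    have "eventually (\<lambda>w. g w \<noteq> 0) (at z)"
      by (rule eventually_nonzero_deriv[OF df(2)]) (use that assms(4) in auto)
    then obtain S where S: "open S" "z \<in> S" "\<And>w. w \<in> S \<Longrightarrow> w \<noteq> z \<Longrightarrow> g w \<noteq> 0"
      unfolding eventually_at_topological by blast
    have "((\<lambda>w. f w / g w) \<longlongrightarrow> h z) (at z)"
      by (rule lhopital_complex_simple[OF df]) (use that assms in \<open>auto simp: h_def\<close>)
    moreover have "eventually (\<lambda>w. f w / g w = h w) (at z)"
      unfolding eventually_at_topological using S by (intro exI[of _ S]) (auto simp: h_def)
    ultimately have "isCont h z" unfolding isCont_def by (rule Lim_transform_eventually)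
    moreover have "isCont h w" if "w \<in> S" "w \<noteq> z" for w
      using S(3)[OF that] * by (intro field_differentiable_imp_continuous_at) auto
    ultimately have "continuous_on S h" by (metis continuous_at_imp_continuous_on)
    moreover have "h holomorphic_on S - {z}"
      unfolding holomorphic_on_def using S(3) * by (simp add: field_differentiable_at_within)
    ultimately have "h holomorphic_on S" by (rule no_isolated_singularity) (use S in auto)
    thus ?thesis using S by (auto intro: holomorphic_on_imp_differentiable_at)
  qed
  with * have "\<And>z. h field_differentiable at z" by blast
  thus "h holomorphic_on UNIV" by (simp add: holomorphic_on_def field_differentiable_at_within)
qed

text \<open>Fractional parts bring every argument into the compact period parallelogram, so h is
  bounded and Liouville's theorem applies.\<close>

lemma doubly_periodic_constant:
  fixes h :: "complex \<Rightarrow> complex"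
  assumes "h holomorphic_on UNIV" "Im \<tau> > 0" "\<And>z. h (z + 1) = h z" "\<And>z. h (z + \<tau>) = h z"
  shows "h z = h 0"
proof -
  have nat: "h (z + of_nat n) = h z" "h (z + of_nat n * \<tau>) = h z" for z n
  proof (induction n)
    case (Suc n)
    have "z + of_nat (Suc n) = (z + of_nat n) + 1" "z + of_nat (Suc n) * \<tau> = (z + of_nat n * \<tau>) + \<tau>"
      by (auto simp: algebra_simps)
    thus "h (z + of_nat (Suc n)) = h z" "h (z + of_nat (Suc n) * \<tau>) = h z"
      unfolding assms(3) assms(4) using Suc assms by metis+
  qed auto
  have int1: "h (z + of_int n) = h z" for z n
  proof (cases n)
    case (neg k)
    have "z = (z + of_int n) + of_nat (Suc k)" using neg by simp
    thus ?thesis using nat(1) by metis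
  qed (use nat in auto)
  have int2: "h (z + of_int n * \<tau>) = h z" for z n
  proof (cases n)
    case (neg k)
    have "of_int n = - (of_nat (Suc k) :: complex)" using neg by simp
    hence "z = (z + of_int n * \<tau>) + of_nat (Suc k) * \<tau>" by (simp del: of_nat_Suc)
    thus ?thesis using nat(2) by metis
  qed (use nat in auto)
  define K where "K = (\<lambda>p. of_real (fst p) + of_real (snd p) * \<tau>) ` ({0..1} \<times> {0..1})"
  have "compact K" unfolding K_def
    by (intro compact_continuous_image compact_Times continuous_intros) auto
  moreover have "continuous_on K h"
    using assms(1) by (intro holomorphic_on_imp_continuous_on) (rule holomorphic_on_subset, auto)
  ultimately have "bounded (h ` K)" by (intro compact_imp_bounded compact_continuous_image)
  moreover have "range h \<subseteq> h ` K"
  proof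
    fix y assume "y \<in> range h"
    then obtain z where z: "y = h z" by blast
    define t where "t = Im z / Im \<tau>"
    define s where "s = Re z - t * Re \<tau>"
    have zst: "z = of_real s + of_real t * \<tau>"
      using assms(2) by (auto simp: complex_eq_iff s_def t_def)
    define w where "w = of_real (frac s) + of_real (frac t) * \<tau>"
    have "z = w + of_int \<lfloor>s\<rfloor> + of_int \<lfloor>t\<rfloor> * \<tau>"
      unfolding w_def zst frac_def by (simp add: algebra_simps)
    hence "h z = h w" using int1 int2 by metis
    moreover have "w \<in> K" unfolding w_def K_def
      by (intro image_eqI[of _ _ "(frac s, frac t)"]) (auto simp: less_imp_le[OF frac_lt_1])
    ultimately show "y \<in> h ` K" using z by blast
  qed
  ultimately have "bounded (range h)" by (rule bounded_subset)
  hence "h constant_on UNIV" by (rule Liouville_theorem[OF assms(1)])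
  thus ?thesis unfolding constant_on_def by (metis UNIV_I)
qed

text \<open>The zero at 0 comes from the single factor 1 - 1 / x of (1 / x; q). The remaining
  product at z = 0 is q^(1/8) (q; q)^3, the cube of eta.\<close>

lemma theta_has_deriv_0:
  assumes "Im \<tau> > 0"
  shows "((\<lambda>z. theta z \<tau>) has_field_derivative (2 * of_real pi * \<i> * eta \<tau> ^ 3)) (at 0)"
proof -
  define q where "q = e2pi \<tau>"
  have q: "norm q < 1" unfolding q_def by (rule norm_e2pi_less_1[OF assms])
  define G where "G = (\<lambda>z. e2pi (\<tau> / 8) * e2pi (z * (1 / 2)) * (qinf q q * qinf (e2pi z * q) q * qinf (e2pi (- 1 * z) * q) q))"
  have th: "theta z \<tau> = (1 - e2pi (- z)) * G z" for z
    unfolding theta_product[OF assms] G_def q_def[symmetric]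
    by (subst qinf_shift[OF q, of "1 / e2pi z"]) (simp add: e2pi_minus)
  have "hd2 (\<lambda>p. e2pi (\<tau> / 8) * e2pi (fst p * (1 / 2)) * (qinf q q * qinf (e2pi (fst p) * q) q * qinf (e2pi (- 1 * fst p) * q) q)) (0, 0)"
    by (intro hd2_mult hd2_e2pi hd2_const hd2_fst hd2_snd qinf_comp_hd2 q)
  from hd2_imp_field_differentiable(1)[OF this] have "G field_differentiable at 0"
    by (simp add: G_def)
  then obtain d where d: "(G has_field_derivative d) (at 0)" by (auto simp: field_differentiable_def)
  have "((\<lambda>z. 1 - e2pi (- z)) has_field_derivative (2 * of_real pi * \<i>)) (at 0)"
    unfolding e2pi_def by (auto intro!: derivative_eq_intros)
  from DERIV_mult[OF this d] have "((\<lambda>z. theta z \<tau>) has_field_derivative (2 * of_real pi * \<i> * G 0)) (at 0)"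
    unfolding th by (simp add: e2pi_def)
  moreover have "G 0 = eta \<tau> ^ 3"
    unfolding G_def eta_product q_def[symmetric] power_mult_distrib e2pi_power
    by (simp add: power3_eq_cube mult.assoc)
  ultimately show ?thesis by simp
qed

text \<open>Quasi-periodicity carries any zero to the one at 0, up to a holomorphic factor without
  zeros.\<close>

lemma theta_deriv_nonzero:
  assumes "Im \<tau> > 0" "theta z \<tau> = 0"
  shows "deriv (\<lambda>z. theta z \<tau>) z \<noteq> 0"
proof -
  obtain m n :: int where z: "z = of_int n * \<tau> + of_int m"
    using theta_eq_0_iff[OF assms(1)] assms(2) by blast
  define c where "c = ((-1) powi (n + m) :: complex)"
  define k where "k = (\<lambda>w. c * e2pi (- (of_int n ^ 2 * \<tau> / 2) - of_int n * (w - z)))"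
  have th: "theta w \<tau> = k w * theta (w - z) \<tau>" for w
    using theta_add_lattice[of "w - z" n \<tau> m] by (simp add: z k_def c_def algebra_simps)
  have "(k has_field_derivative deriv k z) (at z)"
    unfolding k_def e2pi_def by (intro holomorphic_derivI[of _ UNIV] holomorphic_intros) auto
  moreover have "((\<lambda>w. theta (w - z) \<tau>) has_field_derivative (2 * of_real pi * \<i> * eta \<tau> ^ 3)) (at z)"
  proof -
    have "((\<lambda>z. theta z \<tau>) has_field_derivative (2 * of_real pi * \<i> * eta \<tau> ^ 3)) (at (z - z))"
      using theta_has_deriv_0[OF assms(1)] by simp
    moreover have "((\<lambda>w. w - z) has_field_derivative 1) (at z)"
      by (auto intro!: derivative_eq_intros)
    ultimately have "((\<lambda>w. theta (w - z) \<tau>) has_field_derivative (2 * of_real pi * \<i> * eta \<tau> ^ 3) * 1) (at z)"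
      by (rule DERIV_chain2[where f = "\<lambda>z. theta z \<tau>" and g = "\<lambda>w. w - z"])
    thus ?thesis by simp
  qed
  ultimately have "((\<lambda>w. k w * theta (w - z) \<tau>) has_field_derivative
      (deriv k z * theta (z - z) \<tau> + (2 * of_real pi * \<i> * eta \<tau> ^ 3) * k z)) (at z)"
    by (rule DERIV_mult)
  moreover have "theta 0 \<tau> = 0" unfolding theta_eq_0_iff[OF assms(1)]
    by (intro exI[of _ 0]) simp
  ultimately have "deriv (\<lambda>z. theta z \<tau>) z = (2 * of_real pi * \<i> * eta \<tau> ^ 3) * k z"
    unfolding th[symmetric] by (auto dest: DERIV_imp_deriv)
  moreover have "k z \<noteq> 0" unfolding k_def c_def by (auto simp: power_int_0_left)
  ultimately show ?thesis using eta_nonzero[OF assms(1)] by simp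
qed

lemma Im_S:
  assumes "Im \<tau> > 0"
  shows "Im (- 1 / \<tau>) > 0"
proof -
  have "\<tau> \<noteq> 0" using assms by auto
  thus ?thesis using assms by (simp add: Im_divide power2_eq_square[symmetric] sum_power2_gt_zero_iff complex_eq_iff)
qed

text \<open>The Gaussian factor is chosen so that f and g have equal multipliers under z + 1 and z +
  \<tau>. Every zero of g is simple and also a zero of f, so the quotient is entire and doubly
  periodic.\<close>

lemma theta_S_proportional:
  assumes "Im \<tau> > 0"
  obtains C where "\<And>z. theta (z / \<tau>) (- 1 / \<tau>) = C * e2pi (z ^ 2 / (2 * \<tau>)) * theta z \<tau>"
proof -
  have \<tau>: "\<tau> \<noteq> 0" using assms by auto
  define f where "f = (\<lambda>z. theta (z / \<tau>) (- 1 / \<tau>) * e2pi (- (z ^ 2 / (2 * \<tau>))))"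
  define g where "g = (\<lambda>z. theta z \<tau>)"
  have hol: "f holomorphic_on UNIV" "g holomorphic_on UNIV"
  proof -
    have "(\<lambda>z. z / \<tau>) holomorphic_on UNIV"
      by (intro holomorphic_intros) (use \<tau> in auto)
    from holomorphic_on_compose_gen[OF this theta_holomorphic[OF Im_S[OF assms], of UNIV]]
    have "(\<lambda>z. theta (z / \<tau>) (- 1 / \<tau>)) holomorphic_on UNIV"
      by (simp add: o_def)
    thus "f holomorphic_on UNIV" unfolding f_def e2pi_def by (intro holomorphic_intros) (use \<tau> in auto)
    show "g holomorphic_on UNIV" unfolding g_def by (rule theta_holomorphic[OF assms])
  qed
  have zero: "f z = 0" if z0: "g z = 0" for z
  proof -
    obtain m n :: int where z: "z = of_int n * \<tau> + of_int m"
      using z0[unfolded g_def theta_eq_0_iff[OF assms]] by blast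
    have "z / \<tau> = of_int (- m) * (- 1 / \<tau>) + of_int n" using \<tau> by (simp add: z field_simps)
    hence "theta (z / \<tau>) (- 1 / \<tau>) = 0" using theta_eq_0_iff[OF Im_S[OF assms]] by blast
    thus ?thesis by (simp add: f_def)
  qed
  obtain h where h: "h holomorphic_on UNIV" "\<And>z. f z = h z * g z"
    using entire_quotient[OF hol zero] theta_deriv_nonzero[OF assms] unfolding g_def by blast
  have f1: "f (z + 1) = - f z" "g (z + 1) = - g z" for z
  proof -
    have A: "theta ((z + 1) / \<tau>) (- 1 / \<tau>) = - e2pi (1 / (2 * \<tau>) + z / \<tau>) * theta (z / \<tau>) (- 1 / \<tau>)"
      using theta_add_lattice[of "z / \<tau>" "-1" "- 1 / \<tau>" 0]
      by (simp add: add_divide_distrib minus_one_powi mult.commute)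
    have B: "e2pi (- ((z + 1) ^ 2 / (2 * \<tau>))) * e2pi (1 / (2 * \<tau>) + z / \<tau>) = e2pi (- (z ^ 2 / (2 * \<tau>)))"
      unfolding e2pi_add[symmetric] using \<tau>
      by (intro arg_cong[where f = e2pi]) (simp add: field_simps power2_eq_square)
    show "f (z + 1) = - f z" unfolding f_def A B[symmetric] by (simp add: mult_ac)
    show "g (z + 1) = - g z" 
      using theta_add_lattice[of z 0 \<tau> 1] by (simp add: g_def minus_one_powi)
  qed
  have f2: "f (z + \<tau>) = - e2pi (- (\<tau> / 2) - z) * f z" "g (z + \<tau>) = - e2pi (- (\<tau> / 2) - z) * g z" for z
  proof -
    have "theta ((z + \<tau>) / \<tau>) (- 1 / \<tau>) = - theta (z / \<tau>) (- 1 / \<tau>)"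
      using theta_add_lattice[of "z / \<tau>" 0 "- 1 / \<tau>" 1] \<tau> by (simp add: add_divide_distrib minus_one_powi)
    moreover have "e2pi (- ((z + \<tau>) ^ 2 / (2 * \<tau>))) = e2pi (- (\<tau> / 2) - z) * e2pi (- (z ^ 2 / (2 * \<tau>)))"
      unfolding e2pi_add[symmetric] using \<tau>
      by (intro arg_cong[where f = e2pi]) (simp add: field_simps power2_eq_square)
    ultimately show "f (z + \<tau>) = - e2pi (- (\<tau> / 2) - z) * f z" unfolding f_def by (simp add: mult_ac)
    show "g (z + \<tau>) = - e2pi (- (\<tau> / 2) - z) * g z"
      using theta_add_lattice[of z 1 \<tau> 0] by (simp add: g_def minus_one_powi)
  qed
  \<comment> \<open>A continuous function that vanishes off the isolated zeros of g vanishes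
    everywhere; this transfers the periodicity of h g to h.\<close>
  have cancel: "k z = 0" if k: "continuous_on UNIV k" "\<And>z. k z * g z = 0" for k z
  proof (cases "g z = 0")
    case True
    have "eventually (\<lambda>w. g w \<noteq> 0) (at z)"
    proof (rule eventually_nonzero_deriv)
      show "(g has_field_derivative deriv g z) (at z)"
        using hol(2) by (auto intro!: holomorphic_derivI[of _ UNIV])
      show "deriv g z \<noteq> 0" using theta_deriv_nonzero[OF assms] True unfolding g_def by blast
    qed (use True in auto)
    hence "eventually (\<lambda>w. k w = 0) (at z)" by eventually_elim (use k(2) in auto)
    hence "(k \<longlongrightarrow> 0) (at z)" by (rule tendsto_eventually)
    moreover have "(k \<longlongrightarrow> k z) (at z)" using k(1) by (simp add: continuous_on_def)
    ultimately show ?thesis using LIM_unique by blast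
  qed (use k(2)[of z] in auto)
  have hc: "continuous_on UNIV h" using h(1) by (rule holomorphic_on_imp_continuous_on)
  have "h (z + 1) - h z = 0" for z
  proof (rule cancel[of "\<lambda>z. h (z + 1) - h z"])
    show "continuous_on UNIV (\<lambda>z. h (z + 1) - h z)"
      by (intro continuous_intros continuous_on_compose2[OF hc]) auto
    show "(h (z + 1) - h z) * g z = 0" for z
      using h(2)[of "z + 1"] h(2)[of z] unfolding f1 by (auto simp: algebra_simps)
  qed
  moreover have "h (z + \<tau>) - h z = 0" for z
  proof (rule cancel[of "\<lambda>z. h (z + \<tau>) - h z"])
    show "continuous_on UNIV (\<lambda>z. h (z + \<tau>) - h z)"
      by (intro continuous_intros continuous_on_compose2[OF hc]) auto
    show "(h (z + \<tau>) - h z) * g z = 0" for z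
    proof -
      have "e2pi (- (\<tau> / 2) - z) * (h z * g z) = e2pi (- (\<tau> / 2) - z) * (h (z + \<tau>) * g z)"
        using h(2)[of "z + \<tau>"] h(2)[of z] unfolding f2 by simp
      thus ?thesis by (auto simp: algebra_simps)
    qed
  qed
  ultimately have "h z = h 0" for z
    using doubly_periodic_constant[OF h(1) assms, of z] by simp
  hence "f z = h 0 * g z" for z using h(2)[of z] by simp
  hence "theta (z / \<tau>) (- 1 / \<tau>) = h 0 * e2pi (z ^ 2 / (2 * \<tau>)) * theta z \<tau>" for z
    unfolding f_def g_def by (simp add: e2pi_minus field_simps)
  thus thesis by (rule that)
qed

section \<open>Values of theta at the half periods and the inversion constants\<close>

lemma qinf_even_odd:
  assumes "norm q < 1"
  shows "qinf q q = qinf q (q ^ 2) * qinf (q ^ 2) (q ^ 2)"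
proof -
  have q2: "norm (q ^ 2) < 1" using assms by (auto simp: norm_power power_less_one_iff)
  have e: "qpoch q q (2 * n) = qpoch q (q ^ 2) n * qpoch (q ^ 2) (q ^ 2) n" for n
  proof (induction n)
    case (Suc n)
    have "qpoch q q (2 * Suc n) = qpoch q q (2 * n) * ((1 - q * q ^ (2 * n)) * (1 - q * q ^ Suc (2 * n)))"
      by (simp add: qpoch_Suc)
    also have "q * q ^ (2 * n) = q * (q ^ 2) ^ n" by (simp add: power_mult)
    also have "q * q ^ Suc (2 * n) = q ^ 2 * (q ^ 2) ^ n" by (simp add: power_mult power2_eq_square)
    finally show ?case using Suc by (simp add: qpoch_Suc mult_ac)
  qed auto
  have "strict_mono (\<lambda>k::nat. 2 * k)" by (auto simp: strict_mono_def)
  from LIMSEQ_subseq_LIMSEQ[OF qpoch_tendsto[OF assms(1), of q] this]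
  have "(\<lambda>n. qpoch q (q ^ 2) n * qpoch (q ^ 2) (q ^ 2) n) \<longlonglongrightarrow> qinf q q" by (simp add: o_def e)
  moreover have "(\<lambda>n. qpoch q (q ^ 2) n * qpoch (q ^ 2) (q ^ 2) n) \<longlonglongrightarrow> qinf q (q ^ 2) * qinf (q ^ 2) (q ^ 2)"
    by (intro tendsto_intros qpoch_tendsto q2)
  ultimately show ?thesis by (rule LIMSEQ_unique)
qed

text \<open>Euler's identity behind partitions into distinct and into odd parts.\<close>

lemma qinf_neg_mult_odd:
  assumes "norm q < 1"
  shows "qinf (- q) q * qinf q (q ^ 2) = 1"
proof -
  have "norm (q ^ 2) < 1" using assms by (auto simp: norm_power power_less_one_iff)
  hence "qinf (q ^ 2) (q ^ 2) \<noteq> 0" by (rule qinf_self_nonzero)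
  moreover have "qinf (q ^ 2) (q ^ 2) * (qinf (- q) q * qinf q (q ^ 2)) = qinf (q ^ 2) (q ^ 2)"
    using qinf_mult_neg[OF assms, of q] qinf_even_odd[OF assms] by (simp add: mult_ac)
  ultimately show ?thesis by simp
qed

lemma e2pi_half [simp]: "e2pi (1 / 2) = - 1"
  by (simp add: e2pi_def)

lemma e2pi_quarter [simp]: "e2pi (1 / 4) = \<i>"
proof -
  have "e2pi (1 / 4) = cis (pi / 2)" by (simp add: e2pi_def cis_conv_exp mult_ac)
  thus ?thesis by simp
qed

text \<open>At a half period the two factors of theta that contain x collapse into a square. With
  s^2 = q the three squared products are those of (- q; q), (s; q) and (- s; q), and their product
  is (- q; q) (q; q^2) = 1, so only eta^3 and elementary factors are left.\<close>

lemma theta_half_periods: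
  assumes "Im \<tau> > 0"
  shows "theta (1 / 2) \<tau> * theta (\<tau> / 2) \<tau> * theta ((\<tau> + 1) / 2) \<tau> = 2 * e2pi (- (\<tau> / 4)) * eta \<tau> ^ 3"
proof -
  define q s where "q = e2pi \<tau>" and "s = e2pi (\<tau> / 2)"
  have q: "norm q < 1" unfolding q_def by (rule norm_e2pi_less_1[OF assms])
  have s: "norm s < 1" "s \<noteq> 0" unfolding s_def using assms norm_e2pi_less_1[of "\<tau> / 2"] by auto
  have sq: "s * s = q" unfolding s_def q_def by (simp flip: e2pi_add)
  define E where "E = qinf q q"
  define N where "N = qinf (- q) q"
  \<comment> \<open>If a^2 = q then q / a = a, so (1 / a; q) = (1 - 1 / a) (a; q), and 1 - 1 / a = -
    (1 / a) (1 - a) supplies the factor that (a q; q) lacks.\<close>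
  have half: "qinf (a * q) q * qinf (1 / a) q = - (1 / a) * qinf a q ^ 2" if "q = a * a" "a \<noteq> 0" for a
  proof -
    have "(1 / a) * q = a" using that by simp
    hence "qinf (1 / a) q = (1 - 1 / a) * qinf a q" using qinf_shift[OF q, of "1 / a"] by metis
    moreover have "1 - 1 / a = - (1 / a) * (1 - a)" using that(2) by (simp add: field_simps)
    ultimately have "qinf (a * q) q * qinf (1 / a) q = - (1 / a) * ((1 - a) * qinf (a * q) q) * qinf a q"
      by (simp add: mult_ac)
    thus ?thesis unfolding qinf_shift[OF q, of a, symmetric] by (simp add: power2_eq_square)
  qed
  have t1: "theta (1 / 2) \<tau> = e2pi (\<tau> / 8) * \<i> * (E * (2 * N ^ 2))"
  proof -
    have "qinf (- 1) q = 2 * N" using qinf_shift[OF q, of "- 1"] by (simp add: N_def)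
    thus ?thesis unfolding theta_product[OF assms] q_def[symmetric] E_def N_def
      by (simp add: power2_eq_square)
  qed
  have t2: "theta (\<tau> / 2) \<tau> = e2pi (\<tau> / 8) * e2pi (\<tau> / 4) * (E * (- (1 / s) * qinf s q ^ 2))"
    unfolding half[OF sq[symmetric] s(2), symmetric]
    unfolding theta_product[OF assms] q_def[symmetric] E_def s_def[symmetric] by simp
  have t3: "theta ((\<tau> + 1) / 2) \<tau> = e2pi (\<tau> / 8) * (e2pi (\<tau> / 4) * \<i>) * (E * ((1 / s) * qinf (- s) q ^ 2))"
  proof -
    have 1: "e2pi ((\<tau> + 1) / 2) = - s" unfolding s_def add_divide_distrib e2pi_add by simp
    have 2: "e2pi ((\<tau> + 1) / 2 / 2) = e2pi (\<tau> / 4) * \<i>"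
      using e2pi_add[of "\<tau> / 4" "1 / 4"] by (simp add: add_divide_distrib)
    have 3: "qinf (- s * q) q * qinf (1 / - s) q = (1 / s) * qinf (- s) q ^ 2"
      using half[of "- s"] sq s(2) by simp
    show ?thesis unfolding theta_product[OF assms] q_def[symmetric] E_def 1 2 3[symmetric]
      by (simp add: mult_ac)
  qed
  have "qinf s q * qinf (- s) q * N = 1"
    using qinf_mult_neg[OF q, of s] qinf_neg_mult_odd[OF q] sq unfolding N_def by (simp add: power2_eq_square mult_ac)
  hence "(qinf s q * qinf (- s) q * N) ^ 2 = 1" by simp
  hence A: "qinf s q ^ 2 * (qinf (- s) q ^ 2 * N ^ 2) = 1" by (simp add: power_mult_distrib mult_ac)
  have e3: "eta \<tau> ^ 3 = e2pi (\<tau> / 8) * E ^ 3"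
    unfolding eta_product q_def[symmetric] E_def power_mult_distrib e2pi_power by simp
  have ee: "e2pi (\<tau> / 4) * e2pi (\<tau> / 4) = s" "e2pi (\<tau> / 8) * e2pi (\<tau> / 8) = e2pi (\<tau> / 4)"
    unfolding s_def by (simp_all flip: e2pi_add)
  have "theta (1 / 2) \<tau> * theta (\<tau> / 2) \<tau> * theta ((\<tau> + 1) / 2) \<tau> =
    2 * (e2pi (\<tau> / 8) * e2pi (\<tau> / 8)) * e2pi (\<tau> / 8) * (e2pi (\<tau> / 4) * e2pi (\<tau> / 4)) / (s * s) * E ^ 3 * (qinf s q ^ 2 * (qinf (- s) q ^ 2 * N ^ 2))"
    unfolding t1 t2 t3 by (simp add: power3_eq_cube field_simps)
  also have "\<dots> = 2 * (e2pi (\<tau> / 4) / s) * eta \<tau> ^ 3"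
    unfolding A ee e3 using s(2) by (simp add: field_simps)
  also have "e2pi (\<tau> / 4) / s = e2pi (- (\<tau> / 4))"
    unfolding s_def by (simp flip: e2pi_diff)
  finally show ?thesis .
qed

theorem eta_theta_inversion:
  assumes "Im \<tau> > 0"
  shows "eta (- 1 / \<tau>) ^ 24 = \<tau> ^ 12 * eta \<tau> ^ 24"
    "theta (z / \<tau>) (- 1 / \<tau>) = eta (- 1 / \<tau>) ^ 3 / (\<tau> * eta \<tau> ^ 3) * e2pi (z ^ 2 / (2 * \<tau>)) * theta z \<tau>"
proof -
  have \<tau>: "\<tau> \<noteq> 0" using assms by auto
  define \<sigma> where "\<sigma> = - 1 / \<tau>"
  have \<sigma>: "Im \<sigma> > 0" unfolding \<sigma>_def by (rule Im_S[OF assms])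
  define x y where "x = eta \<tau> ^ 3" and "y = eta \<sigma> ^ 3"
  have xy: "x \<noteq> 0" "y \<noteq> 0" using eta_nonzero[OF assms] eta_nonzero[OF \<sigma>] by (auto simp: x_def y_def)
  obtain C where C: "\<And>z. theta (z / \<tau>) \<sigma> = C * e2pi (z ^ 2 / (2 * \<tau>)) * theta z \<tau>"
    using theta_S_proportional[OF assms] unfolding \<sigma>_def by blast
  have yC: "y = \<tau> * C * x"
  proof -
    have "((\<lambda>z. theta z \<sigma>) has_field_derivative (2 * of_real pi * \<i> * y)) (at (0 / \<tau>))"
      using theta_has_deriv_0[OF \<sigma>] by (simp add: y_def)
    moreover have "((\<lambda>z. z / \<tau>) has_field_derivative (1 / \<tau>)) (at 0)"
      using \<tau> by (auto intro!: derivative_eq_intros)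
    ultimately have 1: "((\<lambda>z. theta (z / \<tau>) \<sigma>) has_field_derivative ((2 * of_real pi * \<i> * y) * (1 / \<tau>))) (at 0)"
      by (rule DERIV_chain2[where f = "\<lambda>z. theta z \<sigma>" and g = "\<lambda>z. z / \<tau>"])
    have 2: "((\<lambda>z. C * e2pi (z ^ 2 / (2 * \<tau>))) has_field_derivative 0) (at 0)"
      unfolding e2pi_def using \<tau> by (auto intro!: derivative_eq_intros)
    have "theta 0 \<tau> = 0" unfolding theta_eq_0_iff[OF assms] by (intro exI[of _ 0]) simp
    hence "((\<lambda>z. theta (z / \<tau>) \<sigma>) has_field_derivative ((2 * of_real pi * \<i> * x) * C)) (at 0)"
      unfolding C using DERIV_mult[OF 2 theta_has_deriv_0[OF assms]] by (simp add: x_def)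
    from DERIV_unique[OF 1 this] show ?thesis using \<tau> by (simp add: field_simps)
  qed
  \<comment> \<open>Inversion permutes the half periods: 1/2 goes to - \<sigma>/2, \<tau>/2 to 1/2
    and (\<tau> + 1)/2 to 1 - (\<sigma> + 1)/2. Only the first one changes the sign of
    theta.\<close>
  have neg: "- y = \<i> * C ^ 3 * x"
  proof -
    have a: "theta (1 / 2 / \<tau>) \<sigma> = - theta (\<sigma> / 2) \<sigma>"
    proof -
      have "1 / 2 / \<tau> = - (\<sigma> / 2)" by (simp add: \<sigma>_def)
      thus ?thesis by (simp only: theta_minus)
    qed
    have b: "theta (\<tau> / 2 / \<tau>) \<sigma> = theta (1 / 2) \<sigma>" using \<tau> by simp
    have c: "theta ((\<tau> + 1) / 2 / \<tau>) \<sigma> = theta ((\<sigma> + 1) / 2) \<sigma>"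
    proof -
      have "(\<tau> + 1) / 2 / \<tau> = - ((\<sigma> + 1) / 2) + of_int 0 * \<sigma> + of_int 1"
        using \<tau> by (simp add: \<sigma>_def field_simps)
      thus ?thesis by (simp only: theta_add_lattice theta_minus) (simp add: minus_one_powi)
    qed
    have "- (2 * e2pi (- (\<sigma> / 4)) * y) =
      theta (1 / 2 / \<tau>) \<sigma> * theta (\<tau> / 2 / \<tau>) \<sigma> * theta ((\<tau> + 1) / 2 / \<tau>) \<sigma>"
      unfolding a b c y_def using theta_half_periods[OF \<sigma>] by (simp add: mult_ac)
    also have "\<dots> = C ^ 3 * (e2pi ((1 / 2) ^ 2 / (2 * \<tau>)) * e2pi ((\<tau> / 2) ^ 2 / (2 * \<tau>)) * e2pi (((\<tau> + 1) / 2) ^ 2 / (2 * \<tau>))) *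
       (theta (1 / 2) \<tau> * theta (\<tau> / 2) \<tau> * theta ((\<tau> + 1) / 2) \<tau>)"
      unfolding C by (simp add: power3_eq_cube mult_ac)
    also have "e2pi ((1 / 2) ^ 2 / (2 * \<tau>)) * e2pi ((\<tau> / 2) ^ 2 / (2 * \<tau>)) * e2pi (((\<tau> + 1) / 2) ^ 2 / (2 * \<tau>)) =
      e2pi (- (\<sigma> / 4)) * e2pi (\<tau> / 4) * e2pi (1 / 4)"
      unfolding e2pi_add[symmetric] \<sigma>_def using \<tau>
      by (intro arg_cong[where f = e2pi]) (simp add: field_simps power2_eq_square)
    also have "theta (1 / 2) \<tau> * theta (\<tau> / 2) \<tau> * theta ((\<tau> + 1) / 2) \<tau> = 2 * e2pi (- (\<tau> / 4)) * x"
      unfolding x_def by (rule theta_half_periods[OF assms])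
    finally have F: "- (2 * e2pi (- (\<sigma> / 4)) * y) =
      C ^ 3 * (e2pi (- (\<sigma> / 4)) * e2pi (\<tau> / 4) * e2pi (1 / 4)) * (2 * e2pi (- (\<tau> / 4)) * x)" .
    have G: "e2pi (\<tau> / 4) * e2pi (- (\<tau> / 4)) = 1" by (simp flip: e2pi_add)
    have "2 * e2pi (- (\<sigma> / 4)) * (- y) = - (2 * e2pi (- (\<sigma> / 4)) * y)" by (rule mult_minus_right)
    also have "\<dots> = 2 * e2pi (- (\<sigma> / 4)) * (\<i> * C ^ 3 * x * (e2pi (\<tau> / 4) * e2pi (- (\<tau> / 4))))"
      unfolding F e2pi_quarter by (simp only: mult_ac)
    also have "\<dots> = 2 * e2pi (- (\<sigma> / 4)) * (\<i> * C ^ 3 * x)"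
      unfolding G mult_1_right ..
    finally show ?thesis
      by (rule mult_left_cancel[THEN iffD1, rotated]) simp
  qed
  have "C \<noteq> 0" using yC xy by auto
  hence "C * x \<noteq> 0" using xy(1) by simp
  moreover have "(C * x) * (\<i> * C ^ 2) = (C * x) * (- \<tau>)"
    using neg yC by (simp add: power3_eq_cube power2_eq_square mult_ac)
  ultimately have "\<i> * C ^ 2 = - \<tau>" by (rule mult_left_cancel[THEN iffD1])
  hence "\<i> * (\<i> * C ^ 2) = \<i> * (- \<tau>)" by (simp only:)
  hence C2: "C ^ 2 = \<i> * \<tau>" by (simp add: mult.assoc[symmetric])
  \<comment> \<open>The two relations give C^2 = i \<tau>. The eighth power removes both the sign of
    C and the factor i, and y^8 is eta^24, whence the exponent 24.\<close>
  have C8: "C ^ 8 = \<tau> ^ 4"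
  proof -
    have "C ^ 8 = (C ^ 2) ^ 4" by (simp flip: power_mult)
    thus ?thesis unfolding C2 by (simp add: power_mult_distrib)
  qed
  have "y ^ 8 = \<tau> ^ 8 * \<tau> ^ 4 * x ^ 8"
    unfolding yC power_mult_distrib C8 ..
  also have "\<tau> ^ 8 * \<tau> ^ 4 = \<tau> ^ 12" by (simp flip: power_add)
  finally show "eta (- 1 / \<tau>) ^ 24 = \<tau> ^ 12 * eta \<tau> ^ 24"
    unfolding x_def y_def \<sigma>_def power_mult[symmetric] by simp
  have "C = eta (- 1 / \<tau>) ^ 3 / (\<tau> * eta \<tau> ^ 3)"
    using yC xy \<tau> unfolding x_def y_def \<sigma>_def by (simp add: field_simps)
  thus "theta (z / \<tau>) (- 1 / \<tau>) = eta (- 1 / \<tau>) ^ 3 / (\<tau> * eta \<tau> ^ 3) * e2pi (z ^ 2 / (2 * \<tau>)) * theta z \<tau>"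
    using C[of z] unfolding \<sigma>_def by simp
qed

subsection \<open>The action of the modular group\<close>

abbreviation (input) lin :: "int \<Rightarrow> int \<Rightarrow> complex \<Rightarrow> complex" where
  "lin c d \<tau> \<equiv> of_int c * \<tau> + of_int d"

text \<open>The quotient f / g maps a connected set continuously into the finite set of n-th roots
  of unity, so it is constant.\<close>

lemma root_of_unity_multiple:
  fixes f g :: "'a :: topological_space \<Rightarrow> complex"
  assumes "connected S" "continuous_on S f" "continuous_on S g"
    "\<And>z. z \<in> S \<Longrightarrow> g z \<noteq> 0" "\<And>z. z \<in> S \<Longrightarrow> f z ^ n = g z ^ n" "n > 0"
  obtains \<zeta> where "\<zeta> ^ n = 1" "\<And>z. z \<in> S \<Longrightarrow> f z = \<zeta> * g z"
proof (cases "S = {}")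
  case True
  thus thesis using that[of 1] by simp
next
  case False
  define k where "k = (\<lambda>z. f z / g z)"
  have k1: "k z ^ n = 1" if "z \<in> S" for z
    using assms(4,5)[OF that] by (simp add: k_def power_divide)
  have "connected (k ` S)"
    unfolding k_def using assms by (intro connected_continuous_image continuous_intros) auto
  moreover have "finite (k ` S)"
  proof (rule finite_subset)
    show "k ` S \<subseteq> {z. z ^ n = 1}" using k1 by auto
    show "finite {z :: complex. z ^ n = 1}" using finite_roots_unity[of n] assms(6) by simp
  qed
  ultimately obtain \<zeta> where \<zeta>: "k ` S = {\<zeta>}"
    using connected_finite_iff_sing False by blast
  have "\<zeta> ^ n = 1" using k1 \<zeta> by (metis imageE insertI1)
  moreover have "f z = \<zeta> * g z" if "z \<in> S" for z
  proof -
    have "k z = \<zeta>" using \<zeta> that by blast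
    thus ?thesis using assms(4)[OF that] by (auto simp: k_def)
  qed
  ultimately show thesis by (rule that)
qed

lemma SL2_induct [consumes 1, case_names one T S]:
  fixes P :: "int \<Rightarrow> int \<Rightarrow> int \<Rightarrow> int \<Rightarrow> bool"
  assumes "a * d - b * c = 1" "P 1 0 0 1"
    "\<And>a b c d n. a * d - b * c = 1 \<Longrightarrow> P a b c d \<Longrightarrow> P a (b + n * a) c (d + n * c)"
    "\<And>a b c d. a * d - b * c = 1 \<Longrightarrow> P a b c d \<Longrightarrow> P b (- a) d (- c)"
  shows "P a b c d"
  using assms(1)
proof (induction "nat \<bar>c\<bar>" arbitrary: a b c d rule: less_induct)
  case less
  show ?case
  proof (cases "c = 0")
    case True
    hence "a * d = 1" using less.prems by simp
    hence ad: "a = 1 \<and> d = 1 \<or> a = - 1 \<and> d = - 1" by (simp add: zmult_eq_1_iff)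
    have S: "P 0 (- 1) 1 0" using assms(4)[OF _ assms(2)] by simp
    have SS: "P (- 1) 0 0 (- 1)" using assms(4)[OF _ S] by simp
    from ad show ?thesis
    proof
      assume "a = 1 \<and> d = 1"
      thus ?thesis using assms(3)[OF _ assms(2), of b] True by simp
    next
      assume "a = - 1 \<and> d = - 1"
      thus ?thesis using assms(3)[OF _ SS, of "- b"] True by simp
    qed
  next
    case False
    define k r b' where "k = d div c" and "r = d mod c" and "b' = b - k * a"
    have d: "d = r + k * c" unfolding k_def r_def by simp
    have det: "a * r - b' * c = 1" using less.prems unfolding d b'_def by (simp add: algebra_simps)
    have "nat \<bar>r\<bar> < nat \<bar>c\<bar>" using False unfolding r_def by (simp add: abs_mod_less)
    \<comment> \<open>The induction hypothesis applies to the matrix (a, b'; c, r) times S, whose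
      lower left entry r is smaller than c in absolute value. Since S has order four, three further
      applications of S bring the matrix back.\<close>
    hence 0: "P b' (- a) r (- c)" using less.hyps[of r b' "- c" "- a"] det by (simp add: mult_ac)
    have 1: "P (- a) (- b') (- c) (- r)" using assms(4)[OF _ 0] det by (simp add: mult_ac)
    have 2: "P (- b') a (- r) c" using assms(4)[OF _ 1] det by (simp add: mult_ac)
    have 3: "P a b' c r" using assms(4)[OF _ 2] det by (simp add: mult_ac)
    show ?thesis using assms(3)[OF det 3, of k] unfolding b'_def by (simp add: d)
  qed
qed

section \<open>Automorphy factors and their square roots on the half-plane\<close>

lemma connected_upper: "connected upper_half_plane"
proof -
  have "convex upper_half_plane"
    unfolding upper_half_plane_def by (rule convex_halfspace_Im_gt)
  thus ?thesis by (rule convex_connected)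
qed

lemma j_nonzero:
  assumes "Im \<tau> > 0" "c \<noteq> 0 \<or> d \<noteq> 0"
  shows "lin c d \<tau> \<noteq> 0"
proof
  assume 0: "lin c d \<tau> = 0"
  hence "Im (lin c d \<tau>) = 0" by simp
  hence "c = 0" using assms(1) by simp
  thus False using 0 assms(2) by simp
qed

lemma SL2_bottom_row_nonzero: "a * d - b * c = 1 \<Longrightarrow> c \<noteq> 0 \<or> d \<noteq> (0::int)"
  by auto

lemma Im_moebius:
  fixes a b c d :: int
  assumes "Im \<tau> > 0" "a * d - b * c = 1"
  shows "Im ((lin a b \<tau>) / (lin c d \<tau>)) > 0"
proof -
  define j where "j = lin c d \<tau>"
  have j: "j \<noteq> 0" unfolding j_def using j_nonzero[OF assms(1) SL2_bottom_row_nonzero[OF assms(2)]] .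
  have "(of_int a * of_int d - of_int b * of_int c :: real) = 1"
    using assms(2) by (simp flip: of_int_mult of_int_diff)
  hence "Im (lin a b \<tau>) * Re j - Re (lin a b \<tau>) * Im j = Im \<tau>"
    unfolding j_def by (simp add: algebra_simps)
  hence "Im ((lin a b \<tau>) / j) = Im \<tau> / (Re j ^ 2 + Im j ^ 2)"
    by (simp add: Im_divide)
  moreover have "Re j ^ 2 + Im j ^ 2 > 0" using j by (simp add: sum_power2_gt_zero_iff complex_eq_iff)
  ultimately show ?thesis using assms(1) unfolding j_def by simp
qed

lemma powr_half_squared: "(z powr (1 / 2)) ^ 2 = (z :: complex)"
  by (simp flip: csqrt_conv_powr)

text \<open>For c \<noteq> 0 the argument is never real, so it avoids the branch cut; for c = 0 it
  is constant.\<close>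

lemma continuous_on_j_half:
  assumes "c \<noteq> 0 \<or> d \<noteq> 0"
  shows "continuous_on upper_half_plane (\<lambda>\<tau>. (lin c d \<tau>) powr (1 / 2))"
proof (cases "c = 0")
  case False
  show ?thesis
    by (rule continuous_on_powr_complex) (use False in \<open>auto simp: upper_half_plane_def intro!: continuous_intros\<close>)
qed auto

text \<open>The inversion law for the 24th powers leaves a 24th root of unity, and
  \<open>root_of_unity_multiple\<close> makes it independent of \<tau>.\<close>

lemma eta_S:
  obtains \<zeta> where "\<zeta> ^ 24 = 1" "\<And>\<tau>. Im \<tau> > 0 \<Longrightarrow> eta (- 1 / \<tau>) = \<zeta> * \<tau> powr (1 / 2) * eta \<tau>"
proof -
  let ?H = upper_half_plane
  have ce: "continuous_on ?H eta"
    using eta_holomorphic unfolding upper_half_plane_def by (rule holomorphic_on_imp_continuous_on)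
  have 1: "continuous_on ?H (\<lambda>\<tau>. eta (- 1 / \<tau>))"
    by (rule continuous_on_compose2[OF ce])
       (use Im_S in \<open>auto simp: upper_half_plane_def intro!: continuous_intros\<close>)
  have 2: "continuous_on ?H (\<lambda>\<tau>. \<tau> powr (1 / 2) * eta \<tau>)"
    using continuous_on_j_half[of 1 0] by (intro continuous_on_mult ce) simp
  have p: "(\<tau> powr (1 / 2)) ^ 24 = \<tau> ^ 12" for \<tau> :: complex
  proof -
    have "(\<tau> powr (1 / 2)) ^ 24 = ((\<tau> powr (1 / 2)) ^ 2) ^ 12" by (simp only: power_mult[symmetric]) simp
    thus ?thesis by (simp only: powr_half_squared)
  qed
  obtain \<zeta> where "\<zeta> ^ 24 = 1" "\<And>\<tau>. \<tau> \<in> ?H \<Longrightarrow> eta (- 1 / \<tau>) = \<zeta> * (\<tau> powr (1 / 2) * eta \<tau>)"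
  proof (rule root_of_unity_multiple[OF connected_upper 1 2])
    fix \<tau> assume "\<tau> \<in> ?H"
    hence \<tau>: "Im \<tau> > 0" by (simp add: upper_half_plane_def)
    thus "\<tau> powr (1 / 2) * eta \<tau> \<noteq> 0" using eta_nonzero[OF \<tau>] by auto
    show "eta (- 1 / \<tau>) ^ 24 = (\<tau> powr (1 / 2) * eta \<tau>) ^ 24"
      unfolding power_mult_distrib p using eta_theta_inversion(1)[OF \<tau>] .
  qed auto
  thus thesis using that by (simp add: upper_half_plane_def mult.assoc)
qed

text \<open>Principal square roots are multiplicative only up to sign. Both sides are continuous
  with the same square, so the sign is the same on the whole half-plane.\<close>

lemma j_half_cocycle:
  assumes "c \<noteq> 0 \<or> d \<noteq> (0::int)"
  obtains \<epsilon> :: complex where "\<epsilon> ^ 2 = 1" "\<And>\<tau>. Im \<tau> > 0 \<Longrightarrow>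
    (lin c d (- 1 / \<tau>)) powr (1 / 2) * \<tau> powr (1 / 2) =
      \<epsilon> * (lin d (- c) \<tau>) powr (1 / 2)"
proof -
  let ?H = upper_half_plane
  have 1: "continuous_on ?H (\<lambda>\<tau>. (lin c d (- 1 / \<tau>)) powr (1 / 2) * \<tau> powr (1 / 2))"
  proof (rule continuous_on_mult)
    show "continuous_on ?H (\<lambda>\<tau>. (lin c d (- 1 / \<tau>)) powr (1 / 2))"
      by (rule continuous_on_compose2[OF continuous_on_j_half[OF assms]])
         (use Im_S in \<open>auto simp: upper_half_plane_def intro!: continuous_intros\<close>)
    show "continuous_on ?H (\<lambda>\<tau>. \<tau> powr (1 / 2))" using continuous_on_j_half[of 1 0] by simp
  qed
  have 2: "continuous_on ?H (\<lambda>\<tau>. (lin d (- c) \<tau>) powr (1 / 2))"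
    by (rule continuous_on_j_half) (use assms in auto)
  obtain \<epsilon> where "\<epsilon> ^ 2 = 1" "\<And>\<tau>. \<tau> \<in> ?H \<Longrightarrow>
    (lin c d (- 1 / \<tau>)) powr (1 / 2) * \<tau> powr (1 / 2) =
      \<epsilon> * (lin d (- c) \<tau>) powr (1 / 2)"
  proof (rule root_of_unity_multiple[OF connected_upper 1 2])
    fix \<tau> assume "\<tau> \<in> ?H"
    hence \<tau>: "Im \<tau> > 0" "\<tau> \<noteq> 0" by (auto simp: upper_half_plane_def)
    show "(lin d (- c) \<tau>) powr (1 / 2) \<noteq> 0"
      using j_nonzero[OF \<tau>(1), of d "- c"] assms by auto
    show "((lin c d (- 1 / \<tau>)) powr (1 / 2) * \<tau> powr (1 / 2)) ^ 2 =
        ((lin d (- c) \<tau>) powr (1 / 2)) ^ 2"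
      unfolding power_mult_distrib powr_half_squared using \<tau>(2) by (simp add: field_simps)
  qed auto
  thus thesis using that by (simp add: upper_half_plane_def)
qed

text \<open>One induction along words in T and S for both functions: m = 0 is the case of eta, where
  z is a dummy, and m = 1 that of theta. In the S step the automorphy factors match up to the sign
  from \<open>j_half_cocycle\<close>, and the exponents in z add up exactly.\<close>

lemma modular_extension:
  fixes F :: "complex \<Rightarrow> complex \<Rightarrow> complex" and m :: complex
  assumes "a * d - b * c = (1::int)"
    and F_T: "\<And>n. \<exists>\<zeta>. \<zeta> ^ 24 = 1 \<and> (\<forall>z \<tau>. Im \<tau> > 0 \<longrightarrow> F z (\<tau> + of_int n) = \<zeta> * F z \<tau>)"
    and F_S: "\<exists>\<zeta>. \<zeta> ^ 24 = 1 \<and> (\<forall>z \<tau>. Im \<tau> > 0 \<longrightarrow>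
      F (z / \<tau>) (- 1 / \<tau>) = \<zeta> * \<tau> powr (1 / 2) * e2pi (m * z ^ 2 / (2 * \<tau>)) * F z \<tau>)"
  shows "\<exists>\<zeta>. \<zeta> ^ 24 = 1 \<and> (\<forall>z \<tau>. Im \<tau> > 0 \<longrightarrow>
    F (z / (lin c d \<tau>)) ((lin a b \<tau>) / (lin c d \<tau>)) =
      \<zeta> * (lin c d \<tau>) powr (1 / 2) *
        e2pi (m * of_int c * z ^ 2 / (2 * (lin c d \<tau>))) * F z \<tau>)"
  using assms(1)
proof (induction rule: SL2_induct)
  case one
  show ?case by (intro exI[of _ 1]) auto
next
  case (T a b c d n)
  then obtain \<zeta> where \<zeta>: "\<zeta> ^ 24 = 1" "\<And>z \<tau>. Im \<tau> > 0 \<Longrightarrow>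
    F (z / (lin c d \<tau>)) ((lin a b \<tau>) / (lin c d \<tau>)) =
      \<zeta> * (lin c d \<tau>) powr (1 / 2) *
        e2pi (m * of_int c * z ^ 2 / (2 * (lin c d \<tau>))) * F z \<tau>" by blast
  obtain \<xi> where \<xi>: "\<xi> ^ 24 = 1" "\<And>z \<tau>. Im \<tau> > 0 \<Longrightarrow> F z (\<tau> + of_int n) = \<xi> * F z \<tau>"
    using F_T by blast
  show ?case
  proof (intro exI[of _ "\<zeta> * \<xi>"] conjI allI impI)
    show "(\<zeta> * \<xi>) ^ 24 = 1" unfolding power_mult_distrib \<zeta>(1) \<xi>(1) by simp
    fix z \<tau> :: complex assume \<tau>: "Im \<tau> > 0"
    have e: "lin a (b + n * a) \<tau> = of_int a * (\<tau> + of_int n) + of_int b"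
      "lin c (d + n * c) \<tau> = of_int c * (\<tau> + of_int n) + of_int d"
      by (simp_all add: algebra_simps)
    show "F (z / (lin c (d + n * c) \<tau>))
        ((lin a (b + n * a) \<tau>) / (lin c (d + n * c) \<tau>)) =
      \<zeta> * \<xi> * (lin c (d + n * c) \<tau>) powr (1 / 2) *
        e2pi (m * of_int c * z ^ 2 / (2 * (lin c (d + n * c) \<tau>))) * F z \<tau>"
      unfolding e using \<zeta>(2)[of "\<tau> + of_int n" z] \<xi>(2)[OF \<tau>] \<tau> by (simp add: mult_ac)
  qed
next
  case (S a b c d)
  then obtain \<zeta> where \<zeta>: "\<zeta> ^ 24 = 1" "\<And>z \<tau>. Im \<tau> > 0 \<Longrightarrow>
    F (z / (lin c d \<tau>)) ((lin a b \<tau>) / (lin c d \<tau>)) =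
      \<zeta> * (lin c d \<tau>) powr (1 / 2) *
        e2pi (m * of_int c * z ^ 2 / (2 * (lin c d \<tau>))) * F z \<tau>" by blast
  obtain \<xi> where \<xi>: "\<xi> ^ 24 = 1" "\<And>z \<tau>. Im \<tau> > 0 \<Longrightarrow>
      F (z / \<tau>) (- 1 / \<tau>) = \<xi> * \<tau> powr (1 / 2) * e2pi (m * z ^ 2 / (2 * \<tau>)) * F z \<tau>"
    using F_S by blast
  obtain \<epsilon> where \<epsilon>: "\<epsilon> ^ 2 = 1" "\<And>\<tau>. Im \<tau> > 0 \<Longrightarrow>
    (lin c d (- 1 / \<tau>)) powr (1 / 2) * \<tau> powr (1 / 2) =
      \<epsilon> * (lin d (- c) \<tau>) powr (1 / 2)"
    using j_half_cocycle[OF SL2_bottom_row_nonzero[OF S(1)]] by blast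
  show ?case
  proof (intro exI[of _ "\<zeta> * \<xi> * \<epsilon>"] conjI allI impI)
    have "\<epsilon> ^ 24 = (\<epsilon> ^ 2) ^ 12" by (simp flip: power_mult)
    thus "(\<zeta> * \<xi> * \<epsilon>) ^ 24 = 1"
      unfolding power_mult_distrib \<zeta>(1) \<xi>(1) \<epsilon>(1) by simp
    fix z \<tau> :: complex assume \<tau>: "Im \<tau> > 0"
    hence t0: "\<tau> \<noteq> 0" by auto
    have j0: "of_int d * \<tau> - of_int c \<noteq> 0"
      using j_nonzero[OF \<tau>, of d "- c"] SL2_bottom_row_nonzero[OF S(1)] by auto
    have e1: "lin a b (- 1 / \<tau>) = (lin b (- a) \<tau>) / \<tau>"
      and e2: "lin c d (- 1 / \<tau>) = (lin d (- c) \<tau>) / \<tau>"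
        using t0 by (simp_all add: field_simps)
    have e: "(lin b (- a) \<tau>) / (lin d (- c) \<tau>) =
       (lin a b (- 1 / \<tau>)) / (lin c d (- 1 / \<tau>))"
      unfolding e1 e2 using t0 by simp
    have ez: "z / (lin d (- c) \<tau>) = (z / \<tau>) / (lin c d (- 1 / \<tau>))"
      unfolding e2 using t0 by simp
    have ee: "e2pi (m * of_int c * (z / \<tau>) ^ 2 / (2 * (lin c d (- 1 / \<tau>)))) * e2pi (m * z ^ 2 / (2 * \<tau>)) =
       e2pi (m * of_int d * z ^ 2 / (2 * (lin d (- c) \<tau>)))"
    proof -
      have "m * of_int c * (z / \<tau>) ^ 2 / (2 * (lin c d (- 1 / \<tau>))) + m * z ^ 2 / (2 * \<tau>) =
        m * of_int d * z ^ 2 / (2 * (lin d (- c) \<tau>))"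
        unfolding e2 using t0 j0 by (simp add: divide_simps) (simp add: algebra_simps power2_eq_square)
      thus ?thesis unfolding e2pi_add[symmetric] by (rule arg_cong)
    qed
    have "F (z / (lin d (- c) \<tau>)) ((lin b (- a) \<tau>) / (lin d (- c) \<tau>)) =
      \<zeta> * \<xi> * ((lin c d (- 1 / \<tau>)) powr (1 / 2) * \<tau> powr (1 / 2)) *
       (e2pi (m * of_int c * (z / \<tau>) ^ 2 / (2 * (lin c d (- 1 / \<tau>)))) * e2pi (m * z ^ 2 / (2 * \<tau>))) * F z \<tau>"
      unfolding e ez \<zeta>(2)[OF Im_S[OF \<tau>]] \<xi>(2)[OF \<tau>] by (simp only: mult_ac)
    thus "F (z / (lin d (- c) \<tau>)) ((lin b (- a) \<tau>) / (lin d (- c) \<tau>)) =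
      \<zeta> * \<xi> * \<epsilon> * (lin d (- c) \<tau>) powr (1 / 2) *
        e2pi (m * of_int d * z ^ 2 / (2 * (lin d (- c) \<tau>))) * F z \<tau>"
      unfolding \<epsilon>(2)[OF \<tau>] ee by (simp only: mult_ac)
  qed
qed

theorem eta_modular:
  assumes "a * d - b * c = (1::int)"
  shows "\<exists>\<zeta>. \<zeta> ^ 24 = 1 \<and> (\<forall>\<tau>. Im \<tau> > 0 \<longrightarrow>
    eta ((lin a b \<tau>) / (lin c d \<tau>)) =
      \<zeta> * (lin c d \<tau>) powr (1 / 2) * eta \<tau>)"
proof -
  have "e2pi (of_int n / 24) ^ 24 = 1" for n :: int by (simp add: e2pi_power)
  hence 1: "\<exists>\<zeta>. \<zeta> ^ 24 = 1 \<and> (\<forall>z \<tau> :: complex. Im \<tau> > 0 \<longrightarrow> eta (\<tau> + of_int n) = \<zeta> * eta \<tau>)" for n :: int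
    using eta_add_int by blast
  obtain \<xi> where "\<xi> ^ 24 = 1" "\<And>\<tau>. Im \<tau> > 0 \<Longrightarrow> eta (- 1 / \<tau>) = \<xi> * \<tau> powr (1 / 2) * eta \<tau>"
    using eta_S by blast
  hence 2: "\<exists>\<zeta>. \<zeta> ^ 24 = 1 \<and> (\<forall>z \<tau> :: complex. Im \<tau> > 0 \<longrightarrow>
      eta (- 1 / \<tau>) = \<zeta> * \<tau> powr (1 / 2) * e2pi (0 * z ^ 2 / (2 * \<tau>)) * eta \<tau>)"
    by (intro exI[of _ \<xi>]) simp
  show ?thesis using modular_extension[OF assms, of "\<lambda>z. eta" 0, OF 1 2] by simp
qed

text \<open>The constant in the inversion of theta is eta (- 1 / \<tau>)^3 / (\<tau> eta^3), which
  by \<open>eta_S\<close> is \<xi>^3 times the square root of \<tau>: the multiplier is the cube of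
  that of eta.\<close>

theorem theta_modular:
  assumes "a * d - b * c = (1::int)"
  shows "\<exists>\<zeta>. \<zeta> ^ 24 = 1 \<and> (\<forall>z \<tau>. Im \<tau> > 0 \<longrightarrow>
    theta (z / (lin c d \<tau>)) ((lin a b \<tau>) / (lin c d \<tau>)) =
      \<zeta> * (lin c d \<tau>) powr (1 / 2) *
        e2pi (of_int c * z ^ 2 / (2 * (lin c d \<tau>))) * theta z \<tau>)"
proof -
  have "e2pi (of_int n / 8) ^ 24 = 1" for n :: int
  proof -
    have "of_nat 24 * (of_int n / 8) = (of_int (3 * n) :: complex)" by simp
    thus ?thesis unfolding e2pi_power by (simp only: e2pi_of_int)
  qed
  hence 1: "\<exists>\<zeta>. \<zeta> ^ 24 = 1 \<and> (\<forall>z \<tau>. Im \<tau> > 0 \<longrightarrow> theta z (\<tau> + of_int n) = \<zeta> * theta z \<tau>)" for n :: int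
    using theta_add_int_tau by blast
  obtain \<xi> where \<xi>: "\<xi> ^ 24 = 1" "\<And>\<tau>. Im \<tau> > 0 \<Longrightarrow> eta (- 1 / \<tau>) = \<xi> * \<tau> powr (1 / 2) * eta \<tau>"
    using eta_S by blast
  have "theta (z / \<tau>) (- 1 / \<tau>) = \<xi> ^ 3 * \<tau> powr (1 / 2) * e2pi (1 * z ^ 2 / (2 * \<tau>)) * theta z \<tau>"
    if \<tau>: "Im \<tau> > 0" for z \<tau>
  proof -
    have "(\<tau> powr (1 / 2)) ^ 3 = \<tau> * \<tau> powr (1 / 2)"
      using powr_half_squared[of \<tau>] by (simp add: power3_eq_cube power2_eq_square)
    moreover have "\<tau> \<noteq> 0" using \<tau> by auto
    ultimately have "eta (- 1 / \<tau>) ^ 3 / (\<tau> * eta \<tau> ^ 3) = \<xi> ^ 3 * \<tau> powr (1 / 2)"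
      unfolding \<xi>(2)[OF \<tau>] power_mult_distrib using eta_nonzero[OF \<tau>] by simp
    thus ?thesis unfolding eta_theta_inversion(2)[OF \<tau>] by simp
  qed
  moreover have "(\<xi> ^ 3) ^ 24 = (\<xi> ^ 24) ^ 3" by (simp flip: power_mult)
  ultimately have 2: "\<exists>\<zeta>. \<zeta> ^ 24 = 1 \<and> (\<forall>z \<tau>. Im \<tau> > 0 \<longrightarrow>
      theta (z / \<tau>) (- 1 / \<tau>) = \<zeta> * \<tau> powr (1 / 2) * e2pi (1 * z ^ 2 / (2 * \<tau>)) * theta z \<tau>)"
    using \<xi>(1) by (intro exI[of _ "\<xi> ^ 3"]) simp
  show ?thesis using modular_extension[OF assms 1 2] by simp
qed

subsection \<open>Transformation of the quotient\<close>

text \<open>In the variables 2 z and 2 \<tau> the translation is a (2 \<tau>) + 2 b, so b enters the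
  sign only through (-1)^(2 b) = 1.\<close>

lemma phi_add_lattice:
  "phi (z + of_int a * \<tau> + of_int b) \<tau> = (-1) powi a * e2pi (of_int a ^ 2 * \<tau> + 2 * of_int a * z) * phi z \<tau>"
proof -
  have "2 * (z + of_int a * \<tau> + of_int b) = 2 * z + of_int a * (2 * \<tau>) + of_int (2 * b)"
    by (simp add: algebra_simps)
  hence "theta (2 * (z + of_int a * \<tau> + of_int b)) (2 * \<tau>) =
    (-1) powi a * e2pi (- (of_int a ^ 2 * \<tau> + 2 * of_int a * z)) * theta (2 * z) (2 * \<tau>)"
    by (simp only: theta_add_lattice) (simp add: minus_one_powi mult_ac)
  thus ?thesis unfolding phi_def e2pi_minus by (simp add: minus_one_powi)
qed

text \<open>J is a square root of the automorphy factor and E the exponential of the theta law. Four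
  copies of J over two plus one leave a single J, that is weight 1/2.\<close>

lemma eta_theta_quotient_transform:
  fixes J E \<zeta>1 \<zeta>2 \<zeta>3 :: complex
  assumes "J \<noteq> 0"
  shows "(\<zeta>1 * J * x) ^ 4 / ((\<zeta>2 * J * y) ^ 2 * (\<zeta>3 * J * E * t)) =
    \<zeta>1 ^ 4 / (\<zeta>2 ^ 2 * \<zeta>3) * J * (1 / E) * (x ^ 4 / (y ^ 2 * t))"
proof -
  have "J ^ 4 / (J ^ 2 * J) = J" using assms(1) by (simp add: eval_nat_numeral)
  hence "\<zeta>1 ^ 4 / (\<zeta>2 ^ 2 * \<zeta>3) * J * (1 / E) * (x ^ 4 / (y ^ 2 * t)) =
    \<zeta>1 ^ 4 / (\<zeta>2 ^ 2 * \<zeta>3) * (J ^ 4 / (J ^ 2 * J)) * (1 / E) * (x ^ 4 / (y ^ 2 * t))" by simp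
  also have "\<dots> = (\<zeta>1 * J * x) ^ 4 / ((\<zeta>2 * J * y) ^ 2 * (\<zeta>3 * J * E * t))"
    by (simp only: power_mult_distrib times_divide_times_eq times_divide_eq_right times_divide_eq_left divide_divide_eq_left mult_1_right mult_1_left mult_ac)
  finally show "(\<zeta>1 * J * x) ^ 4 / ((\<zeta>2 * J * y) ^ 2 * (\<zeta>3 * J * E * t)) =
    \<zeta>1 ^ 4 / (\<zeta>2 ^ 2 * \<zeta>3) * J * (1 / E) * (x ^ 4 / (y ^ 2 * t))" ..
qed

lemma root_of_unity_quotient:
  fixes \<zeta>1 \<zeta>2 \<zeta>3 :: complex
  assumes "\<zeta>1 ^ 24 = 1" "\<zeta>2 ^ 24 = 1" "\<zeta>3 ^ 24 = 1"
  shows "(\<zeta>1 ^ 4 / (\<zeta>2 ^ 2 * \<zeta>3)) ^ 24 = 1"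
proof -
  have "(\<zeta>1 ^ 4) ^ 24 = (\<zeta>1 ^ 24) ^ 4" "(\<zeta>2 ^ 2) ^ 24 = (\<zeta>2 ^ 24) ^ 2"
    by (simp_all flip: power_mult)
  thus "(\<zeta>1 ^ 4 / (\<zeta>2 ^ 2 * \<zeta>3)) ^ 24 = 1"
    unfolding power_divide power_mult_distrib assms by simp
qed

text \<open>The common shape of \<open>phi\<close> at all cusps. The parameters (\<kappa>, l, e) =
  (2, 4, 0) give back \<open>phi\<close>; (1, 1, 0) and (1, 1, 1) give the forms in \<tau>/2 and
  (\<tau> + 1)/2.\<close>

definition cusp_phi :: "nat \<Rightarrow> nat \<Rightarrow> nat \<Rightarrow> complex \<Rightarrow> complex \<Rightarrow> complex" where
  "cusp_phi \<kappa> l e z \<tau> = eta ((of_nat l * \<tau> + of_nat e) / 2) ^ 4 /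
     (eta \<tau> ^ 2 * theta (of_nat \<kappa> * z) ((of_nat l * \<tau> + of_nat e) / 2))"

text \<open>A positive real factor leaves the argument unchanged, so here the principal square root
  is multiplicative without a sign.\<close>

lemma powr_half_mult_real:
  fixes r :: real and j :: complex
  assumes "r > 0"
  shows "(of_real r * j) powr (1 / 2) = of_real r powr (1 / 2) * j powr (1 / 2)"
proof (cases "j = 0")
  case False
  have "Ln (of_real r * j) = Ln (of_real r) + Ln j"
    using Ln_times_of_real[OF assms False] Ln_of_real[OF assms] by simp
  thus ?thesis using False assms by (simp add: powr_def exp_add ring_distribs add_divide_distrib)
qed auto

text \<open>
  The determinant-2 matrix that sends \<open>\<tau>\<close> to \<open>2 * moebius A \<tau>\<close> factors as a matrix \<open>(a1, b1; c1, d1)\<close>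
  of determinant 1 after the map \<open>\<tau> \<mapsto> (l * \<tau> + e) / 2\<close>.
\<close>

lemma phi_factored_transform:
  fixes a b c d a1 b1 c1 d1 :: int
  assumes det: "a * d - b * c = 1" "a1 * d1 - b1 * c1 = 1" and pos: "l > 0" "\<kappa> > 0"
    and num: "\<And>\<tau>. lin a1 b1 ((of_nat l * \<tau> + of_nat e) / 2) = of_nat \<kappa> * lin a b \<tau>"
    and den: "\<And>\<tau>. lin c1 d1 ((of_nat l * \<tau> + of_nat e) / 2) = of_nat \<kappa> / 2 * lin c d \<tau>"
    and c: "c = int \<kappa> * c1"
  defines "h \<equiv> (of_nat \<kappa> / 2 :: complex) powr (1 / 2)"
  shows "\<exists>\<zeta>1 \<zeta>2 \<zeta>3. \<zeta>1 ^ 24 = 1 \<and> \<zeta>2 ^ 24 = 1 \<and> \<zeta>3 ^ 24 = 1 \<and> (\<forall>z \<tau>. Im \<tau> > 0 \<longrightarrow>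
    phi (z / lin c d \<tau>) (lin a b \<tau> / lin c d \<tau>) = (\<zeta>1 * h) ^ 4 / (\<zeta>2 ^ 2 * (\<zeta>3 * h)) * lin c d \<tau> powr (1 / 2) *
        (1 / e2pi (of_int c * z ^ 2 / lin c d \<tau>)) * cusp_phi \<kappa> l e z \<tau>)"
proof -
  from eta_modular[OF det(2)] obtain \<zeta>1 where 1: "\<zeta>1 ^ 24 = 1" "\<And>\<tau>. Im \<tau> > 0 \<Longrightarrow>
    eta (lin a1 b1 \<tau> / lin c1 d1 \<tau>) = \<zeta>1 * lin c1 d1 \<tau> powr (1 / 2) * eta \<tau>" by blast
  from eta_modular[OF det(1)] obtain \<zeta>2 where 2: "\<zeta>2 ^ 24 = 1" "\<And>\<tau>. Im \<tau> > 0 \<Longrightarrow>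
    eta (lin a b \<tau> / lin c d \<tau>) = \<zeta>2 * lin c d \<tau> powr (1 / 2) * eta \<tau>" by blast
  from theta_modular[OF det(2)] obtain \<zeta>3 where 3: "\<zeta>3 ^ 24 = 1" "\<And>z \<tau>. Im \<tau> > 0 \<Longrightarrow>
    theta (z / lin c1 d1 \<tau>) (lin a1 b1 \<tau> / lin c1 d1 \<tau>) = \<zeta>3 * lin c1 d1 \<tau> powr (1 / 2) *
        e2pi (of_int c1 * z ^ 2 / (2 * lin c1 d1 \<tau>)) * theta z \<tau>" by blast
  show ?thesis
  proof (intro exI conjI allI impI)
    show "\<zeta>1 ^ 24 = 1" "\<zeta>2 ^ 24 = 1" "\<zeta>3 ^ 24 = 1" by (fact 1 2 3)+
    fix z \<tau> :: complex assume \<tau>: "Im \<tau> > 0"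
    define j where "j = lin c d \<tau>"
    define u where "u = (of_nat l * \<tau> + of_nat e) / 2"
    have j0: "j \<noteq> 0" unfolding j_def using j_nonzero[OF \<tau> SL2_bottom_row_nonzero[OF det(1)]] .
    have u: "Im u > 0" using \<tau> pos by (simp add: u_def)
    have \<kappa>: "(of_nat \<kappa> :: complex) \<noteq> 0" using pos by simp
    have A: "2 * (lin a b \<tau> / j) = lin a1 b1 u / (of_nat \<kappa> / 2 * j)"
      unfolding num u_def using \<kappa> j0 by (simp add: field_simps)
    have z2: "2 * (z / j) = (of_nat \<kappa> * z) / (of_nat \<kappa> / 2 * j)" using \<kappa> j0 by (simp add: field_simps)
    have E: "e2pi (of_int c1 * (of_nat \<kappa> * z) ^ 2 / (2 * (of_nat \<kappa> / 2 * j))) = e2pi (of_int c * z ^ 2 / j)"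
      unfolding c using \<kappa> j0 by (intro arg_cong[where f = e2pi]) (simp add: field_simps power2_eq_square)
    have h: "(of_nat \<kappa> / 2 * j) powr (1 / 2) = h * j powr (1 / 2)"
      using powr_half_mult_real[of "of_nat \<kappa> / 2" j] pos unfolding h_def by simp
    have f1: "eta (lin a1 b1 u / (of_nat \<kappa> / 2 * j)) = \<zeta>1 * h * j powr (1 / 2) * eta u"
      using 1(2)[OF u] unfolding den[of \<tau>, folded u_def j_def] h by (simp only: mult_ac)
    have f2: "eta (lin a b \<tau> / j) = \<zeta>2 * j powr (1 / 2) * eta \<tau>"
      using 2(2)[OF \<tau>] unfolding j_def .
    have f3: "theta ((of_nat \<kappa> * z) / (of_nat \<kappa> / 2 * j)) (lin a1 b1 u / (of_nat \<kappa> / 2 * j)) =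
        \<zeta>3 * h * j powr (1 / 2) * e2pi (of_int c * z ^ 2 / j) * theta (of_nat \<kappa> * z) u"
      using 3(2)[OF u, of "of_nat \<kappa> * z"] unfolding den[of \<tau>, folded u_def j_def] h E by (simp only: mult_ac)
    have "phi (z / j) (lin a b \<tau> / j) = (\<zeta>1 * h * j powr (1 / 2) * eta u) ^ 4 / ((\<zeta>2 * j powr (1 / 2) * eta \<tau>) ^ 2 *
         (\<zeta>3 * h * j powr (1 / 2) * e2pi (of_int c * z ^ 2 / j) * theta (of_nat \<kappa> * z) u))"
      unfolding phi_def A z2 f1 f2 f3 ..
    also have "\<dots> = (\<zeta>1 * h) ^ 4 / (\<zeta>2 ^ 2 * (\<zeta>3 * h)) * j powr (1 / 2) * (1 / e2pi (of_int c * z ^ 2 / j)) * cusp_phi \<kappa> l e z \<tau>"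
      unfolding cusp_phi_def u_def[symmetric] by (rule eta_theta_quotient_transform) (use j0 in auto)
    finally show "phi (z / lin c d \<tau>) (lin a b \<tau> / lin c d \<tau>) = (\<zeta>1 * h) ^ 4 / (\<zeta>2 ^ 2 * (\<zeta>3 * h)) * lin c d \<tau> powr (1 / 2) *
        (1 / e2pi (of_int c * z ^ 2 / lin c d \<tau>)) * cusp_phi \<kappa> l e z \<tau>"
      unfolding j_def .
  qed
qed

text \<open>For even c, doubling the image of \<tau> amounts to applying (a, 2 b; c/2, d), again of
  determinant 1, to 2 \<tau>. Here \<kappa> = 2 makes the scaling factor \<open>h\<close> of
  \<open>phi_factored_transform\<close> equal to 1, so the constant stays a root of unity.\<close>

theorem phi_modular:
  assumes "a * d - b * c = (1::int)" "even c"
  shows "\<exists>\<zeta>. \<zeta> ^ 24 = 1 \<and> (\<forall>z \<tau>. Im \<tau> > 0 \<longrightarrow>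
    phi (z / lin c d \<tau>) (lin a b \<tau> / lin c d \<tau>) =
      \<zeta> * lin c d \<tau> powr (1 / 2) * (1 / e2pi (of_int c * z ^ 2 / lin c d \<tau>)) * phi z \<tau>)"
proof -
  obtain c1 where c: "c = 2 * c1" using assms(2) by blast
  have phi: "cusp_phi 2 4 0 z \<tau> = phi z \<tau>" for z \<tau>
    by (simp add: cusp_phi_def phi_def)
  have "\<exists>\<zeta>1 \<zeta>2 \<zeta>3. \<zeta>1 ^ 24 = 1 \<and> \<zeta>2 ^ 24 = 1 \<and> \<zeta>3 ^ 24 = 1 \<and> (\<forall>z \<tau>. Im \<tau> > 0 \<longrightarrow>
    phi (z / lin c d \<tau>) (lin a b \<tau> / lin c d \<tau>) = (\<zeta>1 * (of_nat 2 / 2) powr (1 / 2)) ^ 4 /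
        (\<zeta>2 ^ 2 * (\<zeta>3 * (of_nat 2 / 2) powr (1 / 2))) * lin c d \<tau> powr (1 / 2) *
        (1 / e2pi (of_int c * z ^ 2 / lin c d \<tau>)) * cusp_phi 2 4 0 z \<tau>)"
    by (rule phi_factored_transform[of a d b c a d "2 * b" c1 4 2 0])
       (use assms c in \<open>simp_all add: algebra_simps\<close>)
  then obtain \<zeta>1 \<zeta>2 \<zeta>3 where \<zeta>: "\<zeta>1 ^ 24 = 1" "\<zeta>2 ^ 24 = 1" "\<zeta>3 ^ 24 = 1" and
    law: "\<And>z \<tau>. Im \<tau> > 0 \<Longrightarrow> phi (z / lin c d \<tau>) (lin a b \<tau> / lin c d \<tau>) =
      \<zeta>1 ^ 4 / (\<zeta>2 ^ 2 * \<zeta>3) * lin c d \<tau> powr (1 / 2) * (1 / e2pi (of_int c * z ^ 2 / lin c d \<tau>)) * phi z \<tau>"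
    unfolding phi by auto
  show ?thesis using root_of_unity_quotient[OF \<zeta>] law by blast
qed

text \<open>For odd c the matrix (2 a, b - a e; c, (d - c e)/2) acts on (\<tau> + e)/2. With
  \<kappa> = 1 the factor \<open>h\<close> is the square root of 1/2, so C is only asserted to be
  some constant.\<close>

theorem phi_at_cusps:
  assumes "a * d - b * c = (1::int)"
  shows "\<exists>C \<kappa> l e. l > 0 \<and> \<kappa> > 0 \<and> (\<forall>z \<tau>. Im \<tau> > 0 \<longrightarrow>
    phi (z / lin c d \<tau>) (lin a b \<tau> / lin c d \<tau>) =
      C * lin c d \<tau> powr (1 / 2) * (1 / e2pi (of_int c * z ^ 2 / lin c d \<tau>)) * cusp_phi \<kappa> l e z \<tau>)"
proof (cases "even c")
  case True
  have "cusp_phi 2 4 0 z \<tau> = phi z \<tau>" for z \<tau>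
    by (simp add: cusp_phi_def phi_def)
  thus ?thesis using phi_modular[OF assms True]
    by (metis zero_less_numeral)
next
  case False
  define e where "e = nat (d mod 2)"
  have e: "int e = d mod 2" by (simp add: e_def)
  \<comment> \<open>As c is odd, the choice e = d mod 2 makes d - c e even, which keeps the factored
    matrix integral.\<close>
  have "even (d - c * int e)" using False unfolding e by (auto simp: even_iff_mod_2_eq_zero odd_iff_mod_2_eq_one mod_diff_eq[symmetric] mod_mult_eq[symmetric])
  then obtain d1 where d1: "d - c * int e = 2 * d1" by blast
  have det: "(2 * a) * d1 - (b - a * int e) * c = 1"
  proof -
    have "(2 * a) * d1 = a * (d - c * int e)" unfolding d1 by simp
    thus ?thesis using assms by (simp add: algebra_simps)
  qed
  have "d = 2 * d1 + c * int e" using d1 by simp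
  hence d: "(of_int d :: complex) = 2 * of_int d1 + of_int c * of_nat e" by simp
  have num: "lin (2 * a) (b - a * int e) ((of_nat 1 * \<tau> + of_nat e) / 2) = of_nat 1 * lin a b \<tau>"
    and den: "lin c d1 ((of_nat 1 * \<tau> + of_nat e) / 2) = of_nat 1 / 2 * lin c d \<tau>" for \<tau>
    unfolding d by (simp_all add: algebra_simps add_divide_distrib)
  from phi_factored_transform[OF assms det _ _ num den] show ?thesis by (metis int_ops(2) mult_1 zero_less_one)
qed

subsection \<open>Principal congruence subgroups\<close>

lemma SL2Z_simps: "carrier SL2Z = {A. det A = 1}" "A \<otimes>\<^bsub>SL2Z\<^esub> B = A ** B" "\<one>\<^bsub>SL2Z\<^esub> = mat 1"
  by (simp_all add: SL2Z_def)

lemma matrix_mult_entries: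
  fixes A B :: "int ^ 2 ^ 2"
  shows "(A ** B) $ i $ j = A $ i $ 1 * B $ 1 $ j + A $ i $ 2 * B $ 2 $ j"
  by (simp add: matrix_matrix_mult_def sum_2)

definition adj2 :: "int ^ 2 ^ 2 \<Rightarrow> int ^ 2 ^ 2" where
  "adj2 A = vector [vector [A $ 2 $ 2, - A $ 1 $ 2], vector [- A $ 2 $ 1, A $ 1 $ 1]]"

lemma adj2_entries [simp]:
  "adj2 A $ 1 $ 1 = A $ 2 $ 2" "adj2 A $ 1 $ 2 = - A $ 1 $ 2"
  "adj2 A $ 2 $ 1 = - A $ 2 $ 1" "adj2 A $ 2 $ 2 = A $ 1 $ 1"
  by (simp_all add: adj2_def)

lemma mat1_entries: "(mat 1 :: int ^ 2 ^ 2) $ i $ j = (if i = j then 1 else 0)"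
  by (simp add: mat_def)

lemma adj2_mult:
  assumes "det A = (1::int)"
  shows "adj2 A ** A = mat 1" "A ** adj2 A = mat 1" "det (adj2 A) = 1"
  using assms by (simp_all add: vec_eq_iff forall_2 matrix_mult_entries mat1_entries det_2 mult_ac)

lemma SL2Z_group: "group SL2Z"
proof (rule groupI)
  fix A B C assume "A \<in> carrier SL2Z" "B \<in> carrier SL2Z" "C \<in> carrier SL2Z"
  thus "A \<otimes>\<^bsub>SL2Z\<^esub> B \<in> carrier SL2Z" "A \<otimes>\<^bsub>SL2Z\<^esub> B \<otimes>\<^bsub>SL2Z\<^esub> C = A \<otimes>\<^bsub>SL2Z\<^esub> (B \<otimes>\<^bsub>SL2Z\<^esub> C)"
    "\<one>\<^bsub>SL2Z\<^esub> \<otimes>\<^bsub>SL2Z\<^esub> A = A"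
    by (simp_all add: SL2Z_simps det_mul matrix_mul_assoc)
  show "\<exists>B\<in>carrier SL2Z. B \<otimes>\<^bsub>SL2Z\<^esub> A = \<one>\<^bsub>SL2Z\<^esub>"
    using \<open>A \<in> carrier SL2Z\<close> adj2_mult[of A] by (auto simp: SL2Z_simps)
qed (simp add: SL2Z_simps det_I)

lemma SL2Z_inv:
  assumes "A \<in> carrier SL2Z"
  shows "inv\<^bsub>SL2Z\<^esub> A = adj2 A"
  by (rule group.inv_equality[OF SL2Z_group]) (use assms adj2_mult[of A] in \<open>auto simp: SL2Z_simps\<close>)

lemma principal_congruence_subgroup_iff:
  "A \<in> principal_congruence_subgroup N \<longleftrightarrow> det A = 1 \<and> int N dvd A $ 1 $ 1 - 1 \<and> int N dvd A $ 1 $ 2 \<and>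
     int N dvd A $ 2 $ 1 \<and> int N dvd A $ 2 $ 2 - 1"
  by (auto simp: principal_congruence_subgroup_def SL2Z_simps forall_2 mat1_entries)

lemma principal_congruence_subgroup_congruence:
  assumes "N > 0"
  shows "congruence_subgroup (principal_congruence_subgroup N)"
proof -
  have "subgroup (principal_congruence_subgroup N) SL2Z"
  proof (rule group.subgroupI[OF SL2Z_group])
    show "principal_congruence_subgroup N \<subseteq> carrier SL2Z"
      by (auto simp: principal_congruence_subgroup_def)
    have "mat 1 \<in> principal_congruence_subgroup N"
      by (simp add: principal_congruence_subgroup_iff mat1_entries det_I)
    thus "principal_congruence_subgroup N \<noteq> {}" by blast
  next
    fix A assume A: "A \<in> principal_congruence_subgroup N"
    hence "A \<in> carrier SL2Z" by (simp add: principal_congruence_subgroup_iff SL2Z_simps)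
    thus "inv\<^bsub>SL2Z\<^esub> A \<in> principal_congruence_subgroup N"
      unfolding SL2Z_inv using A adj2_mult[of A] by (simp add: principal_congruence_subgroup_iff SL2Z_inv)
  next
    fix A B assume AB: "A \<in> principal_congruence_subgroup N" "B \<in> principal_congruence_subgroup N"
    have A: "det A = 1" "int N dvd A $ 1 $ 1 - 1" "int N dvd A $ 1 $ 2" "int N dvd A $ 2 $ 1" "int N dvd A $ 2 $ 2 - 1"
      and B: "det B = 1" "int N dvd B $ 1 $ 1 - 1" "int N dvd B $ 1 $ 2" "int N dvd B $ 2 $ 1" "int N dvd B $ 2 $ 2 - 1"
      using AB by (simp_all only: principal_congruence_subgroup_iff)
    have "int N dvd (A $ 1 $ 1 - 1) * B $ 1 $ 1 + A $ 1 $ 2 * B $ 2 $ 1 + (B $ 1 $ 1 - 1)"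
      by (rule dvd_add[OF dvd_add[OF dvd_mult2[OF A(2)] dvd_mult2[OF A(3)]] B(2)])
    moreover have "int N dvd A $ 2 $ 1 * B $ 1 $ 2 + (A $ 2 $ 2 - 1) * B $ 2 $ 2 + (B $ 2 $ 2 - 1)"
      by (rule dvd_add[OF dvd_add[OF dvd_mult2[OF A(4)] dvd_mult2[OF A(5)]] B(5)])
    moreover have "(a - 1) * e + b * g + (e - 1) = a * e + b * g - 1"
      "b * g + (a - 1) * e + (e - 1) = b * g + a * e - 1" for a b e g :: int
      by (simp_all add: algebra_simps)
    moreover have "int N dvd A $ 1 $ 1 * B $ 1 $ 2 + A $ 1 $ 2 * B $ 2 $ 2"
      by (rule dvd_add[OF dvd_mult[OF B(3)] dvd_mult2[OF A(3)]])
    moreover have "int N dvd A $ 2 $ 1 * B $ 1 $ 1 + A $ 2 $ 2 * B $ 2 $ 1"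
      by (rule dvd_add[OF dvd_mult2[OF A(4)] dvd_mult[OF B(4)]])
    moreover have "det (A ** B) = 1" unfolding det_mul A(1) B(1) by simp
    ultimately show "A \<otimes>\<^bsub>SL2Z\<^esub> B \<in> principal_congruence_subgroup N"
      unfolding principal_congruence_subgroup_iff SL2Z_simps matrix_mult_entries by (simp only: simp_thms)
  qed
  thus ?thesis unfolding congruence_subgroup_def using assms by blast
qed

lemma SL2Z_det: "A \<in> carrier SL2Z \<Longrightarrow> A $ 1 $ 1 * A $ 2 $ 2 - A $ 1 $ 2 * A $ 2 $ 1 = 1"
  by (simp add: SL2Z_simps det_2)

subsection \<open>The Jacobi form\<close>

lemma countable_e2pi_level:
  assumes "k \<noteq> 0"
  shows "countable {z. e2pi (k * z) = c}"
proof (cases "{z. e2pi (k * z) = c} = {}")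
  case False
  then obtain z0 where z0: "e2pi (k * z0) = c" by blast
  have "{z. e2pi (k * z) = c} \<subseteq> range (\<lambda>n::int. z0 + of_int n / k)"
  proof
    fix z assume "z \<in> {z. e2pi (k * z) = c}"
    hence "e2pi (k * z - k * z0) = 1" using z0 by (simp add: e2pi_diff) (metis e2pi_nonzero)
    then obtain n :: int where "k * z - k * z0 = of_int n" unfolding e2pi_eq_1_iff by blast
    hence "z = z0 + of_int n / k" using assms by (simp add: field_simps)
    thus "z \<in> range (\<lambda>n::int. z0 + of_int n / k)" by blast
  qed
  thus ?thesis by (rule countable_subset) auto
qed auto

text \<open>An open set contains a product of open sets. Its second factor is infinite, so some y
  avoids \<open>F\<close>; the disc of points above this y is uncountable and cannot consist of
  zeros. \<open>F\<close> allows for exceptional slices on which Q vanishes identically.\<close>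

lemma open_countable_slices:
  fixes W :: "(complex \<times> complex) set"
  assumes "open W" "W \<noteq> {}" "finite F" "\<And>y. y \<notin> F \<Longrightarrow> (\<exists>x. (x, y) \<in> W) \<Longrightarrow> countable {x. Q (x, y) = (0::complex)}"
  shows "\<exists>p\<in>W. Q p \<noteq> 0"
proof -
  obtain p where "p \<in> W" using assms(2) by blast
  then obtain A B where AB: "open A" "open B" "p \<in> A \<times> B" "A \<times> B \<subseteq> W"
    by (rule open_prod_elim[OF assms(1)])
  have "infinite B" using AB(2,3) finite_imp_not_open[of B] by auto
  hence "\<exists>y\<in>B. y \<notin> F" using assms(3) by (meson finite_subset subsetI)
  then obtain y where y: "y \<in> B" "y \<notin> F" by blast
  obtain r where "r > 0" "ball (fst p) r \<subseteq> A"
    using AB(1,3) open_contains_ball[of A] by (auto simp: mem_Times_iff)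
  hence "uncountable A" using uncountable_ball countable_subset by blast
  moreover have "countable {x. Q (x, y) = 0}"
    by (rule assms(4)) (use y AB in auto)
  ultimately obtain x where "x \<in> A" "Q (x, y) \<noteq> 0"
    by (metis (mono_tags, lifting) countable_subset mem_Collect_eq subsetI)
  thus ?thesis using y AB(4) by blast
qed

section \<open>Poles and regular points of the function\<close>

lemma theta2_isCont:
  assumes "Im \<tau> > 0"
  shows "isCont (\<lambda>\<beta>. theta (2 * \<beta>) (2 * \<tau>)) z"
proof -
  have "hd2 (\<lambda>p. theta (2 * fst p) (2 * \<tau>)) (z, 0)"
    by (intro theta_hd2 hd2_mult hd2_const hd2_fst) (use assms in simp)
  from hd2_imp_field_differentiable(1)[OF this] show ?thesis
    by (simp add: field_differentiable_imp_continuous_at)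
qed

lemma theta2_eventually_nonzero:
  assumes "Im \<tau> > 0"
  shows "eventually (\<lambda>\<beta>. theta (2 * \<beta>) (2 * \<tau>) \<noteq> 0) (at z)"
proof (cases "theta (2 * z) (2 * \<tau>) = 0")
  case True
  have \<tau>2: "Im (2 * \<tau>) > 0" using assms by simp
  define d where "d = deriv (\<lambda>z. theta z (2 * \<tau>)) (2 * z)"
  have "((\<lambda>z. theta z (2 * \<tau>)) has_field_derivative d) (at (2 * z))"
    unfolding d_def by (rule holomorphic_derivI[OF theta_holomorphic[OF \<tau>2, of UNIV]]) auto
  moreover have "((\<lambda>z. 2 * z) has_field_derivative 2) (at z)"
    by (auto intro!: derivative_eq_intros)
  ultimately have "((\<lambda>z. theta (2 * z) (2 * \<tau>)) has_field_derivative (d * 2)) (at z)"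
    by (rule DERIV_chain2[where f = "\<lambda>z. theta z (2 * \<tau>)" and g = "\<lambda>z. 2 * z"])
  thus ?thesis
    by (rule eventually_nonzero_deriv) (use True theta_deriv_nonzero[OF \<tau>2 True] in \<open>auto simp: d_def\<close>)
next
  case False
  have "isCont (\<lambda>\<beta>. theta (2 * \<beta>) (2 * \<tau>)) z"
    using theta2_isCont assms by blast
  thus ?thesis using False unfolding isCont_def by (rule tendsto_imp_eventually_ne)
qed

lemma theta2_eq_0_iff:
  assumes "Im \<tau> > 0"
  shows "theta (2 * z) (2 * \<tau>) = 0 \<longleftrightarrow> (\<exists>m n :: int. 2 * z = 2 * of_int n * \<tau> + of_int m)"
proof -
  have "Im (2 * \<tau>) > 0" using assms by simp
  from theta_eq_0_iff[OF this, of "2 * z"] show ?thesis by (simp add: mult_ac)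
qed

lemma g2_sum_times_theta:
  assumes "Im \<tau> > 0" "theta (2 * z) (2 * \<tau>) \<noteq> 0"
  shows "g2_sum z \<tau> * (eta \<tau> ^ 2 * theta (2 * z) (2 * \<tau>)) = - 2 * eta (2 * \<tau>) ^ 4"
  using eta_nonzero[OF assms(1)] assms(2) unfolding g2_sum_eq_phi[OF assms] phi_def by simp

lemma phi_is_pole:
  assumes "Im \<tau> > 0" "theta (2 * \<alpha>) (2 * \<tau>) = 0"
  shows "is_pole (\<lambda>\<beta>. - 2 * phi \<beta> \<tau>) \<alpha>"
proof -
  have \<tau>2: "Im (2 * \<tau>) > 0" using assms by simp
  have "is_pole (\<lambda>\<beta>. (- 2 * eta (2 * \<tau>) ^ 4) / (eta \<tau> ^ 2 * theta (2 * \<beta>) (2 * \<tau>))) \<alpha>"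
  proof (rule is_pole_divide)
    show "filterlim (\<lambda>\<beta>. eta \<tau> ^ 2 * theta (2 * \<beta>) (2 * \<tau>)) (at 0) (at \<alpha>)"
      unfolding filterlim_at
    proof
      show "eventually (\<lambda>\<beta>. eta \<tau> ^ 2 * theta (2 * \<beta>) (2 * \<tau>) \<in> UNIV \<and> eta \<tau> ^ 2 * theta (2 * \<beta>) (2 * \<tau>) \<noteq> 0) (at \<alpha>)"
        using theta2_eventually_nonzero[OF assms(1), of \<alpha>]
        by eventually_elim (use eta_nonzero[OF assms(1)] in auto)
      have "((\<lambda>\<beta>. eta \<tau> ^ 2 * theta (2 * \<beta>) (2 * \<tau>)) \<longlongrightarrow> eta \<tau> ^ 2 * theta (2 * \<alpha>) (2 * \<tau>)) (at \<alpha>)"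
        using theta2_isCont[OF assms(1), of \<alpha>] unfolding isCont_def by (intro tendsto_intros)
      thus "((\<lambda>\<beta>. eta \<tau> ^ 2 * theta (2 * \<beta>) (2 * \<tau>)) \<longlongrightarrow> 0) (at \<alpha>)" using assms(2) by simp
    qed
  qed (use eta_nonzero[OF \<tau>2] in auto)
  thus ?thesis by (simp add: phi_def)
qed

text \<open>The zeros of theta are isolated, so \<open>g2_sum\<close> equals the theta quotient on a
  punctured neighbourhood, and being a pole depends on nothing else.\<close>

lemma g2_sum_is_pole:
  assumes "Im \<tau> > 0" "theta (2 * \<alpha>) (2 * \<tau>) = 0"
  shows "is_pole (\<lambda>\<beta>. g2_sum \<beta> \<tau>) \<alpha>"
proof (rule is_pole_transform[OF phi_is_pole[OF assms]])
  show "eventually (\<lambda>\<beta>. - 2 * phi \<beta> \<tau> = g2_sum \<beta> \<tau>) (at \<alpha>)"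
    using theta2_eventually_nonzero[OF assms(1), of \<alpha>]
    by eventually_elim (use g2_sum_eq_phi[OF assms(1)] in auto)
qed simp

text \<open>Regularity implies continuity in z, which excludes a pole. The guards in the definition
  of a Jacobi form thus become non-vanishing of theta, exactly where \<open>g2_sum\<close> is
  known.\<close>

lemma regular_g2_sum:
  assumes "regular2_at (\<lambda>(\<alpha>, \<tau>). g2_sum \<alpha> \<tau>) (z, \<tau>)" "Im \<tau> > 0"
  shows "theta (2 * z) (2 * \<tau>) \<noteq> 0"
proof
  assume 0: "theta (2 * z) (2 * \<tau>) = 0"
  have "hd2 (\<lambda>(\<alpha>, \<tau>). g2_sum \<alpha> \<tau>) (z, \<tau>)"
    using assms(1) unfolding regular2_at_def holomorphic2_on_iff by blast
  from hd2_imp_field_differentiable(1)[OF this]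
  have "isCont (\<lambda>\<beta>. g2_sum \<beta> \<tau>) z" by (simp add: field_differentiable_imp_continuous_at)
  moreover have "is_pole (\<lambda>\<beta>. g2_sum \<beta> \<tau>) z" by (rule g2_sum_is_pole[OF assms(2) 0])
  ultimately show False
    unfolding is_pole_def isCont_def using not_tendsto_and_filterlim_at_infinity[of "at z"] by auto
qed

lemma countable_theta2_zeros:
  assumes "Im \<tau> > 0"
  shows "countable {z. theta (2 * z) (2 * \<tau>) = 0}"
proof -
  have "{z. theta (2 * z) (2 * \<tau>) = 0} \<subseteq> (\<lambda>(m, n). (2 * of_int n * \<tau> + of_int m) / 2) ` (UNIV :: (int \<times> int) set)"
  proof
    fix z assume "z \<in> {z. theta (2 * z) (2 * \<tau>) = 0}"
    then obtain m n :: int where "2 * z = 2 * of_int n * \<tau> + of_int m"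
      using theta2_eq_0_iff[OF assms] by blast
    hence "z = (\<lambda>(m, n). (2 * of_int n * \<tau> + of_int m) / 2) (m, n)"
      by (simp add: eq_divide_eq mult.commute)
    thus "z \<in> (\<lambda>(m, n). (2 * of_int n * \<tau> + of_int m) / 2) ` (UNIV :: (int \<times> int) set)" by blast
  qed
  thus ?thesis by (rule countable_subset) auto
qed

lemma g2_sum_meromorphic2: "meromorphic2_on (\<lambda>(\<alpha>, \<tau>). g2_sum \<alpha> \<tau>) (UNIV \<times> upper_half_plane)"
  unfolding meromorphic2_on_def
proof
  fix p :: "complex \<times> complex" assume p: "p \<in> UNIV \<times> upper_half_plane"
  define V where "V = {p :: complex \<times> complex. Im (snd p) > 0}"
  define P where "P = (\<lambda>p :: complex \<times> complex. - 2 * eta (2 * snd p) ^ 4)"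
  define Q where "Q = (\<lambda>p :: complex \<times> complex. eta (snd p) ^ 2 * theta (2 * fst p) (2 * snd p))"
  show "\<exists>V P Q. open V \<and> p \<in> V \<and> holomorphic2_on P V \<and> holomorphic2_on Q V \<and>
        (\<forall>W. open W \<and> W \<noteq> {} \<and> W \<subseteq> V \<longrightarrow> (\<exists>x\<in>W. Q x \<noteq> 0)) \<and>
        (\<forall>x\<in>V. Q x \<noteq> 0 \<longrightarrow> (case x of (\<alpha>, \<tau>) \<Rightarrow> g2_sum \<alpha> \<tau>) = P x / Q x)"
  proof (intro exI conjI allI impI ballI)
    show "open V" unfolding V_def by (rule open_upper)
    show "p \<in> V" using p by (auto simp: V_def upper_half_plane_def)
    show "holomorphic2_on P V" unfolding holomorphic2_on_iff P_def
      by (intro ballI hd2_mult hd2_const hd2_power eta_hd2 hd2_snd) (auto simp: V_def)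
    show "holomorphic2_on Q V" unfolding holomorphic2_on_iff Q_def
      by (intro ballI hd2_mult hd2_const hd2_power eta_hd2 theta_hd2 hd2_snd hd2_fst) (auto simp: V_def)
    show "\<exists>x\<in>W. Q x \<noteq> 0" if W: "open W \<and> W \<noteq> {} \<and> W \<subseteq> V" for W
    proof (rule open_countable_slices[of W "{}"])
      fix y assume "\<exists>x. (x, y) \<in> W"
      hence y: "Im y > 0" using W by (auto simp: V_def)
      show "countable {x. Q (x, y) = 0}"
        using countable_theta2_zeros[OF y] eta_nonzero[OF y] by (simp add: Q_def)
    qed (use W in auto)
    fix x assume x: "x \<in> V" "Q x \<noteq> 0"
    obtain z \<tau> where [simp]: "x = (z, \<tau>)" by (cases x)
    have \<tau>: "Im \<tau> > 0" using x by (simp add: V_def)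
    show "(case x of (\<alpha>, \<tau>) \<Rightarrow> g2_sum \<alpha> \<tau>) = P x / Q x"
      using x(2) g2_sum_times_theta[OF \<tau>, of z] by (simp add: P_def Q_def field_simps)
  qed
qed

text \<open>With t = e2pi (\<tau> / (48 w)), p is the nome of (l \<tau> + e)/2. The number 48 clears
  the denominator 24 of eta at the halved argument, and w leaves room for the denominators of
  rational points.\<close>

definition cusp_num :: "nat \<Rightarrow> nat \<Rightarrow> nat \<Rightarrow> complex \<Rightarrow> complex" where
  "cusp_num l e w t = (let p = e2pi (of_nat e / 2) * t ^ (24 * l * w)
     in (e2pi (of_nat e / 48) * t ^ (l * w) * qinf p p) ^ 4)"

text \<open>Here \<open>x\<close> and \<open>h\<close> stand for \<open>e2pi (\<kappa> * z)\<close> and its square root \<open>e2pi (\<kappa> * z / 2)\<close>, and \<open>y\<close> for \<open>1 / x\<close>.\<close>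

definition cusp_den :: "nat \<Rightarrow> nat \<Rightarrow> nat \<Rightarrow> complex \<Rightarrow> complex \<Rightarrow> complex \<Rightarrow> complex \<Rightarrow> complex" where
  "cusp_den l e w h x y t = (let p = e2pi (of_nat e / 2) * t ^ (24 * l * w)
     in (t ^ (2 * w) * qinf (t ^ (48 * w)) (t ^ (48 * w))) ^ 2 *
        (e2pi (of_nat e / 16) * t ^ (3 * l * w) * h * (qinf p p * qinf (x * p) p * qinf y p)))"

lemma cusp_phi_expansion:
  assumes "Im \<tau> > 0" "l > 0" "w > 0"
  shows "cusp_phi \<kappa> l e z \<tau> = cusp_num l e w (e2pi (\<tau> / of_nat (48 * w))) /
    cusp_den l e w (e2pi (of_nat \<kappa> * z / 2)) (e2pi (of_nat \<kappa> * z)) (e2pi (- (of_nat \<kappa> * z))) (e2pi (\<tau> / of_nat (48 * w)))"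
proof -
  define t where "t = e2pi (\<tau> / of_nat (48 * w))"
  define u where "u = (of_nat l * \<tau> + of_nat e) / 2"
  have u: "Im u > 0" using assms by (simp add: u_def)
  have w: "(of_nat w :: complex) \<noteq> 0" using assms(3) by simp
  have tp: "t ^ (k * w) = e2pi (of_nat k * \<tau> / 48)" for k
    unfolding t_def e2pi_power using w by (intro arg_cong[where f = e2pi]) (simp add: field_simps)
  have e1: "e2pi (of_nat e / 2) * t ^ (24 * l * w) = e2pi u"
    unfolding tp e2pi_add[symmetric] u_def by (intro arg_cong[where f = e2pi]) (simp add: field_simps)
  have e2: "e2pi (of_nat e / 48) * t ^ (l * w) = e2pi (u / 24)"
    unfolding tp e2pi_add[symmetric] u_def by (intro arg_cong[where f = e2pi]) (simp add: field_simps)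
  have e3: "e2pi (of_nat e / 16) * t ^ (3 * l * w) = e2pi (u / 8)"
    unfolding tp e2pi_add[symmetric] u_def by (intro arg_cong[where f = e2pi]) (simp add: field_simps)
  have e4: "t ^ (2 * w) = e2pi (\<tau> / 24)" "t ^ (48 * w) = e2pi \<tau>"
    using tp[of 2] tp[of 48] by simp_all
  show ?thesis
    unfolding cusp_phi_def u_def[symmetric] t_def[symmetric] cusp_num_def cusp_den_def Let_def e1 e2 e3 e4
      eta_product theta_product[OF u]
    by (simp add: e2pi_minus mult_ac)
qed

lemma cusp_den_hd2:
  assumes "hd2 h p" "hd2 x p" "hd2 y p" "hd2 t p" "norm (t p) < 1" "l > 0" "w > 0"
  shows "hd2 (\<lambda>p. cusp_den l e w (h p) (x p) (y p) (t p)) p" "hd2 (\<lambda>p. cusp_num l e w (t p)) p"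
proof -
  have n: "norm (t p) ^ k < 1" if "k > 0" for k
    using assms(5) that by (simp add: power_less_one_iff)
  have "norm (e2pi (of_nat e / 2)) = 1" by (simp add: norm_e2pi)
  hence 1: "norm (e2pi (of_nat e / 2) * t p ^ (24 * l * w)) < 1"
    using n[of "24 * l * w"] assms by (simp add: norm_mult norm_power)
  have 2: "norm (t p ^ (48 * w)) < 1"
    using n[of "48 * w"] assms by (simp add: norm_power)
  show "hd2 (\<lambda>p. cusp_den l e w (h p) (x p) (y p) (t p)) p" "hd2 (\<lambda>p. cusp_num l e w (t p)) p"
    unfolding cusp_den_def cusp_num_def Let_def
    by (intro hd2_mult hd2_power hd2_const qinf_comp_hd2 assms 1 2)+
qed

lemma jacobi_cusp:
  assumes "l > 0" "\<kappa> > 0"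
  shows "meromorphic2_on (\<lambda>(z, t). C * cusp_num l e 1 t /
    cusp_den l e 1 (e2pi (of_nat \<kappa> * z / 2)) (e2pi (of_nat \<kappa> * z)) (e2pi (- (of_nat \<kappa> * z))) t) (UNIV \<times> ball 0 1)"
  unfolding meromorphic2_on_def
proof
  fix p :: "complex \<times> complex" assume p: "p \<in> UNIV \<times> ball 0 1"
  define V where "V = (UNIV \<times> ball 0 1 :: (complex \<times> complex) set)"
  define P where "P = (\<lambda>p :: complex \<times> complex. C * cusp_num l e 1 (snd p))"
  define Q where "Q = (\<lambda>p :: complex \<times> complex. cusp_den l e 1 (e2pi (of_nat \<kappa> / 2 * fst p)) (e2pi (of_nat \<kappa> * fst p))
    (e2pi (- of_nat \<kappa> * fst p)) (snd p))"
  show "\<exists>V P Q. open V \<and> p \<in> V \<and> holomorphic2_on P V \<and> holomorphic2_on Q V \<and>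
        (\<forall>W. open W \<and> W \<noteq> {} \<and> W \<subseteq> V \<longrightarrow> (\<exists>x\<in>W. Q x \<noteq> 0)) \<and>
        (\<forall>x\<in>V. Q x \<noteq> 0 \<longrightarrow> (case x of (z, t) \<Rightarrow> C * cusp_num l e 1 t /
    cusp_den l e 1 (e2pi (of_nat \<kappa> * z / 2)) (e2pi (of_nat \<kappa> * z)) (e2pi (- (of_nat \<kappa> * z))) t) = P x / Q x)"
  proof (intro exI conjI allI impI ballI)
    show "open V" unfolding V_def by (intro open_Times) auto
    show "p \<in> V" using p by (simp add: V_def)
    show "holomorphic2_on P V" unfolding holomorphic2_on_iff P_def
      by (intro ballI hd2_mult hd2_const cusp_den_hd2(2)[OF hd2_fst hd2_fst hd2_fst hd2_snd])
         (use assms in \<open>auto simp: V_def\<close>)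
    show "holomorphic2_on Q V" unfolding holomorphic2_on_iff Q_def
      by (intro ballI cusp_den_hd2(1) hd2_e2pi hd2_mult hd2_const hd2_fst hd2_snd)
         (use assms in \<open>auto simp: V_def\<close>)
    show "\<exists>x\<in>W. Q x \<noteq> 0" if W: "open W \<and> W \<noteq> {} \<and> W \<subseteq> V" for W
    proof (rule open_countable_slices[of W "{0}"])
      \<comment> \<open>The slice t = 0 lies in the ball and the denominator vanishes identically on
        it, hence the exceptional set {0}.\<close>
      fix t :: complex assume t0: "t \<notin> {0}" and "\<exists>x. (x, t) \<in> W"
      hence t: "norm t < 1" "t \<noteq> 0" using W by (auto simp: V_def)
      define p where "p = e2pi (of_nat e / 2) * t ^ (24 * l * 1)"
      have n: "norm t ^ k < 1" if "k > 0" for k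
        using t(1) that by (simp add: power_less_one_iff)
      have "norm (e2pi (of_nat e / 2)) = 1" by (simp add: norm_e2pi)
      hence p: "norm p < 1"
        using n[of "24 * l"] assms by (simp add: norm_mult norm_power p_def)
      have p0: "p \<noteq> 0" using t(2) by (simp add: p_def)
      have t48: "norm (t ^ (48 * 1)) < 1" using n[of 48] by (simp add: norm_power)
      \<comment> \<open>Zeros of the two z-dependent products, each a countable level set of e2pi
        (\<kappa> z); the other factors do not vanish for t \<noteq> 0.\<close>
      define S where "S = (\<Union>n. {z. e2pi (of_nat \<kappa> * z) = 1 / (p * p ^ n)}) \<union> (\<Union>n. {z. e2pi (of_nat \<kappa> * z) = p ^ n})"
      have "countable S" unfolding S_def
        using assms by (intro countable_Un countable_UN countable_e2pi_level) auto
      moreover have "{z. Q (z, t) = 0} \<subseteq> S"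
      proof
        fix z assume "z \<in> {z. Q (z, t) = 0}"
        hence "qinf (e2pi (of_nat \<kappa> * z) * p) p = 0 \<or> qinf (e2pi (- of_nat \<kappa> * z)) p = 0"
          using t(2) qinf_self_nonzero[OF p] qinf_self_nonzero[OF t48]
          unfolding Q_def cusp_den_def Let_def fst_conv snd_conv p_def[symmetric] by simp
        then obtain k where "e2pi (of_nat \<kappa> * z) * p * p ^ k = 1 \<or> e2pi (- of_nat \<kappa> * z) * p ^ k = 1"
          unfolding qinf_eq_0_iff[OF p] by blast
        hence "e2pi (of_nat \<kappa> * z) = 1 / (p * p ^ k) \<or> e2pi (of_nat \<kappa> * z) = p ^ k"
          using p0 by (auto simp: field_simps e2pi_minus)
        thus "z \<in> S" unfolding S_def by blast
      qed
      ultimately show "countable {z. Q (z, t) = 0}" using countable_subset by blast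
    qed (use W in auto)
  qed (auto simp: P_def Q_def)
qed

lemma SL2Z_automorphy_nonzero:
  assumes "A \<in> carrier SL2Z" "Im \<tau> > 0"
  shows "automorphy A \<tau> \<noteq> 0"
  unfolding automorphy_def using j_nonzero[OF assms(2) SL2_bottom_row_nonzero[OF SL2Z_det[OF assms(1)]]] .

lemma SL2Z_Im_moebius:
  assumes "A \<in> carrier SL2Z" "Im \<tau> > 0"
  shows "Im (moebius A \<tau>) > 0"
  unfolding moebius_def automorphy_def by (rule Im_moebius[OF assms(2) SL2Z_det[OF assms(1)]])

abbreviation (input) jacobi_factor :: "complex \<Rightarrow> int ^ 2 ^ 2 \<Rightarrow> complex \<Rightarrow> complex \<Rightarrow> complex" where
  "jacobi_factor C A z \<tau> \<equiv> C * automorphy A \<tau> powr (1 / 2) * e2pi (- (of_int (A $ 2 $ 1) * z ^ 2 / automorphy A \<tau>))"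

lemma phi_SL2Z_even:
  assumes "A \<in> carrier SL2Z" "even (A $ 2 $ 1)"
  shows "\<exists>\<zeta>. \<zeta> ^ 24 = 1 \<and> (\<forall>z \<tau>. Im \<tau> > 0 \<longrightarrow> phi (z / automorphy A \<tau>) (moebius A \<tau>) =
    jacobi_factor \<zeta> A z \<tau> * phi z \<tau>)"
  using phi_modular[OF SL2Z_det[OF assms(1)] assms(2)]
  unfolding moebius_def automorphy_def e2pi_minus by simp

lemma phi_SL2Z_cusp:
  assumes "A \<in> carrier SL2Z"
  shows "\<exists>C \<kappa> l e. l > 0 \<and> \<kappa> > 0 \<and> (\<forall>z \<tau>. Im \<tau> > 0 \<longrightarrow> phi (z / automorphy A \<tau>) (moebius A \<tau>) =
    jacobi_factor C A z \<tau> * cusp_phi \<kappa> l e z \<tau>)"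
  using phi_at_cusps[OF SL2Z_det[OF assms(1)]]
  unfolding moebius_def automorphy_def e2pi_minus .

lemma principal_congruence_subgroup_even:
  assumes "A \<in> principal_congruence_subgroup N" "even N"
  shows "A \<in> carrier SL2Z" "even (A $ 2 $ 1)"
proof -
  have "2 dvd int N" using assms(2) by simp
  thus "A \<in> carrier SL2Z" "even (A $ 2 $ 1)"
    using assms(1) dvd_trans unfolding principal_congruence_subgroup_iff SL2Z_simps by blast+
qed

lemma powr_cancel:
  assumes "(j :: complex) \<noteq> 0"
  shows "j powr (- (1 / 2)) * j powr (1 / 2) = 1"
  using assms by (simp flip: powr_add)

text \<open>Level 2 makes the lower left entry even, as \<open>phi_modular\<close> requires. The
  index is -1 because theta (2 z) (2 \<tau>), of index 1, stands in the denominator.\<close>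

theorem g2_sum_jacobi_form:
  "meromorphic_jacobi_form (1 / 2) (- 1) (principal_congruence_subgroup 2) (\<lambda>(\<alpha>, \<tau>). g2_sum \<alpha> \<tau>)"
proof -
  let ?\<phi> = "\<lambda>(\<alpha>, \<tau>). g2_sum \<alpha> \<tau>"
  let ?\<Gamma> = "principal_congruence_subgroup 2"
  have reg: "?\<phi> (z, \<tau>) = - 2 * phi z \<tau>" if "regular2_at ?\<phi> (z, \<tau>)" "Im \<tau> > 0" for z \<tau>
    using g2_sum_eq_phi[OF that(2) regular_g2_sum[OF that]] by simp
  have "\<forall>A\<in>?\<Gamma>. \<exists>\<zeta>. \<zeta> ^ 24 = 1 \<and> (\<forall>z \<tau>. Im \<tau> > 0 \<longrightarrow> phi (z / automorphy A \<tau>) (moebius A \<tau>) =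
    jacobi_factor \<zeta> A z \<tau> * phi z \<tau>)"
    using phi_SL2Z_even principal_congruence_subgroup_even[of _ 2] by simp
  then obtain v where v: "\<And>A. A \<in> ?\<Gamma> \<Longrightarrow> v A ^ 24 = 1"
    "\<And>A z \<tau>. A \<in> ?\<Gamma> \<Longrightarrow> Im \<tau> > 0 \<Longrightarrow> phi (z / automorphy A \<tau>) (moebius A \<tau>) =
    jacobi_factor (v A) A z \<tau> * phi z \<tau>"
    by (auto dest!: bchoice)
  have 1: "\<exists>M>0. \<exists>v :: int ^ 2 ^ 2 \<Rightarrow> complex. \<forall>A\<in>?\<Gamma>. v A ^ M = 1 \<and>
        (\<forall>z. \<forall>\<tau>\<in>upper_half_plane.
           regular2_at ?\<phi> (z, \<tau>) \<and> regular2_at ?\<phi> (z / automorphy A \<tau>, moebius A \<tau>) \<longrightarrow>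
           ?\<phi> (z / automorphy A \<tau>, moebius A \<tau>) =
             v A * automorphy A \<tau> powr of_real (1 / 2)
               * e2pi (of_real (- 1) * of_int (A $ 2 $ 1) * z ^ 2 / automorphy A \<tau>) * ?\<phi> (z, \<tau>))"
  proof (rule exI[of _ 24], rule conjI, simp, rule exI[of _ v], intro ballI conjI allI impI)
    fix A assume A: "A \<in> ?\<Gamma>"
    show "v A ^ 24 = 1" by (rule v(1)[OF A])
    fix z \<tau> assume \<tau>: "\<tau> \<in> upper_half_plane"
      and r: "regular2_at ?\<phi> (z, \<tau>) \<and> regular2_at ?\<phi> (z / automorphy A \<tau>, moebius A \<tau>)"
    have \<tau>': "Im \<tau> > 0" using \<tau> by (simp add: upper_half_plane_def)
    have "A \<in> carrier SL2Z" using principal_congruence_subgroup_even[OF A] by simp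
    note r1 = reg[OF conjunct1[OF r] \<tau>'] and r2 = reg[OF conjunct2[OF r] SL2Z_Im_moebius[OF this \<tau>']]
    show "?\<phi> (z / automorphy A \<tau>, moebius A \<tau>) =
             v A * automorphy A \<tau> powr of_real (1 / 2)
               * e2pi (of_real (- 1) * of_int (A $ 2 $ 1) * z ^ 2 / automorphy A \<tau>) * ?\<phi> (z, \<tau>)"
      unfolding r1 r2 v(2)[OF A \<tau>'] by simp
  qed
  have 2: "\<exists>M>0. \<exists>u :: int \<Rightarrow> int \<Rightarrow> complex. \<forall>a b. u a b ^ M = 1 \<and>
        (\<forall>z. \<forall>\<tau>\<in>upper_half_plane.
           regular2_at ?\<phi> (z, \<tau>) \<and> regular2_at ?\<phi> (z + of_int a * \<tau> + of_int b, \<tau>) \<longrightarrow>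
           ?\<phi> (z + of_int a * \<tau> + of_int b, \<tau>) =
             u a b * e2pi (- of_real (- 1) * (of_int a ^ 2 * \<tau> + 2 * of_int a * z)) * ?\<phi> (z, \<tau>))"
  proof (rule exI[of _ 2], rule conjI, simp, rule exI[of _ "\<lambda>a b. (-1) powi a"], intro ballI conjI allI impI)
    fix a b :: int
    show "((-1) powi a) ^ 2 = (1 :: complex)" by (simp add: minus_one_powi)
    fix z \<tau> assume \<tau>: "\<tau> \<in> upper_half_plane"
      and r: "regular2_at ?\<phi> (z, \<tau>) \<and> regular2_at ?\<phi> (z + of_int a * \<tau> + of_int b, \<tau>)"
    have \<tau>': "Im \<tau> > 0" using \<tau> by (simp add: upper_half_plane_def)
    note r1 = reg[OF conjunct1[OF r] \<tau>'] and r2 = reg[OF conjunct2[OF r] \<tau>']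
    show "?\<phi> (z + of_int a * \<tau> + of_int b, \<tau>) =
             (-1) powi a * e2pi (- of_real (- 1) * (of_int a ^ 2 * \<tau> + 2 * of_int a * z)) * ?\<phi> (z, \<tau>)"
      unfolding r1 r2 phi_add_lattice by simp
  qed
  have 3: "\<forall>A\<in>carrier SL2Z. \<exists>N::nat. N > 0 \<and> (\<exists>G. meromorphic2_on G (UNIV \<times> ball 0 1) \<and>
        (\<forall>z. \<forall>\<tau>\<in>upper_half_plane.
           regular2_at ?\<phi> (z / automorphy A \<tau>, moebius A \<tau>) \<longrightarrow>
           automorphy A \<tau> powr of_real (- (1 / 2))
             * e2pi (- of_real (- 1) * of_int (A $ 2 $ 1) * z ^ 2 / automorphy A \<tau>)
             * ?\<phi> (z / automorphy A \<tau>, moebius A \<tau>) = G (z, e2pi (\<tau> / of_nat N))))"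
  proof
    fix A assume A: "A \<in> carrier SL2Z"
    from phi_SL2Z_cusp[OF A] obtain C \<kappa> l e where le: "l > 0" "\<kappa> > 0" and cusp':
      "\<forall>z \<tau>. Im \<tau> > 0 \<longrightarrow> phi (z / automorphy A \<tau>) (moebius A \<tau>) =
        jacobi_factor C A z \<tau> * cusp_phi \<kappa> l e z \<tau>"
      by (elim exE conjE)
    note cusp = cusp'[rule_format]
    define G where "G = (\<lambda>(z, t). (- 2 * C) * cusp_num l e 1 t /
      cusp_den l e 1 (e2pi (of_nat \<kappa> * z / 2)) (e2pi (of_nat \<kappa> * z)) (e2pi (- (of_nat \<kappa> * z))) t)"
    show "\<exists>N::nat. N > 0 \<and> (\<exists>G. meromorphic2_on G (UNIV \<times> ball 0 1) \<and>
        (\<forall>z. \<forall>\<tau>\<in>upper_half_plane.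
           regular2_at ?\<phi> (z / automorphy A \<tau>, moebius A \<tau>) \<longrightarrow>
           automorphy A \<tau> powr of_real (- (1 / 2))
             * e2pi (- of_real (- 1) * of_int (A $ 2 $ 1) * z ^ 2 / automorphy A \<tau>)
             * ?\<phi> (z / automorphy A \<tau>, moebius A \<tau>) = G (z, e2pi (\<tau> / of_nat N))))"
    proof (rule exI[of _ 48], rule conjI, simp, rule exI[of _ G], intro conjI ballI allI impI)
      show "meromorphic2_on G (UNIV \<times> ball 0 1)" unfolding G_def by (rule jacobi_cusp[OF le])
      fix z \<tau> assume \<tau>: "\<tau> \<in> upper_half_plane"
        and r: "regular2_at ?\<phi> (z / automorphy A \<tau>, moebius A \<tau>)"
      have \<tau>': "Im \<tau> > 0" using \<tau> by (simp add: upper_half_plane_def)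
      define j where "j = automorphy A \<tau>"
      define E where "E = of_int (A $ 2 $ 1) * z ^ 2 / j"
      have j: "j \<noteq> 0" unfolding j_def by (rule SL2Z_automorphy_nonzero[OF A \<tau>'])
      have "?\<phi> (z / j, moebius A \<tau>) = - 2 * (C * j powr (1 / 2) * e2pi (- E) * cusp_phi \<kappa> l e z \<tau>)"
        using reg[OF r SL2Z_Im_moebius[OF A \<tau>']] cusp[OF \<tau>', of z] unfolding j_def E_def by simp
      hence "j powr (- (1 / 2)) * e2pi E * ?\<phi> (z / j, moebius A \<tau>) =
        (- 2 * C) * (j powr (- (1 / 2)) * j powr (1 / 2)) * (e2pi E * e2pi (- E)) * cusp_phi \<kappa> l e z \<tau>"
        by (simp only: mult_ac)
      also have "e2pi E * e2pi (- E) = 1" by (simp add: e2pi_minus)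
      also have "(- 2 * C) * (j powr (- (1 / 2)) * j powr (1 / 2)) * 1 * cusp_phi \<kappa> l e z \<tau> = G (z, e2pi (\<tau> / of_nat 48))"
        unfolding powr_cancel[OF j] G_def using cusp_phi_expansion[OF \<tau>' le(1), of 1 \<kappa> e z] by simp
      finally show "automorphy A \<tau> powr of_real (- (1 / 2))
             * e2pi (- of_real (- 1) * of_int (A $ 2 $ 1) * z ^ 2 / automorphy A \<tau>)
             * ?\<phi> (z / automorphy A \<tau>, moebius A \<tau>) = G (z, e2pi (\<tau> / of_nat 48))"
        unfolding E_def j_def by simp
    qed
  qed
  show ?thesis unfolding meromorphic_jacobi_form_def
    using g2_sum_meromorphic2 1 2 3 by blast
qed

subsection \<open>Rational points\<close>

text \<open>If m < 0 the argument of the product has a pole at t = 0. Finitely many factors, each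
  meromorphic, are split off until the remaining argument has a nonnegative exponent and the rest of
  the product is holomorphic near 0.\<close>

lemma qinf_meromorphic:
  fixes f g :: "complex \<Rightarrow> complex"
  assumes "\<And>t. t \<noteq> 0 \<Longrightarrow> f t = X * t powi m" "\<And>t. g t = \<epsilon> * t ^ L" "L > 0" "norm \<epsilon> = 1"
  shows "(\<lambda>t. qinf (f t) (g t)) meromorphic_on {0}"
proof -
  \<comment> \<open>Each factor split off raises the exponent by L \<ge> 1, so |m| of them
    suffice.\<close>
  define n where "n = nat \<bar>m\<bar>"
  define K where "K = nat (m + int L * int n)"
  have K: "int K = m + int L * int n"
  proof -
    have "int L * int n \<ge> 1 * int n" using assms(3) by (intro mult_right_mono) auto
    thus ?thesis unfolding K_def n_def by simp
  qed
  define F where "F = (\<lambda>t. qpoch (X * t powi m) (\<epsilon> * t ^ L) n * qinf (X * \<epsilon> ^ n * t ^ K) (\<epsilon> * t ^ L))"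
  have small: "norm (\<epsilon> * t ^ L) < 1" if "norm t < 1" for t
    using that assms(3,4) by (simp add: norm_mult norm_power power_less_one_iff)
  have "(\<lambda>t. qinf (X * \<epsilon> ^ n * t ^ K) (\<epsilon> * t ^ L)) holomorphic_on ball 0 1"
  proof (rule holomorphic_onI)
    fix t :: complex assume t: "t \<in> ball 0 1"
    have "hd2 (\<lambda>p. qinf (X * \<epsilon> ^ n * snd p ^ K) (\<epsilon> * snd p ^ L)) (0, t)"
      by (intro qinf_comp_hd2 hd2_mult hd2_const hd2_power hd2_snd) (use small t in simp)
    from hd2_imp_field_differentiable(2)[OF this]
    show "(\<lambda>t. qinf (X * \<epsilon> ^ n * t ^ K) (\<epsilon> * t ^ L)) field_differentiable at t within ball 0 1"
      by (simp add: field_differentiable_at_within)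
  qed
  hence "(\<lambda>t. qinf (X * \<epsilon> ^ n * t ^ K) (\<epsilon> * t ^ L)) analytic_on {0}"
    unfolding analytic_on_def by (auto intro!: exI[of _ 1])
  hence "(\<lambda>t. qinf (X * \<epsilon> ^ n * t ^ K) (\<epsilon> * t ^ L)) meromorphic_on {0}"
    by (rule analytic_on_imp_meromorphic_on)
  hence "F meromorphic_on {0}"
    unfolding F_def qpoch_def by (intro meromorphic_intros)
  moreover have "eventually (\<lambda>t. F t = qinf (f t) (g t)) (at 0)"
    unfolding eventually_at
  proof (intro exI[of _ 1] conjI ballI impI)
    fix t :: complex assume "t \<noteq> 0 \<and> dist t 0 < 1"
    hence t: "t \<noteq> 0" "norm t < 1" by auto
    have "X * t powi m * (\<epsilon> * t ^ L) ^ n = X * \<epsilon> ^ n * t powi int K"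
      unfolding K power_mult_distrib using t(1)
      by (simp add: power_int_add power_mult power_int_mult mult_ac)
    hence e: "X * t powi m * (\<epsilon> * t ^ L) ^ n = X * \<epsilon> ^ n * t ^ K" by simp
    show "F t = qinf (f t) (g t)"
      unfolding F_def assms(2) assms(1)[OF t(1)] e[symmetric]
      by (rule qinf_split[OF small[OF t(2)], symmetric])
  qed auto
  ultimately show ?thesis
    using meromorphic_on_cong[of "{0}" F "\<lambda>t. qinf (f t) (g t)" "{0}"] by auto
qed

lemma e2pi_powi: "e2pi z powi n = e2pi (of_int n * z)"
proof (cases n)
  case (nonneg k)
  thus ?thesis by (simp add: e2pi_power)
next
  case (neg k)
  have "of_int n = - (of_nat (Suc k) :: complex)" using neg by simp
  hence "e2pi (of_int n * z) = 1 / e2pi z ^ Suc k"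
    by (simp only: e2pi_power e2pi_minus[symmetric] mult_minus_left)
  thus ?thesis unfolding neg power_int_minus by (simp add: field_simps del: of_nat_Suc)
qed

lemma cusp_meromorphic:
  assumes "l > 0" "w > 0"
  shows "(\<lambda>t. cusp_num l e w t / cusp_den l e w (c * t powi m) (X * t powi k) (Y * t powi (- k)) t) meromorphic_on {0}"
proof -
  define \<epsilon> where "\<epsilon> = e2pi (of_nat e / 2)"
  have \<epsilon>: "norm \<epsilon> = 1" by (simp add: \<epsilon>_def norm_e2pi)
  define L where "L = 24 * l * w"
  have L: "L > 0" using assms by (simp add: L_def)
  have 1: "(\<lambda>t. qinf (\<epsilon> * t ^ L) (\<epsilon> * t ^ L)) meromorphic_on {0}"
    by (rule qinf_meromorphic[where X = \<epsilon> and m = "int L", OF _ refl L \<epsilon>]) simp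
  have 2: "(\<lambda>t. qinf (t ^ (48 * w)) (t ^ (48 * w))) meromorphic_on {0}"
    by (rule qinf_meromorphic[where X = 1 and m = "int (48 * w)" and \<epsilon> = 1 and L = "48 * w"]) (use assms in \<open>auto simp del: of_nat_mult\<close>)
  have 3: "(\<lambda>t. qinf (X * t powi k * (\<epsilon> * t ^ L)) (\<epsilon> * t ^ L)) meromorphic_on {0}"
    by (rule qinf_meromorphic[where X = "X * \<epsilon>" and m = "k + int L", OF _ refl L \<epsilon>]) (simp add: power_int_add)
  have 4: "(\<lambda>t. qinf (Y * t powi (- k)) (\<epsilon> * t ^ L)) meromorphic_on {0}"
    by (rule qinf_meromorphic[OF refl refl L \<epsilon>])
  show ?thesis
    unfolding cusp_num_def cusp_den_def Let_def \<epsilon>_def[symmetric] L_def[symmetric]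
    by (intro meromorphic_intros 1 2 3 4)
qed

lemma rat_common_denominator:
  fixes r s :: rat
  obtains D :: nat and p k :: int where "D > 0" "r = of_int p / of_nat D" "s = of_int k / of_nat D"
proof -
  obtain a b where r: "r = Fract a b" "b > 0" by (cases r) auto
  obtain a' b' where s: "s = Fract a' b'" "b' > 0" by (cases s) auto
  show thesis
  proof (rule that[of "nat (b * b')" "a * b'" "a' * b"])
    show "nat (b * b') > 0" using r s by simp
    have "of_nat (nat (b * b')) = (of_int (b * b') :: rat)" using r s by (simp add: of_nat_nat)
    thus "r = of_int (a * b') / of_nat (nat (b * b'))" "s = of_int (a' * b) / of_nat (nat (b * b'))"
      using r s by (simp_all add: Fract_of_int_quotient)
  qed
qed

text \<open>1 and \<tau> are linearly independent over the reals, so a zero forces equality of both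
  coordinates, that is r in Z and 2 s in Z.\<close>

lemma theta2_rational_point_nonzero:
  fixes p k :: int and D :: nat
  assumes "Im \<tau> > 0" "D > 0"
    "\<not> ((of_int p / of_nat D :: rat) \<in> \<int> \<and> 2 * (of_int k / of_nat D :: rat) \<in> \<int>)"
  shows "theta (2 * (of_int p / of_nat D * \<tau> + of_int k / of_nat D)) (2 * \<tau>) \<noteq> 0"
proof
  assume "theta (2 * (of_int p / of_nat D * \<tau> + of_int k / of_nat D)) (2 * \<tau>) = 0"
  then obtain m n :: int where mn: "2 * (of_int p / of_nat D * \<tau> + of_int k / of_nat D) = 2 * of_int n * \<tau> + of_int m"
    unfolding theta2_eq_0_iff[OF assms(1)] by blast
  have D: "(of_nat D :: complex) \<noteq> 0" using assms(2) by simp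
  have "of_int (2 * p) * \<tau> + of_int (2 * k) = of_nat D * (2 * (of_int p / of_nat D * \<tau> + of_int k / of_nat D))"
    using D by (simp add: field_simps)
  also have "\<dots> = of_int (2 * n * int D) * \<tau> + of_int (m * int D)"
    unfolding mn by (simp add: algebra_simps)
  finally have e: "of_int (2 * p) * \<tau> + of_int (2 * k) = of_int (2 * n * int D) * \<tau> + of_int (m * int D)" .
  have "Im (of_int (2 * p) * \<tau> + of_int (2 * k)) = Im (of_int (2 * n * int D) * \<tau> + of_int (m * int D))"
    by (simp only: e)
  hence "of_int (2 * p) * Im \<tau> = of_int (2 * n * int D) * Im \<tau>"
    by (simp del: of_int_mult)
  hence "(of_int (2 * p) :: real) = of_int (2 * n * int D)"
    using assms(1) by (simp only: mult_right_cancel[of "Im \<tau>"])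
  hence p: "2 * p = 2 * n * int D" by (simp only: of_int_eq_iff)
  hence "(of_int (2 * k) :: complex) = of_int (m * int D)" using e by (simp only: add_left_cancel)
  hence k: "2 * k = m * int D" by (simp only: of_int_eq_iff)
  have "(of_int p / of_nat D :: rat) = of_int n"
    using assms(2) p by (simp add: field_simps)
  moreover have "2 * (of_int k / of_nat D :: rat) = of_int m"
  proof -
    have "(of_int (2 * k) :: rat) = of_int (m * int D)" using k by (simp only:)
    thus ?thesis using assms(2) by (simp add: field_simps)
  qed
  ultimately show False using assms(3) by (metis Ints_of_int)
qed

text \<open>The reason for the factor q^(- r^2): (X, Y) is the row vector (R, S) times the matrix,
  and the term c z^2 / (c \<tau> + d) of the Jacobi law combines with - R^2 times the transformed
  variable to - X^2 \<tau> plus a constant. The same kind of function reappears at the transformed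
  point.\<close>

lemma slash_exponent:
  fixes R S X Y a b c d \<tau> :: complex
  assumes "a * d - b * c = 1" "X = R * a + S * c" "Y = R * b + S * d" "c * \<tau> + d \<noteq> 0"
  shows "(X * \<tau> + Y) / (c * \<tau> + d) = R * ((a * \<tau> + b) / (c * \<tau> + d)) + S"
    "- (R ^ 2) * ((a * \<tau> + b) / (c * \<tau> + d)) + - (c * (X * \<tau> + Y) ^ 2 / (c * \<tau> + d)) =
      - (X ^ 2) * \<tau> + (R * S - X * Y)"
proof -
  define j where "j = c * \<tau> + d"
  have j: "j \<noteq> 0" using assms(4) by (simp add: j_def)
  have "X * \<tau> + Y = R * (a * \<tau> + b) + S * j"
    unfolding assms(2,3) j_def by (simp add: algebra_simps)
  thus "(X * \<tau> + Y) / (c * \<tau> + d) = R * ((a * \<tau> + b) / (c * \<tau> + d)) + S"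
    unfolding j_def[symmetric] using j by (simp add: field_simps)
  have "R ^ 2 * (a * \<tau> + b) + c * (X * \<tau> + Y) ^ 2 = (X ^ 2 * \<tau> + X * Y - R * S) * j"
  proof -
    have RX: "X * d - c * Y = R"
    proof -
      have "X * d - c * Y = R * (a * d - b * c)" unfolding assms(2,3) by (simp add: algebra_simps)
      thus ?thesis using assms(1) by simp
    qed
    have "(X ^ 2 * \<tau> + X * Y - R * S) * j - c * (X * \<tau> + Y) ^ 2 = \<tau> * (X * (X * d - c * Y) - R * (S * c)) + (Y * (X * d - c * Y) - R * (S * d))"
      unfolding j_def by (simp add: algebra_simps power2_eq_square)
    also have "\<dots> = R * (\<tau> * (X - S * c) + (Y - S * d))" unfolding RX by (simp add: algebra_simps)
    also have "\<dots> = R ^ 2 * (a * \<tau> + b)" unfolding assms(2,3) by (simp add: algebra_simps power2_eq_square)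
    finally show ?thesis by (simp add: algebra_simps)
  qed
  hence "(R ^ 2 * (a * \<tau> + b) + c * (X * \<tau> + Y) ^ 2) / j = X ^ 2 * \<tau> + X * Y - R * S"
    using j by simp
  thus "- (R ^ 2) * ((a * \<tau> + b) / (c * \<tau> + d)) + - (c * (X * \<tau> + Y) ^ 2 / (c * \<tau> + d)) =
      - (X ^ 2) * \<tau> + (R * S - X * Y)"
    unfolding j_def[symmetric] by (simp add: algebra_simps add_divide_distrib)
qed

text \<open>In the level 2 * D, the factor 2 serves \<open>phi_modular\<close>, and D ensures that
  the matrix changes (R, S) only by integers, which \<open>phi_add_lattice\<close> undoes.\<close>

theorem g2_sum_at_rational_point:
  fixes p k :: int and D :: nat
  assumes D: "D > 0"
    and nonpole: "\<not> ((of_int p / of_nat D :: rat) \<in> \<int> \<and> 2 * (of_int k / of_nat D :: rat) \<in> \<int>)"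
  defines "R \<equiv> of_int p / of_nat D :: complex" and "S \<equiv> of_int k / of_nat D :: complex"
  shows "weakly_holomorphic_modular_form (1 / 2) (principal_congruence_subgroup (2 * D))
    (\<lambda>\<tau>. e2pi (- (R ^ 2) * \<tau>) * g2_sum (R * \<tau> + S) \<tau>)"
proof -
  define f where "f = (\<lambda>\<tau>. e2pi (- (R ^ 2) * \<tau>) * g2_sum (R * \<tau> + S) \<tau>)"
  have D0: "(of_nat D :: complex) \<noteq> 0" using D by simp
  have th: "theta (2 * (R * \<tau> + S)) (2 * \<tau>) \<noteq> 0" if "Im \<tau> > 0" for \<tau>
    unfolding R_def S_def by (rule theta2_rational_point_nonzero[OF that D nonpole])
  have f: "f \<tau> = - 2 * (e2pi (- (R ^ 2) * \<tau>) * phi (R * \<tau> + S) \<tau>)" if "Im \<tau> > 0" for \<tau>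
    unfolding f_def g2_sum_eq_phi[OF that th[OF that]] by simp
  have hol: "f holomorphic_on upper_half_plane"
  proof -
    define P where "P = (\<lambda>\<tau>. - 2 * (e2pi (- (R ^ 2) * \<tau>) * eta (2 * \<tau>) ^ 4))"
    define Q where "Q = (\<lambda>\<tau>. eta \<tau> ^ 2 * theta (2 * (R * \<tau> + S)) (2 * \<tau>))"
    have "(\<lambda>\<tau>. P \<tau> / Q \<tau>) holomorphic_on upper_half_plane"
    proof (rule holomorphic_onI)
      fix \<tau> assume "\<tau> \<in> upper_half_plane"
      hence \<tau>: "Im \<tau> > 0" by (simp add: upper_half_plane_def)
      have "hd2 (\<lambda>p. - 2 * (e2pi (- (R ^ 2) * snd p) * eta (2 * snd p) ^ 4)) (0, \<tau>)"
        by (intro hd2_mult hd2_const hd2_e2pi hd2_power eta_hd2 hd2_snd) (use \<tau> in simp)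
      hence 1: "P field_differentiable at \<tau>"
        using hd2_imp_field_differentiable(2) unfolding P_def by fastforce
      have "hd2 (\<lambda>p. eta (snd p) ^ 2 * theta (2 * (R * snd p + S)) (2 * snd p)) (0, \<tau>)"
        by (intro hd2_mult hd2_add hd2_const hd2_power eta_hd2 theta_hd2 hd2_snd) (use \<tau> in simp_all)
      hence 2: "Q field_differentiable at \<tau>"
        using hd2_imp_field_differentiable(2) unfolding Q_def by fastforce
      have "Q \<tau> \<noteq> 0" using eta_nonzero[OF \<tau>] th[OF \<tau>] by (simp add: Q_def)
      from field_differentiable_divide[OF 1 2 this]
      show "(\<lambda>\<tau>. P \<tau> / Q \<tau>) field_differentiable at \<tau> within upper_half_plane"
        by (rule field_differentiable_at_within)
    qed
    thus ?thesis
      by (rule holomorphic_transform) (auto simp: upper_half_plane_def f phi_def P_def Q_def)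
  qed
  \<comment> \<open>The row vector (R, S) times A; the function at the transformed \<tau> is
    expressed through the point R' \<tau> + S'.\<close>
  define R' S' :: "int ^ 2 ^ 2 \<Rightarrow> complex" where
    "R' = (\<lambda>A. of_int (p * A $ 1 $ 1 + k * A $ 2 $ 1) / of_nat D)" and
    "S' = (\<lambda>A. of_int (p * A $ 1 $ 2 + k * A $ 2 $ 2) / of_nat D)"
  have f_slash: "f (moebius A \<tau>) = - 2 * C * automorphy A \<tau> powr (1 / 2) *
      e2pi (- (R' A ^ 2) * \<tau> + (R * S - R' A * S' A)) * h"
    if A: "A \<in> carrier SL2Z" and \<tau>: "Im \<tau> > 0" and
      phi: "phi ((R' A * \<tau> + S' A) / automorphy A \<tau>) (moebius A \<tau>) =
        jacobi_factor C A (R' A * \<tau> + S' A) \<tau> * h"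
    for A \<tau> C h
  proof -
    have det: "of_int (A $ 1 $ 1) * of_int (A $ 2 $ 2) - of_int (A $ 1 $ 2) * of_int (A $ 2 $ 1) = (1 :: complex)"
      using SL2Z_det[OF A] by (simp flip: of_int_mult of_int_diff)
    have RS: "R' A = R * of_int (A $ 1 $ 1) + S * of_int (A $ 2 $ 1)"
      "S' A = R * of_int (A $ 1 $ 2) + S * of_int (A $ 2 $ 2)"
      unfolding R'_def S'_def R_def S_def by (simp_all add: add_divide_distrib)
    note se = slash_exponent[OF det RS, folded automorphy_def, OF SL2Z_automorphy_nonzero[OF A \<tau>], folded moebius_def]
    have "f (moebius A \<tau>) = - 2 * C * automorphy A \<tau> powr (1 / 2) * (e2pi (- (R ^ 2) * moebius A \<tau>) *
       e2pi (- (of_int (A $ 2 $ 1) * (R' A * \<tau> + S' A) ^ 2 / automorphy A \<tau>))) * h"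
      unfolding f[OF SL2Z_Im_moebius[OF A \<tau>]] se(1)[symmetric] phi by (simp only: mult_ac)
    thus ?thesis unfolding e2pi_add[symmetric] se(2) .
  qed
  have law: "\<exists>\<xi>. \<xi> ^ (24 * D ^ 2) = 1 \<and> (\<forall>\<tau>\<in>upper_half_plane.
      f (moebius A \<tau>) = \<xi> * automorphy A \<tau> powr of_real (1 / 2) * f \<tau>)"
    if A: "A \<in> principal_congruence_subgroup (2 * D)" for A
  proof -
    have AS: "A \<in> carrier SL2Z" "even (A $ 2 $ 1)"
      using principal_congruence_subgroup_even[OF A] by auto
    have "int D dvd A $ 1 $ 1 - 1" "int D dvd A $ 1 $ 2" "int D dvd A $ 2 $ 1" "int D dvd A $ 2 $ 2 - 1"
      using A dvd_trans[of "int D" "int (2 * D)"] unfolding principal_congruence_subgroup_iff by auto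
    hence "int D dvd p * (A $ 1 $ 1 - 1) + k * A $ 2 $ 1" "int D dvd p * A $ 1 $ 2 + k * (A $ 2 $ 2 - 1)"
      by (simp_all add: dvd_add dvd_mult)
    then obtain m n where mn: "p * (A $ 1 $ 1 - 1) + k * A $ 2 $ 1 = int D * m"
      "p * A $ 1 $ 2 + k * (A $ 2 $ 2 - 1) = int D * n" unfolding dvd_def by blast
    have pk: "p * A $ 1 $ 1 + k * A $ 2 $ 1 = p + int D * m" "p * A $ 1 $ 2 + k * A $ 2 $ 2 = k + int D * n"
      unfolding mn[symmetric] by (simp_all add: right_diff_distrib)
    have R': "R' A = R + of_int m" "S' A = S + of_int n"
      unfolding R'_def S'_def pk R_def S_def using D0 by (simp_all add: add_divide_distrib)
    obtain \<zeta> where \<zeta>: "\<zeta> ^ 24 = 1" "\<And>z \<tau>. Im \<tau> > 0 \<Longrightarrow> phi (z / automorphy A \<tau>) (moebius A \<tau>) =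
        jacobi_factor \<zeta> A z \<tau> * phi z \<tau>"
      using phi_SL2Z_even[OF AS] by blast
    \<comment> \<open>All constant phases together: R S - R' S' from \<open>slash_exponent\<close>
      and 2 m S from the lattice translation. Since R and S have denominator D, D^2 X is an integer,
      hence the order 24 D^2.\<close>
    define X where "X = R * S - R' A * S' A + 2 * of_int m * S"
    show ?thesis
    proof (intro exI[of _ "\<zeta> * (-1) powi m * e2pi X"] conjI ballI)
      have "of_nat (D ^ 2) * X = of_int (p * k - (p + int D * m) * (k + int D * n) + 2 * m * int D * k)"
        unfolding X_def R' R_def S_def using D0 by (simp add: field_simps power2_eq_square)
      moreover have "of_nat (24 * D ^ 2) * X = of_int 24 * (of_nat (D ^ 2) * X)" by simp
      ultimately have "of_nat (24 * D ^ 2) * X = of_int (24 * (p * k - (p + int D * m) * (k + int D * n) + 2 * m * int D * k))"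
        by (simp only: of_int_mult)
      hence "e2pi X ^ (24 * D ^ 2) = 1" unfolding e2pi_power by (simp only: e2pi_of_int)
      moreover have "((-1) powi m) ^ (24 * D ^ 2) = (1 :: complex)" by (simp add: minus_one_powi)
      moreover have "\<zeta> ^ (24 * D ^ 2) = 1" unfolding power_mult \<zeta>(1) by simp
      ultimately show "(\<zeta> * (-1) powi m * e2pi X) ^ (24 * D ^ 2) = 1"
        unfolding power_mult_distrib by simp
      fix \<tau> assume "\<tau> \<in> upper_half_plane"
      hence \<tau>: "Im \<tau> > 0" by (simp add: upper_half_plane_def)
      define z where "z = R * \<tau> + S"
      have z: "R' A * \<tau> + S' A = z + of_int m * \<tau> + of_int n" unfolding R' z_def by (simp add: algebra_simps)
      have "f (moebius A \<tau>) = - 2 * \<zeta> * automorphy A \<tau> powr (1 / 2) *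
          e2pi (- (R' A ^ 2) * \<tau> + (R * S - R' A * S' A)) * phi (R' A * \<tau> + S' A) \<tau>"
        by (rule f_slash[OF AS(1) \<tau> \<zeta>(2)[OF \<tau>]])
      also have "\<dots> = - 2 * (\<zeta> * (-1) powi m) * automorphy A \<tau> powr (1 / 2) *
          (e2pi (- (R' A ^ 2) * \<tau> + (R * S - R' A * S' A)) * e2pi (of_int m ^ 2 * \<tau> + 2 * of_int m * z)) * phi z \<tau>"
        unfolding z phi_add_lattice by (simp only: mult_ac)
      also have "e2pi (- (R' A ^ 2) * \<tau> + (R * S - R' A * S' A)) * e2pi (of_int m ^ 2 * \<tau> + 2 * of_int m * z) =
          e2pi X * e2pi (- (R ^ 2) * \<tau>)"
        unfolding e2pi_add[symmetric] X_def z_def R'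
        by (rule arg_cong[where f = e2pi]) (simp add: algebra_simps power2_eq_square)
      finally show "f (moebius A \<tau>) = \<zeta> * (-1) powi m * e2pi X * automorphy A \<tau> powr of_real (1 / 2) * f \<tau>"
        unfolding f[OF \<tau>] z_def by simp
    qed
  qed
  have "\<forall>A\<in>principal_congruence_subgroup (2 * D). \<exists>\<xi>. \<xi> ^ (24 * D ^ 2) = 1 \<and> (\<forall>\<tau>\<in>upper_half_plane.
      f (moebius A \<tau>) = \<xi> * automorphy A \<tau> powr of_real (1 / 2) * f \<tau>)"
    using law by blast
  from bchoice[OF this] have multiplier: "\<exists>M>0. \<exists>v :: int ^ 2 ^ 2 \<Rightarrow> complex.
      \<forall>A\<in>principal_congruence_subgroup (2 * D). v A ^ M = 1 \<and>
        (\<forall>\<tau>\<in>upper_half_plane. f (moebius A \<tau>) = v A * automorphy A \<tau> powr of_real (1 / 2) * f \<tau>)"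
    using D by (intro exI[of _ "24 * D ^ 2"]) simp
  have cusps: "\<exists>N::nat. N > 0 \<and> (\<exists>g. g meromorphic_on {0} \<and>
        (\<forall>\<tau>\<in>upper_half_plane. automorphy A \<tau> powr of_real (- (1 / 2)) * f (moebius A \<tau>) = g (e2pi (\<tau> / of_nat N))))"
    if A: "A \<in> carrier SL2Z" for A
  proof -
    from phi_SL2Z_cusp[OF A] obtain C \<kappa> l e where le: "l > 0" "\<kappa> > 0" and cusp':
      "\<forall>z \<tau>. Im \<tau> > 0 \<longrightarrow> phi (z / automorphy A \<tau>) (moebius A \<tau>) =
        jacobi_factor C A z \<tau> * cusp_phi \<kappa> l e z \<tau>"
      by (elim exE conjE)
    note cusp = cusp'[rule_format]
    \<comment> \<open>The exponent R'^2 has denominator D^2, so t = e2pi (\<tau> / (48 D^2)) turns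
      every power of q that occurs into an integral power of t.\<close>
    define w where "w = D ^ 2"
    have w: "w > 0" using D by (simp add: w_def)
    define p' where "p' = p * A $ 1 $ 1 + k * A $ 2 $ 1"
    define M where "M = 48 * int D * int \<kappa> * p'"
    define M2 where "M2 = 24 * int D * int \<kappa> * p'"
    define Z where "Z = of_nat \<kappa> * S' A"
    define g where "g = (\<lambda>t. - 2 * C * e2pi (R * S - R' A * S' A) * t powi (- 48 * p' ^ 2) *
      (cusp_num l e w t / cusp_den l e w (e2pi (Z / 2) * t powi M2) (e2pi Z * t powi M) (e2pi (- Z) * t powi (- M)) t))"
    have "g meromorphic_on {0}"
      unfolding g_def by (intro meromorphic_intros cusp_meromorphic le w)
    moreover have "automorphy A \<tau> powr of_real (- (1 / 2)) * f (moebius A \<tau>) = g (e2pi (\<tau> / of_nat (48 * w)))"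
      if "\<tau> \<in> upper_half_plane" for \<tau>
    proof -
      have \<tau>: "Im \<tau> > 0" using that by (simp add: upper_half_plane_def)
      define t where "t = e2pi (\<tau> / of_nat (48 * w))"
      define z where "z = R' A * \<tau> + S' A"
      have t: "t powi n = e2pi (of_int n * \<tau> / (48 * of_nat D ^ 2))" for n
        unfolding t_def e2pi_powi w_def by simp
      have R': "R' A = of_int p' / of_nat D" by (simp add: R'_def p'_def)
      have t1: "t powi (- 48 * p' ^ 2) = e2pi (- (R' A ^ 2) * \<tau>)"
        unfolding t R' using D0 by (intro arg_cong[where f = e2pi]) (simp add: field_simps)
      have t2: "e2pi Z * t powi M = e2pi (of_nat \<kappa> * z)"
        unfolding t e2pi_add[symmetric] z_def Z_def R' M_def using D0
        by (intro arg_cong[where f = e2pi]) (simp add: field_simps power2_eq_square)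
      have t3: "e2pi (Z / 2) * t powi M2 = e2pi (of_nat \<kappa> * z / 2)"
        unfolding t e2pi_add[symmetric] z_def Z_def R' M2_def using D0
        by (intro arg_cong[where f = e2pi]) (simp add: field_simps power2_eq_square)
      have t4: "e2pi (- Z) * t powi (- M) = e2pi (- (of_nat \<kappa> * z))"
        unfolding e2pi_minus t2[symmetric] power_int_minus by (simp add: field_simps)
      define j where "j = automorphy A \<tau>"
      have j: "j \<noteq> 0" unfolding j_def by (rule SL2Z_automorphy_nonzero[OF A \<tau>])
      have fA: "f (moebius A \<tau>) = - 2 * C * j powr (1 / 2) *
          e2pi (- (R' A ^ 2) * \<tau> + (R * S - R' A * S' A)) * cusp_phi \<kappa> l e z \<tau>"
        unfolding j_def z_def by (rule f_slash[OF A \<tau> cusp[OF \<tau>]])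
      have "j powr (- (1 / 2)) * f (moebius A \<tau>) = (j powr (- (1 / 2)) * j powr (1 / 2)) *
          (- 2 * C * e2pi (R * S - R' A * S' A) * e2pi (- (R' A ^ 2) * \<tau>) * cusp_phi \<kappa> l e z \<tau>)"
        unfolding fA e2pi_add by (simp only: mult_ac)
      also have "\<dots> = g t"
        unfolding powr_cancel[OF j] g_def t1 t2 t3 t4
        using cusp_phi_expansion[OF \<tau> le(1) w, of \<kappa> e z] unfolding t_def by simp
      finally show ?thesis unfolding j_def t_def by simp
    qed
    moreover have "48 * w > 0" using w by simp
    ultimately show ?thesis by blast
  qed
  show ?thesis
    unfolding weakly_holomorphic_modular_form_def f_def[symmetric]
    using hol multiplier cusps by blast
qed

text \<open>At points with 2 \<alpha> in 2 Z \<tau> + Z, such as \<alpha> = 1/2 or \<alpha> =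
  \<tau>, equality of HOL values would have no content, so there the identity is replaced by the
  statement that both sides have a pole. The rational pairs with r in Z and 2 s in Z are those for
  which r \<tau> + s is such a point for every \<tau>; for all other pairs no \<tau> in the
  half-plane gives a pole.\<close>

theorem theorem1p2:
  shows
    "(\<forall>\<tau> \<alpha> :: complex. Im \<tau> > 0 \<longrightarrow> (\<forall>m n :: int. \<alpha> \<noteq> 2 * of_int n * \<tau> + of_int m) \<longrightarrow>
        (if \<exists>m n :: int. 2 * \<alpha> = 2 * of_int n * \<tau> + of_int m
         then is_pole (\<lambda>\<beta>. e2pi \<beta> * (g2 (e2pi \<beta>) (e2pi \<tau>) + g2 (- e2pi \<beta>) (e2pi \<tau>))) \<alpha> \<and>
              is_pole (\<lambda>\<beta>. - 2 * eta (2 * \<tau>) ^ 4 / (eta \<tau> ^ 2 * theta (2 * \<beta>) (2 * \<tau>))) \<alpha>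
         else e2pi \<alpha> * (g2 (e2pi \<alpha>) (e2pi \<tau>) + g2 (- e2pi \<alpha>) (e2pi \<tau>)) =
              - 2 * eta (2 * \<tau>) ^ 4 / (eta \<tau> ^ 2 * theta (2 * \<alpha>) (2 * \<tau>)))) \<and>
     (\<exists>\<Gamma>. congruence_subgroup \<Gamma> \<and>
        meromorphic_jacobi_form (1 / 2) (- 1) \<Gamma> (\<lambda>(\<alpha>, \<tau>). g2_sum \<alpha> \<tau>)) \<and>
     (\<forall>r s :: rat. \<not> (r \<in> \<int> \<and> 2 * s \<in> \<int>) \<longrightarrow>
        (\<exists>\<Gamma>. congruence_subgroup \<Gamma> \<and>
           weakly_holomorphic_modular_form (1 / 2) \<Gamma>
             (\<lambda>\<tau>. e2pi (- (of_rat r ^ 2) * \<tau>) * g2_sum (of_rat r * \<tau> + of_rat s) \<tau>)))"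
proof (intro conjI allI impI)
  fix \<tau> \<alpha> :: complex assume \<tau>: "Im \<tau> > 0"
  have phi: "- 2 * phi \<beta> \<tau> = - 2 * eta (2 * \<tau>) ^ 4 / (eta \<tau> ^ 2 * theta (2 * \<beta>) (2 * \<tau>))" for \<beta>
    by (simp add: phi_def)
  show "if \<exists>m n :: int. 2 * \<alpha> = 2 * of_int n * \<tau> + of_int m
         then is_pole (\<lambda>\<beta>. e2pi \<beta> * (g2 (e2pi \<beta>) (e2pi \<tau>) + g2 (- e2pi \<beta>) (e2pi \<tau>))) \<alpha> \<and>
              is_pole (\<lambda>\<beta>. - 2 * eta (2 * \<tau>) ^ 4 / (eta \<tau> ^ 2 * theta (2 * \<beta>) (2 * \<tau>))) \<alpha>
         else e2pi \<alpha> * (g2 (e2pi \<alpha>) (e2pi \<tau>) + g2 (- e2pi \<alpha>) (e2pi \<tau>)) =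
              - 2 * eta (2 * \<tau>) ^ 4 / (eta \<tau> ^ 2 * theta (2 * \<alpha>) (2 * \<tau>))"
    unfolding theta2_eq_0_iff[OF \<tau>, symmetric] phi[symmetric] g2_sum_def[symmetric]
    using g2_sum_is_pole[OF \<tau>, of \<alpha>] phi_is_pole[OF \<tau>, of \<alpha>] g2_sum_eq_phi[OF \<tau>, of \<alpha>] by presburger
next
  show "\<exists>\<Gamma>. congruence_subgroup \<Gamma> \<and> meromorphic_jacobi_form (1 / 2) (- 1) \<Gamma> (\<lambda>(\<alpha>, \<tau>). g2_sum \<alpha> \<tau>)"
    using principal_congruence_subgroup_congruence[of 2] g2_sum_jacobi_form by auto
next
  fix r s :: rat assume rs: "\<not> (r \<in> \<int> \<and> 2 * s \<in> \<int>)"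
  obtain D :: nat and p k :: int where D: "D > 0" and r: "r = of_int p / of_nat D" and s: "s = of_int k / of_nat D"
    by (rule rat_common_denominator)
  have e: "of_rat r = (of_int p / of_nat D :: complex)" "of_rat s = (of_int k / of_nat D :: complex)"
    unfolding r s by (simp_all add: of_rat_divide)
  have "weakly_holomorphic_modular_form (1 / 2) (principal_congruence_subgroup (2 * D))
      (\<lambda>\<tau>. e2pi (- (of_rat r ^ 2) * \<tau>) * g2_sum (of_rat r * \<tau> + of_rat s) \<tau>)"
    unfolding e by (rule g2_sum_at_rational_point[OF D rs[unfolded r s]])
  thus "\<exists>\<Gamma>. congruence_subgroup \<Gamma> \<and> weakly_holomorphic_modular_form (1 / 2) \<Gamma>
      (\<lambda>\<tau>. e2pi (- (of_rat r ^ 2) * \<tau>) * g2_sum (of_rat r * \<tau> + of_rat s) \<tau>)"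
    using principal_congruence_subgroup_congruence[of "2 * D"] D by auto
qed

end
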